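(* Suppose $X$ has an indefinite Wiener integral and let $\mathfrak c\in\mathfrak H$. Then, for every $r\in[0,T]$, the domain $D_r^{\mathfrak c}$ of the operator $\widetilde E^{\mathfrak c}[\,\cdot\,|\mathcal F_r^X]$ is given by $$D_r^{\mathfrak c}=\left\{\xi=\sum_{k=0}^\infty I_k(\mathfrak f_k)\in L^2_X:\ \sum_{k=0}^\infty k!\,\Vert\widetilde{\mathfrak f}^{\,r,\mathfrak c}_k\Vert^2_{\mathfrak H^{\otimes k}}<\infty\right\},$$ where $$\widetilde{\mathfrak f}^{\,r,\mathfrak c}_n=\sum_{k=n}^\infty\binom kn\,\mathbb I_r^{\otimes n}\,\mathfrak C_{r,k,n}\mathfrak f_k,\qquad \mathfrak C_{r,k,n}\mathfrak f_k=\langle\mathfrak f_k,\mathfrak c_r^{\otimes(k-n)}\rangle_{\mathfrak H^{\otimes(k-n)}},\qquad \mathfrak c_r=\mathbb I_r^*\mathfrak c-\mathfrak c.$$ Furthermore, for $\xi\in D_r^{\mathfrak c}$ with chaos decomposition $\xi=\sum_{k=0}^\infty I_k(\mathfrak f_k)$ we have $$\widetilde E^{\mathfrak c}\left[\xi\,|\,\mathcal F^X_r\right]=\sum_{k=0}^\infty I_k\left(\widetilde{\mathfrak f}^{\,r,\mathfrak c}_k\right).$$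
   Context: Let $T>0$ and let $X=(X_t)_{t\in[0,T]}$ be a measurable centered Gaussian process with $X_0=0$ on a complete probability space $(\Omega,\mathcal F,P)$, with covariance $R(t,s)=\mathbb E[X_tX_s]$. Let $(\mathcal F^X_t)_{t\in[0,T]}$ be the filtration generated by $X$ and $L^2_X=L^2(\Omega,\mathcal F^X_T,P)$. The first chaos $H_X$ is the closure in $L^2_X$ of $\mathrm{span}\{X_s:0\le s\le T\}$. The space of deterministic integrands $\mathfrak H=\mathfrak H_X$ is the Hilbert space obtained as closure (completion) of the linear span of the indicator functions $\mathbf 1_{(0,t]}$, $t\in[0,T]$, with inner product $\langle \mathbf 1_{(0,t]},\mathbf 1_{(0,s]}\rangle_{\mathfrak H}=R(t,s)$. The Wiener integral $I:\mathfrak H\to H_X$ is the unique linear isometry with $I(\mathbf 1_{(0,t]})=X_t$. For $h\in H_X$, the Wick exponential is $e^{\diamond h}=\exp\{h-\frac12\mathbb E[h^2]\}$. The $S$-transform of $\xi\in L^2_X$ is $(S\xi)(\mathfrak h)=\mathbb E[\xi e^{\diamond I(\mathfrak h)}]$, $\mathfrak h\in\mathfrak H$; it determines $\xi$ uniquely. $X$ has an indefinite Wiener integral if for every $r\in[0,T]$ there is a continuous linear operator $\mathbb I_r:\mathfrak H\to\mathfrak H$ with $\mathbb I_r(\mathbf 1_{(0,t]})=\mathbf 1_{(0,t\wedge r]}$ for all $t\in[0,T]$. In this case $\mathbb I_r^*$ denotes the adjoint and $\mathfrak h^r:=\mathbb I_r^*\mathfrak h$. For $r\in[0,T]$, $\mathfrak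 c\in\mathfrak H$, let $$D_r^{\mathfrak c}=\left\{\xi\in L^2_X:\ \exists\,\eta\in L^2_X\text{ such that }(S\xi)((\mathfrak h+\mathfrak c)^r-\mathfrak c)=(S\eta)(\mathfrak h)\ \ \forall\,\mathfrak h\in\mathfrak H\right\}.$$ For $\xi\in D_r^{\mathfrak c}$ the corresponding $\eta$ is unique and denoted $\widetilde E^{\mathfrak c}[\xi|\mathcal F^X_r]$ ($\mathfrak c$-shifted quasi-conditional expectation). Chaos decomposition: $\mathfrak H^{\tilde\otimes k}$ is the symmetric tensor product, a closed subspace of the Hilbert tensor power $\mathfrak H^{\otimes k}$ ($\mathfrak H^{\otimes 0}=\mathbb R$). $I_k$ denotes the multiple Wiener integral of order $k$, i.e. the linear map from $\mathfrak H^{\tilde\otimes k}$ onto the $k$th Wiener chaos of $X$ with $I_k(\mathfrak h^{\otimes k})=H_k(I(\mathfrak h))$ for $\Vert\mathfrak h\Vert_{\mathfrak H}=1$ ($H_k$ the $k$th, monic, Hermite polynomial), and $I_0$ is the identity on $\mathbb R$; it satisfies $\mathbb E[I_k(\mathfrak f)I_k(\mathfrak g)]=k!\langle\mathfrak f,\mathfrak g\rangle_{\mathfrak H^{\otimes k}}$. Every $\xi\in L^2_X$ has a unique chaos decomposition $\xi=\sum_{k=0}^\infty I_k(\mathfrak f_k)$ with $\mathfrak f_k\in\mathfrak H^{\tilde\otimes k}$. $\langle\mathfrak f_k,\mathfrak c_r^{\otimes(k-n)}\rangle_{\mathfrak H^{\otimes(k-n)}}\in\mathfrak H^{\tilde\otimes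 n}$ denotes the contraction of $k-n$ of the tensor factors of $\mathfrak f_k$ with $\mathfrak c_r^{\otimes(k-n)}$ (it is $\mathfrak f_k$ itself for $n=k$), and $\mathbb I_r^{\otimes n}$ is the $n$th tensor power of the operator $\mathbb I_r$ (the identity on $\mathbb R$ for $n=0$). The series defining $\widetilde{\mathfrak f}^{\,r,\mathfrak c}_n$ converges in $\mathfrak H^{\tilde\otimes n}$. *)

theory Defs
  imports "HOL-Probability.Probability" "HOL-Combinatorics.Permutations"
begin

section \<open>The process and its square integrable functionals\<close>

text \<open>Elements of the $L^2$ spaces are represented by functions, so every identity between
  random variables below is an almost sure one.\<close>

text \<open>The Dirac measure at 0 (zero variance) counts as a centered Gaussian law.\<close>

definition centered_gaussian :: "'w measure \<Rightarrow> ('w \<Rightarrow> real) \<Rightarrow> bool" where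
  "centered_gaussian M Y \<longleftrightarrow>
     (AE \<omega> in M. Y \<omega> = 0) \<or>
     (\<exists>\<sigma>>0. distributed M lborel Y (\<lambda>x. ennreal (normal_density 0 \<sigma> x)))"

definition measurable_centered_gaussian_process ::
    "'w measure \<Rightarrow> real \<Rightarrow> (real \<Rightarrow> 'w \<Rightarrow> real) \<Rightarrow> bool" where
  "measurable_centered_gaussian_process M T X \<longleftrightarrow>
     (\<lambda>(t, \<omega>). X t \<omega>) \<in> borel_measurable (restrict_space borel {0..T} \<Otimes>\<^sub>M M) \<and>
     (\<forall>S a. finite S \<longrightarrow> S \<subseteq> {0..T} \<longrightarrow> centered_gaussian M (\<lambda>\<omega>. \<Sum>t\<in>S. a t * X t \<omega>))"

definition covariance :: "'w measure \<Rightarrow> (real \<Rightarrow> 'w \<Rightarrow> real) \<Rightarrow> real \<Rightarrow> real \<Rightarrow> real" where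
  "covariance M X t s = (\<integral>\<omega>. X t \<omega> * X s \<omega> \<partial>M)"

definition process_filtration ::
    "'w measure \<Rightarrow> (real \<Rightarrow> 'w \<Rightarrow> real) \<Rightarrow> real \<Rightarrow> 'w measure" where
  "process_filtration M X r =
     sigma (space M) {X s -` B \<inter> space M |s B. s \<in> {0..r} \<and> B \<in> sets borel}"

definition L2X :: "'w measure \<Rightarrow> real \<Rightarrow> (real \<Rightarrow> 'w \<Rightarrow> real) \<Rightarrow> ('w \<Rightarrow> real) set" where
  "L2X M T X =
     {\<xi>. \<xi> \<in> borel_measurable (process_filtration M X T) \<and> integrable M (\<lambda>\<omega>. (\<xi> \<omega>)\<^sup>2)}"

definition L2_sums :: "'w measure \<Rightarrow> (nat \<Rightarrow> 'w \<Rightarrow> real) \<Rightarrow> ('w \<Rightarrow> real) \<Rightarrow> bool" where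
  "L2_sums M u \<xi> \<longleftrightarrow>
     (\<lambda>N. \<integral>\<^sup>+\<omega>. ennreal ((\<xi> \<omega> - (\<Sum>k<N. u k \<omega>))\<^sup>2) \<partial>M) \<longlonglongrightarrow> 0"

definition L2_closed_span ::
    "'w measure \<Rightarrow> real \<Rightarrow> (real \<Rightarrow> 'w \<Rightarrow> real) \<Rightarrow> ('w \<Rightarrow> real) set \<Rightarrow> ('w \<Rightarrow> real) set" where
  "L2_closed_span M T X G =
     {Y \<in> L2X M T X. \<forall>e>0. \<exists>S a. finite S \<and> S \<subseteq> G \<and>
        (\<integral>\<^sup>+\<omega>. ennreal ((Y \<omega> - (\<Sum>g\<in>S. a g * g \<omega>))\<^sup>2) \<partial>M) < e}"

definition first_chaos ::
    "'w measure \<Rightarrow> real \<Rightarrow> (real \<Rightarrow> 'w \<Rightarrow> real) \<Rightarrow> ('w \<Rightarrow> real) set" where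
  "first_chaos M T X = L2_closed_span M T X (X ` {0..T})"

section \<open>Deterministic integrands and the Wiener integral\<close>

definition step_functions :: "real \<Rightarrow> (real \<Rightarrow> real) set" where
  "step_functions T =
     {\<lambda>u. \<Sum>t\<in>S. a t * indicator {0<..t} u |S a. finite S \<and> S \<subseteq> {0..T}}"

text \<open>A Hilbert completion depends on \<open>X\<close> and is unique only up to isometric isomorphism. It is
  therefore given as a complete inner product space together with the canonical map \<open>emb\<close> from
  the linear span of the indicator functions onto a dense subspace. The map need not be injective,
  since the form induced by the covariance may be degenerate.\<close>

definition integrand_space ::
    "'w measure \<Rightarrow> real \<Rightarrow> (real \<Rightarrow> 'w \<Rightarrow> real) \<Rightarrow> ((real \<Rightarrow> real) \<Rightarrow> 'h::{real_inner,banach}) \<Rightarrow> bool"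
  where
  "integrand_space M T X emb \<longleftrightarrow>
     (\<forall>f\<in>step_functions T. \<forall>g\<in>step_functions T. \<forall>a b.
        emb (\<lambda>u. a * f u + b * g u) = a *\<^sub>R emb f + b *\<^sub>R emb g) \<and>
     (\<forall>t\<in>{0..T}. \<forall>s\<in>{0..T}.
        emb (indicator {0<..t}) \<bullet> emb (indicator {0<..s}) = covariance M X t s) \<and>
     closure (emb ` step_functions T) = UNIV"

definition wiener_integral ::
    "'w measure \<Rightarrow> real \<Rightarrow> (real \<Rightarrow> 'w \<Rightarrow> real) \<Rightarrow> ((real \<Rightarrow> real) \<Rightarrow> 'h::{real_inner,banach})
       \<Rightarrow> ('h \<Rightarrow> 'w \<Rightarrow> real) \<Rightarrow> bool" where
  "wiener_integral M T X emb I \<longleftrightarrow>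
     (\<forall>h. I h \<in> first_chaos M T X) \<and>
     (\<forall>g h a b. AE \<omega> in M. I (a *\<^sub>R g + b *\<^sub>R h) \<omega> = a * I g \<omega> + b * I h \<omega>) \<and>
     (\<forall>h. (\<integral>\<omega>. (I h \<omega>)\<^sup>2 \<partial>M) = (norm h)\<^sup>2) \<and>
     (\<forall>t\<in>{0..T}. AE \<omega> in M. I (emb (indicator {0<..t})) \<omega> = X t \<omega>)"

definition wick_exp :: "'w measure \<Rightarrow> ('w \<Rightarrow> real) \<Rightarrow> 'w \<Rightarrow> real" where
  "wick_exp M Y \<omega> = exp (Y \<omega> - 1 / 2 * (\<integral>\<omega>'. (Y \<omega>')\<^sup>2 \<partial>M))"

definition S_transform ::
    "'w measure \<Rightarrow> ('h \<Rightarrow> 'w \<Rightarrow> real) \<Rightarrow> ('w \<Rightarrow> real) \<Rightarrow> 'h \<Rightarrow> real" where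
  "S_transform M I \<xi> h = (\<integral>\<omega>. \<xi> \<omega> * wick_exp M (I h) \<omega> \<partial>M)"

section \<open>Quasi-conditional expectation\<close>

definition is_truncation ::
    "real \<Rightarrow> ((real \<Rightarrow> real) \<Rightarrow> 'h::{real_inner,banach}) \<Rightarrow> real \<Rightarrow> ('h \<Rightarrow> 'h) \<Rightarrow> bool" where
  "is_truncation T emb r A \<longleftrightarrow>
     bounded_linear A \<and>
     (\<forall>t\<in>{0..T}. A (emb (indicator {0<..t})) = emb (indicator {0<..min t r}))"

definition has_indefinite_wiener_integral ::
    "real \<Rightarrow> ((real \<Rightarrow> real) \<Rightarrow> 'h::{real_inner,banach}) \<Rightarrow> bool" where
  "has_indefinite_wiener_integral T emb \<longleftrightarrow> (\<forall>r\<in>{0..T}. \<exists>A. is_truncation T emb r A)"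

definition truncation ::
    "real \<Rightarrow> ((real \<Rightarrow> real) \<Rightarrow> 'h::{real_inner,banach}) \<Rightarrow> real \<Rightarrow> 'h \<Rightarrow> 'h" where
  "truncation T emb r = (THE A. is_truncation T emb r A)"

definition stopped ::
    "real \<Rightarrow> ((real \<Rightarrow> real) \<Rightarrow> 'h::{real_inner,banach}) \<Rightarrow> real \<Rightarrow> 'h \<Rightarrow> 'h" where
  "stopped T emb r h = adjoint (truncation T emb r) h"

definition is_qce ::
    "'w measure \<Rightarrow> real \<Rightarrow> (real \<Rightarrow> 'w \<Rightarrow> real) \<Rightarrow> ((real \<Rightarrow> real) \<Rightarrow> 'h::{real_inner,banach})
       \<Rightarrow> ('h \<Rightarrow> 'w \<Rightarrow> real) \<Rightarrow> 'h \<Rightarrow> real \<Rightarrow> ('w \<Rightarrow> real) \<Rightarrow> ('w \<Rightarrow> real) \<Rightarrow> bool" where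
  "is_qce M T X emb I c r \<xi> \<eta> \<longleftrightarrow>
     \<eta> \<in> L2X M T X \<and>
     (\<forall>h. S_transform M I \<xi> (stopped T emb r (h + c) - c) = S_transform M I \<eta> h)"

definition qce_domain ::
    "'w measure \<Rightarrow> real \<Rightarrow> (real \<Rightarrow> 'w \<Rightarrow> real) \<Rightarrow> ((real \<Rightarrow> real) \<Rightarrow> 'h::{real_inner,banach})
       \<Rightarrow> ('h \<Rightarrow> 'w \<Rightarrow> real) \<Rightarrow> 'h \<Rightarrow> real \<Rightarrow> ('w \<Rightarrow> real) set" where
  "qce_domain M T X emb I c r = {\<xi> \<in> L2X M T X. \<exists>\<eta>. is_qce M T X emb I c r \<xi> \<eta>}"

text \<open>Being determined by its S-transform, the quasi-conditional expectation is unique up to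
  almost sure equality, and the choice operator picks a version of it.\<close>

definition qce ::
    "'w measure \<Rightarrow> real \<Rightarrow> (real \<Rightarrow> 'w \<Rightarrow> real) \<Rightarrow> ((real \<Rightarrow> real) \<Rightarrow> 'h::{real_inner,banach})
       \<Rightarrow> ('h \<Rightarrow> 'w \<Rightarrow> real) \<Rightarrow> 'h \<Rightarrow> real \<Rightarrow> ('w \<Rightarrow> real) \<Rightarrow> 'w \<Rightarrow> real" where
  "qce M T X emb I c r \<xi> = (SOME \<eta>. is_qce M T X emb I c r \<xi> \<eta>)"

section \<open>Hilbert tensor powers and multiple Wiener integrals\<close>

text \<open>All Hilbert tensor powers of \<open>'h\<close> live as mutually orthogonal closed subspaces in one
  Hilbert space, their direct sum (the full Fock space). The elementary tensor
  $x_1 \otimes \cdots \otimes x_k$ is \<open>tens [x1, ..., xk]\<close>; in particular \<open>tens []\<close> is the unit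
  of the zeroth power, which is identified with the reals. The product formula for the inner
  products of elementary tensors makes \<open>tens\<close> multilinear and, together with totality, determines
  the space up to isometric isomorphism.\<close>

definition hilbert_tensor_powers ::
    "('h::{real_inner,banach} list \<Rightarrow> 't::{real_inner,banach}) \<Rightarrow> bool" where
  "hilbert_tensor_powers tens \<longleftrightarrow>
     (\<forall>xs ys. tens xs \<bullet> tens ys =
        (if length xs = length ys then (\<Prod>i<length xs. xs ! i \<bullet> ys ! i) else 0)) \<and>
     closure (span (range tens)) = UNIV"

definition symmetrized_tensor ::
    "('h::{real_inner,banach} list \<Rightarrow> 't::{real_inner,banach}) \<Rightarrow> 'h list \<Rightarrow> 't" where
  "symmetrized_tensor tens xs =
     (1 / fact (length xs)) *\<^sub>R
       (\<Sum>p | p permutes {..<length xs}. tens (permute_list p xs))"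

definition sym_power ::
    "('h::{real_inner,banach} list \<Rightarrow> 't::{real_inner,banach}) \<Rightarrow> nat \<Rightarrow> 't set" where
  "sym_power tens k = closure (span {symmetrized_tensor tens xs |xs. length xs = k})"

text \<open>The next two operators, originally defined on a single tensor power, are extended by zero to
  the other tensor powers so that they are determined as bounded operators on the whole space.\<close>

definition tensor_power_op ::
    "('h::{real_inner,banach} list \<Rightarrow> 't::{real_inner,banach}) \<Rightarrow> nat \<Rightarrow> ('h \<Rightarrow> 'h) \<Rightarrow> 't \<Rightarrow> 't" where
  "tensor_power_op tens n A =
     (THE B. bounded_linear B \<and>
        (\<forall>xs. B (tens xs) = (if length xs = n then tens (map A xs) else 0)))"

text \<open>Contraction of the last \<open>k - n\<close> factors of a tensor of order \<open>k\<close> with \<open>c\<close>; which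
  factors are contracted is immaterial for symmetric tensors.\<close>

definition contraction ::
    "('h::{real_inner,banach} list \<Rightarrow> 't::{real_inner,banach}) \<Rightarrow> nat \<Rightarrow> nat \<Rightarrow> 'h \<Rightarrow> 't \<Rightarrow> 't" where
  "contraction tens k n c =
     (THE B. bounded_linear B \<and>
        (\<forall>xs. B (tens xs) =
           (if length xs = k then (\<Prod>i=n..<k. xs ! i \<bullet> c) *\<^sub>R tens (take n xs) else 0)))"

text \<open>Monic (probabilists') Hermite polynomials.\<close>

fun hermite :: "nat \<Rightarrow> real \<Rightarrow> real" where
  "hermite 0 x = 1"
| "hermite (Suc 0) x = x"
| "hermite (Suc (Suc n)) x = x * hermite (Suc n) x - real (Suc n) * hermite n x"

text \<open>Order 0 is listed separately, since there may be no unit vector at all.\<close>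

definition wiener_chaos ::
    "'w measure \<Rightarrow> real \<Rightarrow> (real \<Rightarrow> 'w \<Rightarrow> real) \<Rightarrow> ('h::{real_inner,banach} \<Rightarrow> 'w \<Rightarrow> real)
       \<Rightarrow> nat \<Rightarrow> ('w \<Rightarrow> real) set" where
  "wiener_chaos M T X I k =
     L2_closed_span M T X
       (if k = 0 then {\<lambda>\<omega>. 1} else {\<lambda>\<omega>. hermite k (I h \<omega>) |h. norm h = 1})"

text \<open>The isometry property also supplies the continuity that is needed to determine \<open>J k\<close> from
  its values on the tensors \<open>tens (replicate k h)\<close>.\<close>

definition multiple_wiener_integral ::
    "'w measure \<Rightarrow> real \<Rightarrow> (real \<Rightarrow> 'w \<Rightarrow> real) \<Rightarrow> ('h::{real_inner,banach} \<Rightarrow> 'w \<Rightarrow> real)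
       \<Rightarrow> ('h list \<Rightarrow> 't::{real_inner,banach}) \<Rightarrow> (nat \<Rightarrow> 't \<Rightarrow> 'w \<Rightarrow> real) \<Rightarrow> bool" where
  "multiple_wiener_integral M T X I tens J \<longleftrightarrow>
     (\<forall>a. AE \<omega> in M. J 0 (a *\<^sub>R tens []) \<omega> = a) \<and>
     (\<forall>k.
       (\<forall>f\<in>sym_power tens k. J k f \<in> wiener_chaos M T X I k) \<and>
       (\<forall>Y\<in>wiener_chaos M T X I k. \<exists>f\<in>sym_power tens k. AE \<omega> in M. J k f \<omega> = Y \<omega>) \<and>
       (\<forall>f\<in>sym_power tens k. \<forall>g\<in>sym_power tens k. \<forall>a b.
          AE \<omega> in M. J k (a *\<^sub>R f + b *\<^sub>R g) \<omega> = a * J k f \<omega> + b * J k g \<omega>) \<and>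
       (\<forall>h. norm h = 1 \<longrightarrow>
          (AE \<omega> in M. J k (tens (replicate k h)) \<omega> = hermite k (I h \<omega>))) \<and>
       (\<forall>f\<in>sym_power tens k. \<forall>g\<in>sym_power tens k.
          (\<integral>\<omega>. J k f \<omega> * J k g \<omega> \<partial>M) = fact k * (f \<bullet> g)))"

definition chaos_decomposition ::
    "'w measure \<Rightarrow> ('h::{real_inner,banach} list \<Rightarrow> 't::{real_inner,banach})
       \<Rightarrow> (nat \<Rightarrow> 't \<Rightarrow> 'w \<Rightarrow> real) \<Rightarrow> ('w \<Rightarrow> real) \<Rightarrow> (nat \<Rightarrow> 't) \<Rightarrow> bool" where
  "chaos_decomposition M tens J \<xi> f \<longleftrightarrow>
     (\<forall>k. f k \<in> sym_power tens k) \<and> L2_sums M (\<lambda>k. J k (f k)) \<xi>"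

text \<open>The index \<open>j\<close> below is \<open>k - n\<close> in
  $\sum_{k \ge n} \binom{k}{n} \, \mathbb{I}_r^{\otimes n} \, \langle f_k, c_r^{\otimes (k-n)} \rangle$,
  where $c_r = \mathbb{I}_r^* c - c$.\<close>

definition qce_kernel ::
    "real \<Rightarrow> ((real \<Rightarrow> real) \<Rightarrow> 'h::{real_inner,banach}) \<Rightarrow> ('h list \<Rightarrow> 't::{real_inner,banach})
       \<Rightarrow> 'h \<Rightarrow> real \<Rightarrow> (nat \<Rightarrow> 't) \<Rightarrow> nat \<Rightarrow> 't" where
  "qce_kernel T emb tens c r f n =
     (\<Sum>j. real ((n + j) choose n) *\<^sub>R
        tensor_power_op tens n (truncation T emb r)
          (contraction tens (n + j) n (stopped T emb r c - c) (f (n + j))))"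

end

theory Submission
  imports Defs
begin

text \<open>The proof rests on one identity. If \<open>\<xi> = \<Sum>k. J k (f k)\<close>, then the $S$-transform of \<open>\<xi>\<close> at \<open>h\<close> is the
  series \<open>\<Sum>k. f k \<bullet> h\<^sup>\<otimes>\<^sup>k\<close> (lemma \<open>S_transform_chaos\<close>). The argument that defines the shifted
  quasi-conditional expectation is \<open>A\<^sup>* h + b\<close> with \<open>A\<close> the truncation and \<open>b = A\<^sup>* c - c\<close>, and a
  binomial expansion of \<open>(A\<^sup>* h + b)\<^sup>\<otimes>\<^sup>k\<close> against a symmetric tensor turns that series into
  \<open>\<Sum>n. F n \<bullet> h\<^sup>\<otimes>\<^sup>n\<close>, where \<open>F\<close> is precisely the kernel sequence of the theorem
  (\<open>shifted_kernel_series\<close>). So \<open>\<eta>\<close> is a quasi-conditional expectation of \<open>\<xi>\<close> if and only if the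
  $S$-transform of \<open>\<eta>\<close> is this second series. Replacing \<open>h\<close> by \<open>t h\<close> gives a power series in \<open>t\<close>,
  whose coefficients determine the kernels; hence \<open>\<eta>\<close> has the kernels \<open>F\<close>
  (\<open>is_qce_chaos\<close>). As \<open>\<Sum>n. J n (F n)\<close> converges in $L^2$ exactly when
  \<open>\<Sum>n. n! \<parallel>F n\<parallel>\<^sup>2\<close> is finite, this describes the domain and the value of the operator
  (\<open>qce_domain_iff\<close>). The interchange of the two summations is justified by the fact that
  \<open>\<parallel>f k\<parallel> x\<^sup>k\<close> is summable for every \<open>x\<close> once \<open>k! \<parallel>f k\<parallel>\<^sup>2\<close> is.

  Three foundations are needed.

  First, the operators behind the kernels must exist as bounded operators. The norm of a
  combination of elementary tensors is governed by a Gram matrix that is an entrywise product, so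
  the Schur product theorem bounds \<open>A\<^sup>\<otimes>\<^sup>n\<close> and the contractions on such combinations
  (\<open>gram_map_le\<close>, \<open>contraction_exists\<close>), and closing the graph extends them to the whole space.

  Second, the $S$-transform must be injective on the functionals of the process
  (\<open>S_transform_injective\<close>). If the exponential moments of \<open>\<xi>\<close> against all \<open>I h\<close> vanish, so do the
  ordinary moments, and hence the integrals against \<open>cos (I h)\<close> and \<open>sin (I h)\<close>. The uniqueness
  theorem for one-dimensional characteristic functions then replaces one trigonometric factor
  after another by an indicator of the value of the process at a time point, which yields all
  cylinder sets.

  Third, the chaos decomposition is derived from the generating function of the Hermite
  polynomials, whose partial sums are dominated by an exponential and therefore converge in $L^2$
  to the Wick exponential. Comparing coefficients gives the $S$-transform of \<open>J k f\<close> and the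
  orthogonality of chaoses of different order; the Riesz representation theorem then provides
  the kernels of an arbitrary square integrable functional, and injectivity of the $S$-transform shows
  that the resulting series sums to it (\<open>chaos_decomposition_exists\<close>).\<close>

section \<open>Hilbert spaces\<close>

text \<open>The representing vector is the minimiser of \<open>\<parallel>g\<parallel>\<^sup>2 - 2 \<phi> g\<close> over \<open>S\<close>. A minimising sequence is
  Cauchy by the parallelogram law, because the contributions of the linear form \<open>\<phi>\<close> cancel, and the
  representation property is the vanishing of the first variation at the minimum.\<close>

lemma riesz_on_subspace:
  fixes S :: "'t::{real_inner,banach} set" and \<phi> :: "'t \<Rightarrow> real"
  assumes cl: "closed S" and sub: "subspace S"
    and add: "\<And>g h. g \<in> S \<Longrightarrow> h \<in> S \<Longrightarrow> \<phi> (g + h) = \<phi> g + \<phi> h"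
    and scale: "\<And>a g. g \<in> S \<Longrightarrow> \<phi> (a *\<^sub>R g) = a * \<phi> g"
    and bound: "\<And>g. g \<in> S \<Longrightarrow> \<bar>\<phi> g\<bar> \<le> K * norm g"
  obtains f where "f \<in> S" "\<And>g. g \<in> S \<Longrightarrow> \<phi> g = f \<bullet> g"
proof -
  define F where "F g = (norm g)\<^sup>2 - 2 * \<phi> g" for g
  have F_lower: "- K\<^sup>2 \<le> F g" if "g \<in> S" for g
  proof -
    have "0 \<le> (norm g - K)\<^sup>2" by simp
    also have "\<dots> = (norm g)\<^sup>2 - 2 * (K * norm g) + K\<^sup>2" by (simp add: power2_diff)
    finally show ?thesis using bound[OF that] unfolding F_def by linarith
  qed
  define m where "m = Inf (F ` S)"
  have S0: "0 \<in> S" using sub by (simp add: subspace_0)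
  have bdd: "bdd_below (F ` S)" using F_lower by (auto intro!: bdd_belowI)
  have m_le: "m \<le> F g" if "g \<in> S" for g
    unfolding m_def using bdd that by (simp add: cINF_lower)
  have "\<exists>g\<in>S. F g < m + inverse (real (Suc n))" for n
  proof -
    have "Inf (F ` S) < m + inverse (real (Suc n))" by (simp add: m_def)
    then show ?thesis using cInf_less_iff[OF _ bdd] S0 by auto
  qed
  then obtain s where s: "\<And>n. s n \<in> S" "\<And>n. F (s n) < m + inverse (real (Suc n))"
    by metis
  have para: "(norm (g - h))\<^sup>2 \<le> 2 * (F g - m) + 2 * (F h - m)" if "g \<in> S" "h \<in> S" for g h
  proof -
    define w where "w = (1/2) *\<^sub>R (g + h)"
    have "w \<in> S" using that sub by (simp add: w_def subspace_add subspace_scale)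
    then have le: "m \<le> F w" by (rule m_le)
    have "\<phi> w = (\<phi> g + \<phi> h) / 2"
      using that sub by (simp add: w_def scale add subspace_add)
    moreover have "(norm w)\<^sup>2 = (norm (g + h))\<^sup>2 / 4"
      by (simp add: w_def power_divide)
    moreover have "(norm (g - h))\<^sup>2 + (norm (g + h))\<^sup>2 = 2 * (norm g)\<^sup>2 + 2 * (norm h)\<^sup>2"
      by (simp add: power2_norm_eq_inner inner_simps inner_commute)
    moreover have "d \<le> 2 * (a - 2 * p - m) + 2 * (b - 2 * q - m)"
      if "u = (p + q) / 2" "v = e / 4" "d + e = 2 * a + 2 * b" "m \<le> v - 2 * u"
      for a b d e p q u v :: real
      using that by (simp add: field_simps)
    ultimately show ?thesis using le unfolding F_def by blast
  qed
  have "Cauchy s"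
  proof (rule metric_CauchyI)
    fix e :: real assume "0 < e"
    then obtain N where N: "inverse (real (Suc N)) < e\<^sup>2 / 4"
      using reals_Archimedean[of "e\<^sup>2 / 4"] by auto
    show "\<exists>N. \<forall>m\<ge>N. \<forall>n\<ge>N. dist (s m) (s n) < e"
    proof (intro exI allI impI)
      fix i j assume "N \<le> i" "N \<le> j"
      then have "inverse (real (Suc i)) \<le> inverse (real (Suc N))"
        "inverse (real (Suc j)) \<le> inverse (real (Suc N))" by (auto simp: field_simps)
      then have "(norm (s i - s j))\<^sup>2 < e\<^sup>2"
        using para[OF s(1)[of i] s(1)[of j]] s(2)[of i] s(2)[of j] N by argo
      then show "dist (s i) (s j) < e"
        using \<open>0 < e\<close> by (simp add: dist_norm power2_less_imp_less)
    qed
  qed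
  then obtain f where f: "s \<longlonglongrightarrow> f" using Cauchy_convergent convergentD by blast
  have fS: "f \<in> S" using closed_sequentially[OF cl _ f] s(1) by blast
  have "(\<lambda>n. \<phi> (s n)) \<longlonglongrightarrow> \<phi> f"
  proof (rule LIM_zero_cancel, rule Lim_null_comparison)
    show "\<forall>\<^sub>F n in sequentially. norm (\<phi> (s n) - \<phi> f) \<le> K * norm (s n - f)"
    proof (intro always_eventually allI)
      fix n
      have "\<phi> (s n + (-1) *\<^sub>R f) = \<phi> (s n) - \<phi> f"
        using add[OF s(1)[of n] subspace_scale[OF sub fS, of "-1"]] scale[OF fS, of "-1"] by simp
      moreover have "s n + (-1) *\<^sub>R f \<in> S" using s(1) fS sub by (simp add: subspace_diff)
      ultimately show "norm (\<phi> (s n) - \<phi> f) \<le> K * norm (s n - f)"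
        using bound[of "s n + (-1) *\<^sub>R f"] by simp
    qed
    have "(\<lambda>n. norm (s n - f)) \<longlonglongrightarrow> 0" using f by (simp add: LIM_zero tendsto_norm_zero)
    then show "(\<lambda>n. K * norm (s n - f)) \<longlonglongrightarrow> 0" by (rule tendsto_mult_right_zero)
  qed
  then have "(\<lambda>n. F (s n)) \<longlonglongrightarrow> F f"
    unfolding F_def by (intro tendsto_intros f)
  moreover have "(\<lambda>n. m + inverse (real (Suc n))) \<longlonglongrightarrow> m + 0"
    by (intro tendsto_intros LIMSEQ_inverse_real_of_nat)
  ultimately have "F f \<le> m + 0"
    by (rule LIMSEQ_le) (use s(2) less_imp_le in blast)
  then have min: "F f \<le> F g" if "g \<in> S" for g using m_le[OF that] by linarith
  have "\<phi> g = f \<bullet> g" if g: "g \<in> S" for g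
  proof (cases "g = 0")
    case True
    then show ?thesis using scale[OF S0, of 0] by simp
  next
    case False
    define d where "d = f \<bullet> g - \<phi> g"
    \<comment> \<open>the minimiser of the quadratic polynomial \<open>t \<mapsto> F (f + t *\<^sub>R g)\<close>\<close>
    define t where "t = - d / (norm g)\<^sup>2"
    have "F f \<le> F (f + t *\<^sub>R g)" using fS g sub by (intro min) (simp add: subspace_add subspace_scale)
    also have "\<dots> = F f + t\<^sup>2 * (norm g)\<^sup>2 + 2 * t * d"
    proof -
      have "\<phi> (f + t *\<^sub>R g) = \<phi> f + t * \<phi> g"
        using fS g sub by (simp add: add scale subspace_scale)
      moreover have "(norm (f + t *\<^sub>R g))\<^sup>2 = (norm f)\<^sup>2 + 2 * t * (f \<bullet> g) + t\<^sup>2 * (norm g)\<^sup>2"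
        unfolding power2_norm_eq_inner
        by (simp add: inner_add inner_commute power2_eq_square algebra_simps)
      ultimately show ?thesis by (simp add: F_def d_def algebra_simps)
    qed
    also have "\<dots> = F f - d\<^sup>2 / (norm g)\<^sup>2"
      using False by (simp add: t_def power2_eq_square field_simps)
    finally have "d\<^sup>2 / (norm g)\<^sup>2 \<le> 0" by simp
    then have "d = 0" using False by (simp add: divide_le_0_iff)
    then show ?thesis by (simp add: d_def)
  qed
  with fS show thesis by (rule that)
qed

text \<open>The constant \<open>adjoint\<close> is a choice, so it is the Riesz representation theorem that makes it an
  adjoint on a Hilbert space of any dimension.\<close>

lemma inner_adjoint:
  fixes A :: "'a::{real_inner,banach} \<Rightarrow> 'b::real_inner"
  assumes "bounded_linear A"
  shows "x \<bullet> adjoint A y = A x \<bullet> y"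
proof -
  interpret A: bounded_linear A by fact
  obtain K where K: "\<And>x. norm (A x) \<le> norm x * K" using A.bounded by blast
  have "\<exists>w. \<forall>x. A x \<bullet> y = x \<bullet> w" for y
  proof -
    have "\<bar>A x \<bullet> y\<bar> \<le> K * norm y * norm x" for x
    proof -
      have "\<bar>A x \<bullet> y\<bar> \<le> norm (A x) * norm y" by (rule Cauchy_Schwarz_ineq2)
      also have "\<dots> \<le> norm x * K * norm y" using K by (simp add: mult_right_mono)
      finally show ?thesis by (simp add: ac_simps)
    qed
    then obtain f where "\<And>x. A x \<bullet> y = f \<bullet> x"
      using riesz_on_subspace[of UNIV "\<lambda>x. A x \<bullet> y"]
      by (auto simp: A.add A.scaleR inner_simps)
    then show ?thesis by (auto simp: inner_commute)
  qed
  then have "\<exists>A'. \<forall>x y. A x \<bullet> y = x \<bullet> A' y" by metis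
  then have "\<forall>x y. A x \<bullet> y = x \<bullet> adjoint A y" unfolding adjoint_def by (rule someI_ex)
  then show ?thesis by simp
qed

lemma subspace_closure:
  fixes S :: "'a::real_normed_vector set"
  assumes "subspace S"
  shows "subspace (closure S)"
proof (rule subspaceI)
  show "0 \<in> closure S" using subspace_0[OF assms] closure_subset by blast
next
  fix x y assume "x \<in> closure S" "y \<in> closure S"
  then obtain f g where "\<And>n. f n \<in> S" "f \<longlonglongrightarrow> x" "\<And>n. g n \<in> S" "g \<longlonglongrightarrow> y"
    unfolding closure_sequential by blast
  then have "\<forall>n. f n + g n \<in> S" "(\<lambda>n. f n + g n) \<longlonglongrightarrow> x + y"
    using assms by (auto simp: subspace_add intro: tendsto_add)
  then show "x + y \<in> closure S" unfolding closure_sequential by (intro exI conjI)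
next
  fix c x assume "x \<in> closure S"
  then obtain f where "\<And>n. f n \<in> S" "f \<longlonglongrightarrow> x"
    unfolding closure_sequential by blast
  then have "\<forall>n. c *\<^sub>R f n \<in> S" "(\<lambda>n. c *\<^sub>R f n) \<longlonglongrightarrow> c *\<^sub>R x"
    using assms by (auto simp: subspace_scale intro: tendsto_scaleR)
  then show "c *\<^sub>R x \<in> closure S" unfolding closure_sequential by (intro exI conjI)
qed

lemma bounded_linear_eq_on_total:
  assumes "bounded_linear A" "bounded_linear B" "closure (span G) = UNIV"
    and eq: "\<And>x. x \<in> G \<Longrightarrow> A x = B x"
  shows "A = B"
proof
  fix v
  have "A x = B x" if "x \<in> span G" for x
    by (rule linear_eq_on_span[OF assms(1,2)[THEN bounded_linear.linear] eq that])
  moreover have "continuous_on UNIV A" "continuous_on UNIV B"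
    using assms(1,2) by (simp_all add: linear_continuous_on)
  then have "closed {x. A x = B x}" by (rule closed_Collect_eq)
  ultimately have "closure (span G) \<subseteq> {x. A x = B x}" by (intro closure_minimal) auto
  then show "A v = B v" using assms(3) by auto
qed

lemma inner_eq_0_on_closure_span:
  fixes G :: "'a::real_inner set"
  assumes "f \<in> closure (span G)" "\<And>x. x \<in> G \<Longrightarrow> g \<bullet> x = 0"
  shows "g \<bullet> f = 0"
proof -
  have "span G \<subseteq> {x. g \<bullet> x = 0}"
    using assms(2) by (intro span_minimal) (auto simp: subspace_def inner_simps)
  moreover have "closed {x. g \<bullet> x = 0}" by (intro closed_Collect_eq continuous_intros)
  ultimately have "closure (span G) \<subseteq> {x. g \<bullet> x = 0}" by (rule closure_minimal)
  with assms(1) show ?thesis by auto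
qed

text \<open>A linear assignment on a total family that satisfies a norm bound on finite combinations has a
  bounded extension. Its graph is the closure of the span of the pairs \<open>(e x, \<phi> x)\<close>: the bound
  passes to the closure, so it makes this relation single valued, and completeness of the target
  makes it total. Linear relations between the \<open>e x\<close> do no harm, because the bound forces them on
  the \<open>\<phi> x\<close>.\<close>

lemma bounded_linear_extension:
  fixes e :: "'i \<Rightarrow> 'a::real_normed_vector" and \<phi> :: "'i \<Rightarrow> 'b::banach"
  assumes total: "closure (span (range e)) = UNIV"
    and bound: "\<And>F a. finite F \<Longrightarrow>
      norm (\<Sum>x\<in>F. a x *\<^sub>R \<phi> x) \<le> K * norm (\<Sum>x\<in>F. a x *\<^sub>R e x)"
  obtains B where "bounded_linear B" "\<And>x. B (e x) = \<phi> x" "\<And>v. norm (B v) \<le> K * norm v"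
proof -
  define G where "G = span (range (\<lambda>x. (e x, \<phi> x)))"
  have rep: "\<exists>F a. finite F \<and> p = (\<Sum>x\<in>F. a x *\<^sub>R (e x, \<phi> x))" if "p \<in> G" for p
    using that unfolding G_def
  proof (induction rule: span_induct_alt)
    case base
    then show ?case by (intro exI[of _ "{}"]) auto
  next
    case (step c p q)
    then obtain F a x where *: "finite F" "q = (\<Sum>x\<in>F. a x *\<^sub>R (e x, \<phi> x))" "p = (e x, \<phi> x)" by auto
    define a' where "a' y = (if y \<in> F then a y else 0) + (if y = x then c else 0)" for y
    have "(\<Sum>y\<in>insert x F. a' y *\<^sub>R (e y, \<phi> y)) =
      (\<Sum>y\<in>insert x F. (if y \<in> F then a y *\<^sub>R (e y, \<phi> y) else 0)) +
      (\<Sum>y\<in>insert x F. (if y = x then c *\<^sub>R (e y, \<phi> y) else 0))"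
      unfolding sum.distrib[symmetric]
      by (intro sum.cong) (auto simp: a'_def scaleR_add_left)
    also have "(\<Sum>y\<in>insert x F. (if y \<in> F then a y *\<^sub>R (e y, \<phi> y) else 0)) = q"
      unfolding *(2) using *(1) by (intro sum.mono_neutral_cong_right) auto
    also have "(\<Sum>y\<in>insert x F. (if y = x then c *\<^sub>R (e y, \<phi> y) else 0)) = c *\<^sub>R p"
      using *(1,3) by (simp add: sum.delta)
    finally have "c *\<^sub>R p + q = (\<Sum>y\<in>insert x F. a' y *\<^sub>R (e y, \<phi> y))" by simp
    then show ?case using *(1) by (intro exI[of _ "insert x F"] exI[of _ a']) auto
  qed
  have G_bound: "norm (snd p) \<le> K * norm (fst p)" if "p \<in> G" for p
    using rep[OF that] bound by (auto simp: fst_sum snd_sum)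
  define C where "C = closure G"
  have C_sub: "subspace C" unfolding C_def G_def by (intro subspace_closure) simp
  have "closed {p::'a\<times>'b. norm (snd p) \<le> K * norm (fst p)}"
    by (intro closed_Collect_le continuous_intros)
  then have "C \<subseteq> {p. norm (snd p) \<le> K * norm (fst p)}"
    unfolding C_def by (intro closure_minimal) (use G_bound in auto)
  then have C_bound: "norm v \<le> K * norm u" if "(u, v) \<in> C" for u v using that by auto
  have C_uniq: "v = w" if "(u, v) \<in> C" "(u, w) \<in> C" for u v w
    using C_bound[of 0 "v - w"] subspace_diff[OF C_sub that] by simp
  have C_total: "\<exists>v. (u, v) \<in> C" for u
  proof -
    have "u \<in> closure (span (range e))" using total by simp
    then obtain s where s: "\<And>n. s n \<in> span (range e)" "s \<longlonglongrightarrow> u"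
      unfolding closure_sequential by blast
    have "span (range e) = fst ` G"
    proof -
      have "range e = fst ` range (\<lambda>x. (e x, \<phi> x))" by (auto simp: image_image)
      then show ?thesis unfolding G_def by (simp add: linear_span_image linear_fst)
    qed
    then have "\<forall>n. \<exists>v. (s n, v) \<in> G" using s(1) by force
    then obtain v where v: "\<And>n. (s n, v n) \<in> G" by metis
    have le: "norm (v i - v j) \<le> K * norm (s i - s j)" for i j
    proof -
      have "(s i, v i) - (s j, v j) \<in> G" using v unfolding G_def by (intro span_diff)
      from G_bound[OF this] show ?thesis by simp
    qed
    have "Cauchy v"
    proof (rule metric_CauchyI)
      fix \<epsilon> :: real assume "0 < \<epsilon>"
      have "Cauchy s" using s(2) LIMSEQ_imp_Cauchy by blast
      moreover have "0 < \<epsilon> / (\<bar>K\<bar> + 1)" using \<open>0 < \<epsilon>\<close> by (simp add: add_nonneg_pos)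
      ultimately obtain N where N: "\<And>i j. i \<ge> N \<Longrightarrow> j \<ge> N \<Longrightarrow> dist (s i) (s j) < \<epsilon> / (\<bar>K\<bar> + 1)"
        unfolding Cauchy_def by metis
      show "\<exists>N. \<forall>m\<ge>N. \<forall>n\<ge>N. dist (v m) (v n) < \<epsilon>"
      proof (intro exI allI impI)
        fix i j assume "N \<le> i" "N \<le> j"
        have "dist (v i) (v j) \<le> K * norm (s i - s j)" using le by (simp add: dist_norm)
        also have "\<dots> \<le> (\<bar>K\<bar> + 1) * norm (s i - s j)" by (intro mult_right_mono) auto
        also have "\<dots> < \<epsilon>"
          using N[OF \<open>N \<le> i\<close> \<open>N \<le> j\<close>] by (simp add: dist_norm field_simps pos_less_divide_eq add_nonneg_pos)
        finally show "dist (v i) (v j) < \<epsilon>" .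
      qed
    qed
    then obtain w where "v \<longlonglongrightarrow> w" using Cauchy_convergent convergentD by blast
    then have "(\<lambda>n. (s n, v n)) \<longlonglongrightarrow> (u, w)" using s(2) by (intro tendsto_Pair)
    then have "(u, w) \<in> C" unfolding C_def closure_sequential
      using v by (intro exI[of _ "\<lambda>n. (s n, v n)"] conjI allI)
    then show ?thesis ..
  qed
  define B where "B u = (THE v. (u, v) \<in> C)" for u
  have B: "(u, B u) \<in> C" for u
    unfolding B_def using C_total[of u] C_uniq by (auto intro: theI)
  have B_eq: "B u = v" if "(u, v) \<in> C" for u v using C_uniq B that by blast
  have "bounded_linear B"
  proof (rule bounded_linear_intro)
    show "B (x + y) = B x + B y" for x y
      using subspace_add[OF C_sub B[of x] B[of y]] by (intro B_eq) simp
    show "B (r *\<^sub>R x) = r *\<^sub>R B x" for r x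
      using subspace_scale[OF C_sub B[of x], of r] by (intro B_eq) simp
    show "norm (B x) \<le> norm x * K" for x using C_bound[OF B[of x]] by (simp add: ac_simps)
  qed
  moreover have "B (e x) = \<phi> x" for x
    by (rule B_eq) (auto simp: C_def G_def intro!: subsetD[OF closure_subset] span_base)
  moreover have "norm (B v) \<le> K * norm v" for v using C_bound[OF B] .
  ultimately show thesis by (rule that)
qed

lemma norm_sum_power2:
  fixes g :: "'j \<Rightarrow> 'v::real_inner"
  shows "(norm (\<Sum>j\<in>F. g j))\<^sup>2 = (\<Sum>j\<in>F. \<Sum>l\<in>F. g j \<bullet> g l)"
  unfolding power2_norm_eq_inner inner_sum_left by (simp add: inner_sum_right)

text \<open>The entrywise product of a Gram matrix with a positive semidefinite matrix is positive
  semidefinite. In the induction, the direction \<open>u\<close> of one vector is split off from all of them: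
  the components along \<open>u\<close> contribute a value of the quadratic form of \<open>q\<close>, and the remainders
  vanish on one more index.\<close>

lemma schur_product_nonneg:
  fixes g :: "'j \<Rightarrow> 'v::real_inner" and q :: "'j \<Rightarrow> 'j \<Rightarrow> real"
  assumes fin: "finite F" and q: "\<And>b. 0 \<le> (\<Sum>j\<in>F. \<Sum>l\<in>F. b j * b l * q j l)"
  shows "0 \<le> (\<Sum>j\<in>F. \<Sum>l\<in>F. (g j \<bullet> g l) * q j l)"
proof -
  have "0 \<le> (\<Sum>j\<in>F. \<Sum>l\<in>F. (g j \<bullet> g l) * q j l)"
    if "finite D" "{j\<in>F. g j \<noteq> 0} \<subseteq> D" for D and g :: "'j \<Rightarrow> 'v"
    using that
  proof (induction D arbitrary: g rule: finite_induct)
    case empty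
    then have "g j = 0" if "j \<in> F" for j using that by auto
    then show ?case by simp
  next
    case (insert i D)
    show ?case
    proof (cases "g i = 0")
      case True
      then show ?thesis using insert by (intro insert.IH) auto
    next
      case False
      define u where "u = sgn (g i)"
      have uu: "u \<bullet> u = 1" using False by (simp add: u_def norm_sgn flip: power2_norm_eq_inner)
      define g' where "g' j = g j - (g j \<bullet> u) *\<^sub>R u" for j
      have "g i \<bullet> u = norm (g i)"
        using False by (simp add: u_def sgn_div_norm flip: power2_norm_eq_inner)
          (simp add: power2_eq_square)
      then have "g i = (g i \<bullet> u) *\<^sub>R u"
        using False by (simp add: u_def sgn_div_norm)
      then have "{j\<in>F. g' j \<noteq> 0} \<subseteq> D" using insert.prems by (auto simp: g'_def)
      then have "0 \<le> (\<Sum>j\<in>F. \<Sum>l\<in>F. (g' j \<bullet> g' l) * q j l)" by (rule insert.IH)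
      moreover have "0 \<le> (\<Sum>j\<in>F. \<Sum>l\<in>F. (g j \<bullet> u) * (g l \<bullet> u) * q j l)" by (rule q)
      moreover have "g j \<bullet> g l = g' j \<bullet> g' l + (g j \<bullet> u) * (g l \<bullet> u)" for j l
        by (simp add: g'_def inner_simps uu inner_commute)
      ultimately show ?thesis by (simp add: distrib_right sum.distrib)
    qed
  qed
  from this[of F g] fin show ?thesis by auto
qed

section \<open>Operators on tensor powers\<close>

locale tensor_powers =
  fixes tens :: "'h::{real_inner,banach} list \<Rightarrow> 't::{real_inner,banach}"
  assumes tens: "hilbert_tensor_powers tens"
begin

lemma inner_tens:
  "tens xs \<bullet> tens ys = (if length xs = length ys then (\<Prod>i<length xs. xs ! i \<bullet> ys ! i) else 0)"
  using tens unfolding hilbert_tensor_powers_def by blast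

lemma closure_span_tens: "closure (span (range tens)) = UNIV"
  using tens unfolding hilbert_tensor_powers_def by blast

lemma inner_tens_length_neq [simp]: "length xs \<noteq> length ys \<Longrightarrow> tens xs \<bullet> tens ys = 0"
  by (simp add: inner_tens)

lemma inner_tens_Nil [simp]: "tens [] \<bullet> tens [] = 1"
  by (simp add: inner_tens)

lemma inner_tens_Cons [simp]: "tens (x # xs) \<bullet> tens (y # ys) = (x \<bullet> y) * (tens xs \<bullet> tens ys)"
  by (simp add: inner_tens prod.lessThan_Suc_shift del: prod.lessThan_Suc)

lemma inner_tens_append:
  "length xs = length ys \<Longrightarrow>
    tens (xs @ xs') \<bullet> tens (ys @ ys') = (tens xs \<bullet> tens ys) * (tens xs' \<bullet> tens ys')"
  by (induction xs ys rule: list_induct2) auto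

lemma inner_tens_replicate [simp]:
  "tens (replicate k g) \<bullet> tens (replicate k h) = (g \<bullet> h) ^ k"
  by (induction k) auto

lemma norm_tens_replicate [simp]: "norm (tens (replicate k h)) = norm h ^ k"
  by (simp add: norm_eq_sqrt_inner real_sqrt_power)

lemma tens_replicate_scaleR: "tens (replicate k (a *\<^sub>R h)) = a ^ k *\<^sub>R tens (replicate k h)"
proof -
  have "(norm (tens (replicate k (a *\<^sub>R h)) - a ^ k *\<^sub>R tens (replicate k h)))\<^sup>2 = 0"
    unfolding power2_norm_eq_inner by (simp add: inner_diff power_mult_distrib)
  then show ?thesis by simp
qed

lemma sym_power_closed: "closed (sym_power tens k)"
  by (simp add: sym_power_def)

lemma sym_power_subspace: "subspace (sym_power tens k)"
  unfolding sym_power_def by (intro subspace_closure subspace_span)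

lemma tpow_in_sym_power: "tens (replicate k h) \<in> sym_power tens k"
proof -
  have "permute_list p (replicate k h) = replicate k h" if "p permutes {..<k}" for p
    using that by (intro nth_equalityI) (auto simp: permute_list_nth permutes_in_image[of p "{..<k}", simplified])
  then have "(\<Sum>p | p permutes {..<k}. tens (permute_list p (replicate k h))) =
      (\<Sum>p | p permutes {..<k}. tens (replicate k h))" by simp
  also have "\<dots> = fact k *\<^sub>R tens (replicate k h)"
    by (simp add: card_permutations[of "{..<k}" k] sum_constant_scaleR)
  finally have "symmetrized_tensor tens (replicate k h) = tens (replicate k h)"
    by (simp add: symmetrized_tensor_def)
  then have "tens (replicate k h) \<in> {symmetrized_tensor tens xs |xs. length xs = k}"
    by (metis (mono_tags, lifting) length_replicate mem_Collect_eq)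
  then show ?thesis unfolding sym_power_def by (intro subsetD[OF closure_subset] span_base)
qed

lemma norm_sum_fixed_length_le:
  assumes "finite F"
  shows "norm (\<Sum>x\<in>{x\<in>F. length x = m}. a x *\<^sub>R tens x) \<le> norm (\<Sum>x\<in>F. a x *\<^sub>R tens x)"
proof -
  let ?u = "\<Sum>x\<in>{x\<in>F. length x = m}. a x *\<^sub>R tens x" and ?v = "\<Sum>x\<in>{x\<in>F. length x \<noteq> m}. a x *\<^sub>R tens x"
  have "(\<Sum>x\<in>F. a x *\<^sub>R tens x) = ?u + ?v"
    using assms by (subst sum.union_disjoint[symmetric]) (auto intro!: sum.cong)
  moreover have "?u \<bullet> ?v = 0"
    unfolding inner_sum_left inner_sum_right by (intro sum.neutral) auto
  then have "(norm (?u + ?v))\<^sup>2 = (norm ?u)\<^sup>2 + (norm ?v)\<^sup>2"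
    by (simp add: power2_norm_eq_inner inner_add inner_commute)
  then have "(norm ?u)\<^sup>2 \<le> (norm (?u + ?v))\<^sup>2" by simp
  then have "norm ?u \<le> norm (?u + ?v)" by (rule power2_le_imp_le) simp
  ultimately show ?thesis by simp
qed

text \<open>The operators on tensor powers are definite descriptions of bounded operators that act on one
  tensor power and vanish on the others. Totality of the elementary tensors gives uniqueness, and a
  bound on combinations of tensors of the one relevant length suffices for existence, since
  tensors of different length are orthogonal.\<close>

lemma operator_on_fixed_length:
  assumes bound: "\<And>F a. finite F \<Longrightarrow> (\<And>x. x \<in> F \<Longrightarrow> length x = m) \<Longrightarrow>
      norm (\<Sum>x\<in>F. a x *\<^sub>R \<phi> x) \<le> K * norm (\<Sum>x\<in>F. a x *\<^sub>R tens x)"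
    and "0 \<le> K"
  defines "P \<equiv> \<lambda>B::'t \<Rightarrow> 't. bounded_linear B \<and> (\<forall>xs. B (tens xs) = (if length xs = m then \<phi> xs else 0))"
  shows "P (THE B. P B)" "norm ((THE B. P B) v) \<le> K * norm v"
proof -
  define \<psi> where "\<psi> xs = (if length xs = m then \<phi> xs else 0)" for xs
  have "norm (\<Sum>x\<in>F. a x *\<^sub>R \<psi> x) \<le> K * norm (\<Sum>x\<in>F. a x *\<^sub>R tens x)" if "finite F" for F a
  proof -
    have "(\<Sum>x\<in>F. a x *\<^sub>R \<psi> x) = (\<Sum>x\<in>{x\<in>F. length x = m}. a x *\<^sub>R \<phi> x)"
      using that by (intro sum.mono_neutral_cong_right) (auto simp: \<psi>_def)
    also have "norm \<dots> \<le> K * norm (\<Sum>x\<in>{x\<in>F. length x = m}. a x *\<^sub>R tens x)"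
      using that by (intro bound) auto
    also have "\<dots> \<le> K * norm (\<Sum>x\<in>F. a x *\<^sub>R tens x)"
      using that \<open>0 \<le> K\<close> by (intro mult_left_mono norm_sum_fixed_length_le)
    finally show ?thesis .
  qed
  from bounded_linear_extension[OF closure_span_tens this]
  obtain B where B: "bounded_linear B" "\<And>x. B (tens x) = \<psi> x" "\<And>v. norm (B v) \<le> K * norm v"
    by blast
  have "P B" using B by (simp add: P_def \<psi>_def)
  moreover have "B' = B" if "P B'" for B'
    using that B closure_span_tens
    by (intro bounded_linear_eq_on_total[of B' B "range tens"]) (auto simp: P_def \<psi>_def)
  ultimately have "(THE B. P B) = B" by (rule the_equality)
  with \<open>P B\<close> B(3) show "P (THE B. P B)" "norm ((THE B. P B) v) \<le> K * norm v" by simp_all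
qed

text \<open>Boundedness of \<open>A\<^sup>\<otimes>\<^sup>n\<close> on combinations of elementary tensors. Both Gram matrices are entrywise
  products, so the factors can be compared one at a time: the Schur product theorem replaces \<open>A\<close> on
  the first factor by the constant \<open>K\<^sup>2\<close> and, by induction, on the remaining ones.\<close>

lemma gram_map_le:
  assumes A: "bounded_linear A" and K: "\<And>x. norm (A x) \<le> K * norm x"
    and "finite F" "\<And>j. j \<in> F \<Longrightarrow> length (x j) = n"
  shows "(\<Sum>j\<in>F. \<Sum>l\<in>F. b j * b l * (tens (map A (x j)) \<bullet> tens (map A (x l))))
    \<le> (K\<^sup>2) ^ n * (\<Sum>j\<in>F. \<Sum>l\<in>F. b j * b l * (tens (x j) \<bullet> tens (x l)))"
  using assms(4)
proof (induction n arbitrary: x b)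
  case 0
  then have "x j = []" if "j \<in> F" for j using that by simp
  then show ?case by simp
next
  case (Suc n)
  interpret A: bounded_linear A by fact
  define y z where "y j = hd (x j)" and "z j = tl (x j)" for j
  have x: "x j = y j # z j" if "j \<in> F" for j
    using Suc.prems[OF that] by (cases "x j") (auto simp: y_def z_def)
  have z: "length (z j) = n" if "j \<in> F" for j using Suc.prems[OF that] by (simp add: z_def)
  let ?T = "\<lambda>j l. tens (z j) \<bullet> tens (z l)"
  let ?T' = "\<lambda>j l. tens (map A (z j)) \<bullet> tens (map A (z l))"
  \<comment> \<open>the first factor: \<open>K\<^sup>2 \<langle>y, y'\<rangle> - \<langle>A y, A y'\<rangle>\<close> is a positive semidefinite form\<close>
  have "0 \<le> (\<Sum>j\<in>F. \<Sum>l\<in>F. ((b j *\<^sub>R tens (map A (z j))) \<bullet> (b l *\<^sub>R tens (map A (z l))))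
      * (K\<^sup>2 * (y j \<bullet> y l) - A (y j) \<bullet> A (y l)))"
  proof (rule schur_product_nonneg[OF assms(3)])
    fix d :: "'a \<Rightarrow> real"
    let ?s = "\<Sum>j\<in>F. d j *\<^sub>R y j"
    have "(norm (A ?s))\<^sup>2 \<le> (K * norm ?s)\<^sup>2"
      using K[of ?s] by (intro power_mono) auto
    then have "0 \<le> K\<^sup>2 * (norm ?s)\<^sup>2 - (norm (\<Sum>j\<in>F. d j *\<^sub>R A (y j)))\<^sup>2"
      by (simp add: A.sum A.scaleR power_mult_distrib)
    also have "\<dots> = (\<Sum>j\<in>F. \<Sum>l\<in>F. d j * d l * (K\<^sup>2 * (y j \<bullet> y l) - A (y j) \<bullet> A (y l)))"
      unfolding norm_sum_power2 sum_distrib_left sum_subtractf[symmetric]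
      by (intro sum.cong refl) (simp add: algebra_simps)
    finally show "0 \<le> (\<Sum>j\<in>F. \<Sum>l\<in>F. d j * d l * (K\<^sup>2 * (y j \<bullet> y l) - A (y j) \<bullet> A (y l)))" .
  qed
  then have 1: "(\<Sum>j\<in>F. \<Sum>l\<in>F. b j * b l * ((A (y j) \<bullet> A (y l)) * ?T' j l))
      \<le> (\<Sum>j\<in>F. \<Sum>l\<in>F. b j * b l * (K\<^sup>2 * (y j \<bullet> y l) * ?T' j l))"
    by (simp add: algebra_simps sum_subtractf)
  \<comment> \<open>the remaining factors: positivity is the induction hypothesis\<close>
  have "0 \<le> (\<Sum>j\<in>F. \<Sum>l\<in>F. ((b j *\<^sub>R y j) \<bullet> (b l *\<^sub>R y l)) * ((K\<^sup>2) ^ n * ?T j l - ?T' j l))"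
  proof (rule schur_product_nonneg[OF assms(3)])
    fix d :: "'a \<Rightarrow> real"
    show "0 \<le> (\<Sum>j\<in>F. \<Sum>l\<in>F. d j * d l * ((K\<^sup>2) ^ n * ?T j l - ?T' j l))"
      using Suc.IH[of z d, OF z] by (simp add: right_diff_distrib sum_subtractf sum_distrib_left ac_simps)
  qed
  then have "(\<Sum>j\<in>F. \<Sum>l\<in>F. b j * b l * ((y j \<bullet> y l) * ?T' j l))
      \<le> (\<Sum>j\<in>F. \<Sum>l\<in>F. b j * b l * ((y j \<bullet> y l) * ((K\<^sup>2) ^ n * ?T j l)))"
    by (simp add: algebra_simps sum_subtractf)
  then have "K\<^sup>2 * (\<Sum>j\<in>F. \<Sum>l\<in>F. b j * b l * ((y j \<bullet> y l) * ?T' j l))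
      \<le> K\<^sup>2 * (\<Sum>j\<in>F. \<Sum>l\<in>F. b j * b l * ((y j \<bullet> y l) * ((K\<^sup>2) ^ n * ?T j l)))"
    by (rule mult_left_mono) simp
  with 1 have "(\<Sum>j\<in>F. \<Sum>l\<in>F. b j * b l * ((A (y j) \<bullet> A (y l)) * ?T' j l))
      \<le> (K\<^sup>2) ^ Suc n * (\<Sum>j\<in>F. \<Sum>l\<in>F. b j * b l * ((y j \<bullet> y l) * ?T j l))"
    by (simp add: sum_distrib_left ac_simps)
  then show ?case by (simp add: x cong: sum.cong)
qed

lemma tensor_power_op_exists:
  assumes A: "bounded_linear A" and K: "0 \<le> K" "\<And>x. norm (A x) \<le> K * norm x"
  shows bounded_linear_tensor_power_op: "bounded_linear (tensor_power_op tens n A)"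
    and tensor_power_op_tens:
      "tensor_power_op tens n A (tens xs) = (if length xs = n then tens (map A xs) else 0)"
    and norm_tensor_power_op_le: "norm (tensor_power_op tens n A v) \<le> K ^ n * norm v"
proof -
  have "norm (\<Sum>x\<in>F. a x *\<^sub>R tens (map A x)) \<le> K ^ n * norm (\<Sum>x\<in>F. a x *\<^sub>R tens x)"
    if "finite F" "\<And>x. x \<in> F \<Longrightarrow> length x = n" for F a
  proof -
    have "(norm (\<Sum>x\<in>F. a x *\<^sub>R tens (map A x)))\<^sup>2 \<le> (K\<^sup>2) ^ n * (norm (\<Sum>x\<in>F. a x *\<^sub>R tens x))\<^sup>2"
      using gram_map_le[OF A K(2), of F "\<lambda>x. x" n a] that
      unfolding norm_sum_power2 by (simp add: ac_simps)
    also have "\<dots> = (K ^ n * norm (\<Sum>x\<in>F. a x *\<^sub>R tens x))\<^sup>2"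
      by (simp add: power_mult_distrib mult.commute flip: power_mult)
    finally show ?thesis by (rule power2_le_imp_le) (use K(1) in simp)
  qed
  note * = operator_on_fixed_length[of n "\<lambda>x. tens (map A x)" "K ^ n", OF this]
  show "bounded_linear (tensor_power_op tens n A)"
    "tensor_power_op tens n A (tens xs) = (if length xs = n then tens (map A xs) else 0)"
    "norm (tensor_power_op tens n A v) \<le> K ^ n * norm v"
    unfolding tensor_power_op_def using * K(1) by simp_all
qed

text \<open>An elementary tensor is cut into its first \<open>n\<close> and its last \<open>k - n\<close> factors. Contraction pairs the
  last part with the fixed tensor \<open>e\<close>, a power of \<open>c\<close>, and the Cauchy-Schwarz inequality says that
  \<open>\<parallel>e\<parallel>\<^sup>2 \<langle>d, d'\<rangle> - \<langle>d, e\<rangle> \<langle>d', e\<rangle>\<close> is positive semidefinite; the Schur product theorem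
  adds the first part.\<close>

lemma contraction_exists:
  assumes "n \<le> k"
  shows bounded_linear_contraction: "bounded_linear (contraction tens k n c)"
    and contraction_tens: "contraction tens k n c (tens xs) =
      (if length xs = k then (\<Prod>i=n..<k. xs ! i \<bullet> c) *\<^sub>R tens (take n xs) else 0)"
    and norm_contraction_le: "norm (contraction tens k n c v) \<le> norm c ^ (k - n) * norm v"
proof -
  define e where "e = tens (replicate (k - n) c)"
  have prod_eq: "(\<Prod>i=n..<k. xs ! i \<bullet> c) = tens (drop n xs) \<bullet> e" if "length xs = k" for xs
  proof -
    have "(\<Prod>i=n..<k. xs ! i \<bullet> c) = (\<Prod>i<k-n. xs ! (n + i) \<bullet> c)"
      using assms by (intro prod.reindex_bij_witness[of _ "\<lambda>i. n + i" "\<lambda>i. i - n"]) auto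
    then show ?thesis using that assms by (auto simp: e_def inner_tens intro!: prod.cong)
  qed
  have split: "tens x \<bullet> tens y = (tens (take n x) \<bullet> tens (take n y)) * (tens (drop n x) \<bullet> tens (drop n y))"
    if "length x = k" "length y = k" for x y
    using inner_tens_append[of "take n x" "take n y" "drop n x" "drop n y"] that by simp
  have "norm (\<Sum>x\<in>F. a x *\<^sub>R (\<Prod>i=n..<k. x ! i \<bullet> c) *\<^sub>R tens (take n x))
      \<le> norm c ^ (k - n) * norm (\<Sum>x\<in>F. a x *\<^sub>R tens x)"
    if F: "finite F" "\<And>x. x \<in> F \<Longrightarrow> length x = k" for F a
  proof -
    let ?d = "\<lambda>x. tens (drop n x)" and ?g = "\<lambda>x. a x *\<^sub>R tens (take n x)"
    have "0 \<le> (\<Sum>x\<in>F. \<Sum>y\<in>F. (?g x \<bullet> ?g y) *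
        ((norm e)\<^sup>2 * (?d x \<bullet> ?d y) - (?d x \<bullet> e) * (?d y \<bullet> e)))"
    proof (rule schur_product_nonneg[OF F(1)])
      fix b :: "'h list \<Rightarrow> real"
      let ?s = "\<Sum>x\<in>F. b x *\<^sub>R ?d x"
      have "(?s \<bullet> e)\<^sup>2 \<le> (norm e)\<^sup>2 * (norm ?s)\<^sup>2"
        using Cauchy_Schwarz_ineq[of ?s e] by (simp add: power2_norm_eq_inner mult.commute)
      then have "0 \<le> (norm e)\<^sup>2 * (norm ?s)\<^sup>2 - (?s \<bullet> e) * (?s \<bullet> e)" by (simp add: power2_eq_square)
      also have "\<dots> = (\<Sum>x\<in>F. \<Sum>y\<in>F. b x * b y *
          ((norm e)\<^sup>2 * (?d x \<bullet> ?d y) - (?d x \<bullet> e) * (?d y \<bullet> e)))"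
        unfolding norm_sum_power2 inner_sum_left sum_product
        unfolding sum_distrib_left sum_subtractf[symmetric]
        by (intro sum.cong refl) (simp add: algebra_simps)
      finally show "0 \<le> (\<Sum>x\<in>F. \<Sum>y\<in>F. b x * b y *
          ((norm e)\<^sup>2 * (?d x \<bullet> ?d y) - (?d x \<bullet> e) * (?d y \<bullet> e)))" .
    qed
    also have "\<dots> = (norm e)\<^sup>2 * (norm (\<Sum>x\<in>F. a x *\<^sub>R tens x))\<^sup>2 -
        (norm (\<Sum>x\<in>F. a x *\<^sub>R (\<Prod>i=n..<k. x ! i \<bullet> c) *\<^sub>R tens (take n x)))\<^sup>2"
      unfolding norm_sum_power2 sum_distrib_left sum_subtractf[symmetric]
      by (intro sum.cong refl) (simp add: F(2) split prod_eq algebra_simps)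
    finally have "(norm (\<Sum>x\<in>F. a x *\<^sub>R (\<Prod>i=n..<k. x ! i \<bullet> c) *\<^sub>R tens (take n x)))\<^sup>2
        \<le> (norm e * norm (\<Sum>x\<in>F. a x *\<^sub>R tens x))\<^sup>2" by (simp add: power_mult_distrib)
    then have "norm (\<Sum>x\<in>F. a x *\<^sub>R (\<Prod>i=n..<k. x ! i \<bullet> c) *\<^sub>R tens (take n x))
        \<le> norm e * norm (\<Sum>x\<in>F. a x *\<^sub>R tens x)" by (rule power2_le_imp_le) simp
    then show ?thesis by (simp add: e_def)
  qed
  note * = operator_on_fixed_length[of k "\<lambda>x. (\<Prod>i=n..<k. x ! i \<bullet> c) *\<^sub>R tens (take n x)"
      "norm c ^ (k - n)", OF this]
  show "bounded_linear (contraction tens k n c)"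
    "contraction tens k n c (tens xs) =
      (if length xs = k then (\<Prod>i=n..<k. xs ! i \<bullet> c) *\<^sub>R tens (take n xs) else 0)"
    "norm (contraction tens k n c v) \<le> norm c ^ (k - n) * norm v"
    unfolding contraction_def using * by simp_all
qed

end

section \<open>Square integrable functions\<close>

definition sq_integrable :: "'w measure \<Rightarrow> ('w \<Rightarrow> real) \<Rightarrow> bool" where
  "sq_integrable M f \<longleftrightarrow> f \<in> borel_measurable M \<and> integrable M (\<lambda>w. (f w)\<^sup>2)"

lemma sq_integrable_measurable [measurable_dest]:
  "sq_integrable M f \<Longrightarrow> f \<in> borel_measurable M"
  by (simp add: sq_integrable_def)

lemma sq_integrable_mult:
  assumes f: "sq_integrable M f" and g: "sq_integrable M g"
  shows "integrable M (\<lambda>w. f w * g w)"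
proof (rule Bochner_Integration.integrable_bound)
  show "integrable M (\<lambda>w. (f w)\<^sup>2 + (g w)\<^sup>2)"
    using f g by (auto simp: sq_integrable_def)
  show "(\<lambda>w. f w * g w) \<in> borel_measurable M" using f g by measurable
  have "\<bar>a * b\<bar> \<le> a\<^sup>2 + b\<^sup>2" for a b :: real
  proof -
    have "2 * \<bar>a * b\<bar> \<le> a\<^sup>2 + b\<^sup>2"
      using sum_squares_bound[of "\<bar>a\<bar>" "\<bar>b\<bar>"] by (simp add: abs_mult mult.assoc)
    then show ?thesis using abs_ge_zero[of "a * b"] by argo
  qed
  then show "AE w in M. norm (f w * g w) \<le> norm ((f w)\<^sup>2 + (g w)\<^sup>2)"
    by (auto intro!: AE_I2)
qed

lemma sq_integrable_scale:
  "sq_integrable M f \<Longrightarrow> sq_integrable M (\<lambda>w. a * f w)"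
  unfolding sq_integrable_def by (auto simp: power_mult_distrib)

lemma sq_integrable_add:
  assumes f: "sq_integrable M f" and g: "sq_integrable M g"
  shows "sq_integrable M (\<lambda>w. f w + g w)"
proof -
  have "integrable M (\<lambda>w. (f w)\<^sup>2 + 2 * (f w * g w) + (g w)\<^sup>2)"
    using f g sq_integrable_mult[OF f g] by (auto simp: sq_integrable_def)
  moreover have "(f w + g w)\<^sup>2 = (f w)\<^sup>2 + 2 * (f w * g w) + (g w)\<^sup>2" for w
    by (simp add: power2_sum)
  moreover have "(\<lambda>w. f w + g w) \<in> borel_measurable M" using f g by measurable
  ultimately show ?thesis by (simp add: sq_integrable_def)
qed

lemma sq_integrable_diff:
  assumes "sq_integrable M f" "sq_integrable M g"
  shows "sq_integrable M (\<lambda>w. f w - g w)"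
  using sq_integrable_add[OF assms(1) sq_integrable_scale[OF assms(2), of "-1"]] by simp

lemma sq_integrable_sum:
  assumes "\<And>i. i \<in> A \<Longrightarrow> sq_integrable M (f i)"
  shows "sq_integrable M (\<lambda>w. \<Sum>i\<in>A. f i w)"
  using assms
proof (induction A rule: infinite_finite_induct)
  case (insert x A)
  then show ?case by (simp add: sq_integrable_add)
qed (auto simp: sq_integrable_def)

lemma integral_cauchy_schwarz:
  assumes f: "sq_integrable M f" and g: "sq_integrable M g"
  shows "(\<integral>w. f w * g w \<partial>M)\<^sup>2 \<le> (\<integral>w. (f w)\<^sup>2 \<partial>M) * (\<integral>w. (g w)\<^sup>2 \<partial>M)"
proof -
  let ?A = "\<integral>w. (f w)\<^sup>2 \<partial>M" and ?B = "\<integral>w. f w * g w \<partial>M" and ?G = "\<integral>w. (g w)\<^sup>2 \<partial>M"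
  have int: "integrable M (\<lambda>w. (f w)\<^sup>2)" "integrable M (\<lambda>w. (g w)\<^sup>2)"
    using f g by (auto simp: sq_integrable_def)
  note int = int sq_integrable_mult[OF f g]
  have quad: "0 \<le> ?A + 2 * t * ?B + t\<^sup>2 * ?G" for t
  proof -
    have "0 \<le> (\<integral>w. (f w + t * g w)\<^sup>2 \<partial>M)" by simp
    also have "(\<lambda>w. (f w + t * g w)\<^sup>2) =
        (\<lambda>w. (f w)\<^sup>2 + (2 * t) * (f w * g w) + t\<^sup>2 * (g w)\<^sup>2)"
      by (auto simp: power2_sum power_mult_distrib)
    also have "(\<integral>w. (f w)\<^sup>2 + (2 * t) * (f w * g w) + t\<^sup>2 * (g w)\<^sup>2 \<partial>M) = ?A + 2 * t * ?B + t\<^sup>2 * ?G"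
      using int by simp
    finally show ?thesis .
  qed
  show ?thesis
  proof (cases "?G = 0")
    case True
    \<comment> \<open>otherwise the polynomial in \<open>quad\<close> is linear and not constant, and takes the value -1 at the point chosen\<close>
    have "?B = 0"
    proof (rule ccontr)
      assume "?B \<noteq> 0"
      with quad[of "- (?A + 1) / (2 * ?B)"] True show False by (simp add: field_simps)
    qed
    then show ?thesis using True by simp
  next
    case False
    moreover have "0 \<le> ?G" by simp
    ultimately have "0 < ?G" by linarith
    with quad[of "- ?B / ?G"] show ?thesis by (simp add: field_simps power2_eq_square)
  qed
qed

lemma integral_mult_tendsto:
  assumes u: "\<And>n. sq_integrable M (u n)" and \<xi>: "sq_integrable M \<xi>" and g: "sq_integrable M g"
    and lim: "(\<lambda>n. \<integral>w. (u n w - \<xi> w)\<^sup>2 \<partial>M) \<longlonglongrightarrow> 0"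
  shows "(\<lambda>n. \<integral>w. u n w * g w \<partial>M) \<longlonglongrightarrow> (\<integral>w. \<xi> w * g w \<partial>M)"
proof -
  let ?d = "\<lambda>n. (\<integral>w. u n w * g w \<partial>M) - (\<integral>w. \<xi> w * g w \<partial>M)"
  have "(\<lambda>n. (?d n)\<^sup>2) \<longlonglongrightarrow> 0"
  proof (rule Lim_null_comparison)
    show "\<forall>\<^sub>F n in sequentially. norm ((?d n)\<^sup>2) \<le>
        (\<integral>w. (u n w - \<xi> w)\<^sup>2 \<partial>M) * (\<integral>w. (g w)\<^sup>2 \<partial>M)"
    proof (intro always_eventually allI)
      fix n
      have "?d n = (\<integral>w. (u n w - \<xi> w) * g w \<partial>M)"
        using sq_integrable_mult[OF u g] sq_integrable_mult[OF \<xi> g]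
        by (simp add: left_diff_distrib)
      then show "norm ((?d n)\<^sup>2) \<le> (\<integral>w. (u n w - \<xi> w)\<^sup>2 \<partial>M) * (\<integral>w. (g w)\<^sup>2 \<partial>M)"
        using integral_cauchy_schwarz[OF sq_integrable_diff[OF u \<xi>] g] by simp
    qed
    show "(\<lambda>n. (\<integral>w. (u n w - \<xi> w)\<^sup>2 \<partial>M) * (\<integral>w. (g w)\<^sup>2 \<partial>M)) \<longlonglongrightarrow> 0"
      using lim by (rule tendsto_mult_left_zero)
  qed
  then have "(\<lambda>n. ?d n) \<longlonglongrightarrow> 0" by (simp add: tendsto_null_power)
  then show ?thesis by (rule LIM_zero_cancel)
qed

text \<open>Square integrability turns the nonnegative integral in the definition of \<open>L2_sums\<close> into a real
  number, so that Cauchy-Schwarz arguments apply.\<close>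

lemma L2_sums_iff:
  assumes "\<And>k. sq_integrable M (u k)" "sq_integrable M \<xi>"
  shows "L2_sums M u \<xi> \<longleftrightarrow> (\<lambda>N. \<integral>w. ((\<Sum>k<N. u k w) - \<xi> w)\<^sup>2 \<partial>M) \<longlonglongrightarrow> 0"
proof -
  have "(\<integral>\<^sup>+w. ennreal ((\<xi> w - (\<Sum>k<N. u k w))\<^sup>2) \<partial>M) =
      ennreal (\<integral>w. ((\<Sum>k<N. u k w) - \<xi> w)\<^sup>2 \<partial>M)" for N
    using sq_integrable_diff[OF sq_integrable_sum assms(2), of "{..<N}" u] assms(1)
    by (subst nn_integral_eq_integral[symmetric]) (auto simp: sq_integrable_def power2_commute)
  then show ?thesis unfolding L2_sums_def
    using tendsto_ennreal_iff[of "\<lambda>N. \<integral>w. ((\<Sum>k<N. u k w) - \<xi> w)\<^sup>2 \<partial>M" sequentially 0] by simp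
qed

lemma integral_sq_triangle:
  assumes "sq_integrable M f" "sq_integrable M g"
  shows "(\<integral>w. (f w + g w)\<^sup>2 \<partial>M) \<le> 2 * (\<integral>w. (f w)\<^sup>2 \<partial>M) + 2 * (\<integral>w. (g w)\<^sup>2 \<partial>M)"
proof -
  have "(\<integral>w. (f w + g w)\<^sup>2 \<partial>M) \<le> (\<integral>w. 2 * (f w)\<^sup>2 + 2 * (g w)\<^sup>2 \<partial>M)"
  proof (rule integral_mono)
    show "integrable M (\<lambda>w. (f w + g w)\<^sup>2)"
      using sq_integrable_add[OF assms] by (simp add: sq_integrable_def)
    show "integrable M (\<lambda>w. 2 * (f w)\<^sup>2 + 2 * (g w)\<^sup>2)"
      using assms by (simp add: sq_integrable_def)
    show "(f w + g w)\<^sup>2 \<le> 2 * (f w)\<^sup>2 + 2 * (g w)\<^sup>2" for w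
      using sum_squares_bound[of "f w" "g w"] by (simp add: power2_sum)
  qed
  also have "\<dots> = 2 * (\<integral>w. (f w)\<^sup>2 \<partial>M) + 2 * (\<integral>w. (g w)\<^sup>2 \<partial>M)"
    using assms by (simp add: sq_integrable_def)
  finally show ?thesis .
qed

text \<open>Fatou's lemma for squares.\<close>

lemma sq_integrable_limit:
  assumes v: "\<And>n. sq_integrable M (v n)" and f [measurable]: "f \<in> borel_measurable M"
    and lim: "AE w in M. (\<lambda>n. v n w) \<longlonglongrightarrow> f w"
    and le: "\<forall>\<^sub>F n in sequentially. (\<integral>w. (v n w)\<^sup>2 \<partial>M) \<le> C"
  shows "sq_integrable M f" "(\<integral>w. (f w)\<^sup>2 \<partial>M) \<le> C"
proof -
  have [measurable]: "v n \<in> borel_measurable M" for n using v by (rule sq_integrable_measurable)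
  obtain n where "(\<integral>w. (v n w)\<^sup>2 \<partial>M) \<le> C" using eventually_happens[OF le] by auto
  moreover have "0 \<le> (\<integral>w. (v n w)\<^sup>2 \<partial>M)" by simp
  ultimately have C: "0 \<le> C" by (rule order_trans[rotated])
  have "(\<integral>\<^sup>+w. ennreal ((f w)\<^sup>2) \<partial>M) = (\<integral>\<^sup>+w. liminf (\<lambda>n. ennreal ((v n w)\<^sup>2)) \<partial>M)"
  proof (rule nn_integral_cong_AE)
    show "AE w in M. ennreal ((f w)\<^sup>2) = liminf (\<lambda>n. ennreal ((v n w)\<^sup>2))"
      using lim
    proof eventually_elim
      case (elim w)
      then have "(\<lambda>n. ennreal ((v n w)\<^sup>2)) \<longlonglongrightarrow> ennreal ((f w)\<^sup>2)" by (intro tendsto_intros)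
      then show ?case by (rule lim_imp_Liminf[OF sequentially_bot, symmetric])
    qed
  qed
  also have "\<dots> \<le> liminf (\<lambda>n. \<integral>\<^sup>+w. ennreal ((v n w)\<^sup>2) \<partial>M)"
    by (intro nn_integral_liminf) measurable
  also have "\<dots> \<le> ennreal C"
  proof (rule Liminf_le)
    show "\<forall>\<^sub>F n in sequentially. (\<integral>\<^sup>+w. ennreal ((v n w)\<^sup>2) \<partial>M) \<le> ennreal C"
      using le
    proof eventually_elim
      case (elim n)
      then show ?case
        using v by (subst nn_integral_eq_integral) (auto simp: sq_integrable_def ennreal_leI)
    qed
  qed simp
  finally have bound: "(\<integral>\<^sup>+w. ennreal ((f w)\<^sup>2) \<partial>M) \<le> ennreal C" .
  then show f': "sq_integrable M f"
    unfolding sq_integrable_def by (auto intro!: integrableI_bounded simp: less_top[symmetric] top_unique)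
  then have "ennreal (\<integral>w. (f w)\<^sup>2 \<partial>M) \<le> ennreal C"
    using bound by (subst nn_integral_eq_integral[symmetric]) (auto simp: sq_integrable_def)
  then show "(\<integral>w. (f w)\<^sup>2 \<partial>M) \<le> C" using C by (simp add: ennreal_le_iff)
qed

context prob_space
begin

lemma sq_integrable_const [simp]: "sq_integrable M (\<lambda>_. c)"
  by (simp add: sq_integrable_def)

lemma sq_integrable_integrable: "sq_integrable M f \<Longrightarrow> integrable M f"
  using sq_integrable_mult[of M f "\<lambda>_. 1"] by simp

lemma integral_abs_square_le:
  assumes "sq_integrable M f"
  shows "(\<integral>w. \<bar>f w\<bar> \<partial>M)\<^sup>2 \<le> (\<integral>w. (f w)\<^sup>2 \<partial>M)"
  using integral_cauchy_schwarz[of M "\<lambda>w. \<bar>f w\<bar>" "\<lambda>_. 1"] assms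
  by (simp add: sq_integrable_def prob_space)

lemma L2_tendsto_AE_subseq:
  assumes "\<And>n. sq_integrable M (u n)" "sq_integrable M \<xi>"
    and lim: "(\<lambda>n. \<integral>w. (u n w - \<xi> w)\<^sup>2 \<partial>M) \<longlonglongrightarrow> 0"
  obtains r :: "nat \<Rightarrow> nat" where "strict_mono r" "AE w in M. (\<lambda>n. u (r n) w) \<longlonglongrightarrow> \<xi> w"
proof -
  have d: "sq_integrable M (\<lambda>w. u n w - \<xi> w)" for n
    by (intro sq_integrable_diff assms)
  have "(\<lambda>n. (\<integral>w. \<bar>u n w - \<xi> w\<bar> \<partial>M)\<^sup>2) \<longlonglongrightarrow> 0"
    by (rule Lim_null_comparison[OF _ lim]) (use integral_abs_square_le[OF d] in simp)
  then have "(\<lambda>n. \<integral>w. norm (u n w - \<xi> w) \<partial>M) \<longlonglongrightarrow> 0" by (simp add: tendsto_null_power)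
  from tendsto_L1_AE_subseq[OF sq_integrable_integrable[OF d] this]
  obtain r where r: "strict_mono r" "AE w in M. (\<lambda>n. u (r n) w - \<xi> w) \<longlonglongrightarrow> 0" by auto
  from r(2) have "AE w in M. (\<lambda>n. u (r n) w) \<longlonglongrightarrow> \<xi> w"
    by eventually_elim (rule LIM_zero_cancel)
  with r(1) show thesis by (rule that)
qed

text \<open>The Riesz-Fischer argument: a rapidly converging subsequence converges almost surely, and
  \<open>sq_integrable_limit\<close> shows that its limit is also the limit in mean square. The limit is taken pointwise
  with \<open>lim\<close>, which keeps it measurable for the subalgebra \<open>F\<close>.\<close>

lemma L2_complete:
  assumes F: "subalgebra M F"
    and meas: "\<And>n. u n \<in> borel_measurable F" and sq: "\<And>n. sq_integrable M (u n)"
    and Cauchy: "\<And>e. 0 < e \<Longrightarrow> \<exists>N. \<forall>m\<ge>N. \<forall>n\<ge>N. (\<integral>w. (u m w - u n w)\<^sup>2 \<partial>M) < e"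
  obtains \<xi> where "\<xi> \<in> borel_measurable F" "sq_integrable M \<xi>"
    "(\<lambda>n. \<integral>w. (u n w - \<xi> w)\<^sup>2 \<partial>M) \<longlonglongrightarrow> 0"
proof -
  have "\<forall>k. \<exists>N. \<forall>m\<ge>N. \<forall>n\<ge>N. (\<integral>w. (u m w - u n w)\<^sup>2 \<partial>M) < ((1/2) ^ k)\<^sup>2"
    using Cauchy by simp
  then obtain N where N: "\<And>k m n. m \<ge> N k \<Longrightarrow> n \<ge> N k \<Longrightarrow>
      (\<integral>w. (u m w - u n w)\<^sup>2 \<partial>M) < ((1/2) ^ k)\<^sup>2" by metis
  define r where "r k = Max (N ` {..k}) + k" for k
  have rN: "N k \<le> r k" for k unfolding r_def by (simp add: trans_le_add1)
  have r_mono: "r k \<le> r (Suc k)" for k unfolding r_def by (intro add_mono Max_mono) auto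
  have r_ge: "k \<le> r k" for k by (simp add: r_def)
  define d where "d k w = u (r (Suc k)) w - u (r k) w" for k w
  have d: "sq_integrable M (d k)" for k unfolding d_def by (intro sq_integrable_diff sq)
  have [measurable]: "d k \<in> borel_measurable M" for k
    using d by (rule sq_integrable_measurable)
  have d_le: "(\<integral>w. \<bar>d k w\<bar> \<partial>M) \<le> (1/2) ^ k" for k
  proof -
    have "(\<integral>w. \<bar>d k w\<bar> \<partial>M)\<^sup>2 \<le> ((1/2) ^ k)\<^sup>2"
      using integral_abs_square_le[OF d[of k]] N[of k "r (Suc k)" "r k"] rN[of k] r_mono[of k]
      unfolding d_def by linarith
    then show ?thesis by (rule power2_le_imp_le) simp
  qed
  have "(\<integral>\<^sup>+w. (\<Sum>k. ennreal \<bar>d k w\<bar>) \<partial>M) = (\<Sum>k. \<integral>\<^sup>+w. ennreal \<bar>d k w\<bar> \<partial>M)"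
    by (intro nn_integral_suminf) measurable
  also have "\<dots> \<le> (\<Sum>k. ennreal ((1/2) ^ k))"
  proof (intro suminf_le)
    fix k
    have "(\<integral>\<^sup>+w. ennreal \<bar>d k w\<bar> \<partial>M) = ennreal (\<integral>w. \<bar>d k w\<bar> \<partial>M)"
      using sq_integrable_integrable[OF d] by (intro nn_integral_eq_integral) auto
    then show "(\<integral>\<^sup>+w. ennreal \<bar>d k w\<bar> \<partial>M) \<le> ennreal ((1/2) ^ k)"
      using d_le by (simp add: ennreal_leI)
  qed auto
  also have "\<dots> = ennreal (\<Sum>k. (1/2) ^ k)"
    by (intro suminf_ennreal2) (auto simp: summable_geometric)
  finally have "(\<integral>\<^sup>+w. (\<Sum>k. ennreal \<bar>d k w\<bar>) \<partial>M) \<noteq> \<infinity>" by (auto simp: top_unique)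
  then have "AE w in M. (\<Sum>k. ennreal \<bar>d k w\<bar>) \<noteq> \<infinity>"
    by (intro nn_integral_PInf_AE) measurable
  then have conv: "AE w in M. (\<lambda>k. u (r k) w) \<longlonglongrightarrow> lim (\<lambda>k. u (r k) w)"
  proof eventually_elim
    fix w assume "(\<Sum>k. ennreal \<bar>d k w\<bar>) \<noteq> \<infinity>"
    then have "summable (\<lambda>k. \<bar>d k w\<bar>)" by (intro summable_suminf_not_top) auto
    then have "summable (\<lambda>k. d k w)" by (rule summable_rabs_cancel)
    then have "convergent (\<lambda>n. (\<Sum>k<n. d k w) + u (r 0) w)"
      by (intro convergent_add convergent_const) (simp add: summable_iff_convergent)
    also have "(\<lambda>n. (\<Sum>k<n. d k w) + u (r 0) w) = (\<lambda>n. u (r n) w)"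
      using sum_lessThan_telescope[of "\<lambda>k. u (r k) w"] by (simp add: d_def)
    finally show "(\<lambda>k. u (r k) w) \<longlonglongrightarrow> lim (\<lambda>k. u (r k) w)" by (simp add: convergent_LIMSEQ_iff)
  qed
  define \<xi> where "\<xi> w = lim (\<lambda>k. u (r k) w)" for w
  have \<xi>F: "\<xi> \<in> borel_measurable F" unfolding \<xi>_def using meas by measurable
  then have \<xi>M [measurable]: "\<xi> \<in> borel_measurable M" using F measurable_from_subalg by blast
  note [measurable] = sq
  have bound: "sq_integrable M (\<lambda>w. u n w - \<xi> w)" "(\<integral>w. (u n w - \<xi> w)\<^sup>2 \<partial>M) \<le> e"
    if K: "\<And>m n. m \<ge> K \<Longrightarrow> n \<ge> K \<Longrightarrow> (\<integral>w. (u m w - u n w)\<^sup>2 \<partial>M) < e" and "n \<ge> K" for K e n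
  proof -
    have lim: "AE w in M. (\<lambda>k. u n w - u (r k) w) \<longlonglongrightarrow> u n w - \<xi> w"
      using conv unfolding \<xi>_def by eventually_elim (intro tendsto_intros)
    have le: "\<forall>\<^sub>F k in sequentially. (\<integral>w. (u n w - u (r k) w)\<^sup>2 \<partial>M) \<le> e"
      using eventually_ge_at_top[of K]
    proof eventually_elim
      case (elim k)
      then show ?case using K[of n "r k"] \<open>n \<ge> K\<close> r_ge[of k] by simp
    qed
    have "(\<lambda>w. u n w - \<xi> w) \<in> borel_measurable M" by measurable
    note * = sq_integrable_limit[OF sq_integrable_diff[OF sq sq] this lim le]
    show "sq_integrable M (\<lambda>w. u n w - \<xi> w)" "(\<integral>w. (u n w - \<xi> w)\<^sup>2 \<partial>M) \<le> e"
      by (rule *)+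
  qed
  have "sq_integrable M (\<lambda>w. u (N 0) w - (u (N 0) w - \<xi> w))"
    by (rule sq_integrable_diff[OF sq bound(1)[of "N 0", OF N]]) auto
  then have \<xi>: "sq_integrable M \<xi>" by simp
  have "(\<lambda>n. \<integral>w. (u n w - \<xi> w)\<^sup>2 \<partial>M) \<longlonglongrightarrow> 0"
  proof (rule LIMSEQ_I)
    fix e :: real assume "0 < e"
    then obtain K where K: "\<And>m n. m \<ge> K \<Longrightarrow> n \<ge> K \<Longrightarrow> (\<integral>w. (u m w - u n w)\<^sup>2 \<partial>M) < e / 2"
      using Cauchy[of "e / 2"] by auto
    have "norm ((\<integral>w. (u n w - \<xi> w)\<^sup>2 \<partial>M) - 0) < e" if "n \<ge> K" for n
      using bound(2)[OF K that] \<open>0 < e\<close> by simp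
    then show "\<exists>K. \<forall>n\<ge>K. norm ((\<integral>w. (u n w - \<xi> w)\<^sup>2 \<partial>M) - 0) < e" by blast
  qed
  with \<xi>F \<xi> show thesis by (rule that)
qed

end

section \<open>Fourier uniqueness and cylinder sets\<close>

text \<open>If all coefficients below \<open>k\<close> agree, divide the difference of the series by \<open>t\<^sup>k\<close> and let \<open>t\<close>
  tend to 0.\<close>

lemma power_series_eq_imp_coeff_eq:
  fixes a b :: "nat \<Rightarrow> real"
  assumes a: "\<And>t. (\<lambda>k. a k * t ^ k) sums F t" and b: "\<And>t. (\<lambda>k. b k * t ^ k) sums F t"
  shows "a k = b k"
proof (induction k rule: less_induct)
  case (less k)
  define c where "c n = a n - b n" for n
  have zero: "(\<lambda>n. c n * t ^ n) sums 0" for t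
    using sums_diff[OF a[of t] b[of t]] by (simp add: c_def left_diff_distrib)
  have "(\<lambda>n. c (n + k) * t ^ n) sums 0" if "t \<noteq> 0" for t
  proof -
    have "(\<lambda>n. c (n + k) * t ^ (n + k)) sums (0 - (\<Sum>i<k. c i * t ^ i))"
      by (rule sums_split_initial_segment[OF zero])
    moreover have "(\<Sum>i<k. c i * t ^ i) = 0" using less by (intro sum.neutral) (simp add: c_def)
    ultimately have "(\<lambda>n. t ^ k * (c (n + k) * t ^ n)) sums (t ^ k * 0)"
      by (simp add: power_add ac_simps)
    from sums_mult_D[OF this] that show ?thesis by simp
  qed
  then have "((\<lambda>t. 0) \<longlongrightarrow> c (0 + k)) (at (0::real))"
    by (intro powser_limit_0_strong[of 1 "\<lambda>n. c (n + k)"]) auto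
  then have "c k = 0" using tendsto_unique[of "at (0::real)" "\<lambda>_. 0" "c k" 0] by auto
  then show ?case by (simp add: c_def)
qed

text \<open>Dominated convergence for the partial sums of a series. The terms are differences of consecutive
  partial sums, so their integrability is also a consequence of the domination.\<close>

lemma integral_sums_dominated:
  fixes a :: "nat \<Rightarrow> 'w \<Rightarrow> real"
  assumes [measurable]: "\<And>k. a k \<in> borel_measurable M" "s \<in> borel_measurable M"
    and D: "integrable M D"
    and le: "\<And>N. AE w in M. \<bar>\<Sum>k<N. a k w\<bar> \<le> D w"
    and sums: "AE w in M. (\<lambda>k. a k w) sums s w"
  shows "integrable M s" "integrable M (a k)" "(\<lambda>k. \<integral>w. a k w \<partial>M) sums (\<integral>w. s w \<partial>M)"
proof -
  have lim: "AE w in M. (\<lambda>N. \<Sum>k<N. a k w) \<longlonglongrightarrow> s w"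
    using sums by (simp add: sums_def)
  have bd: "\<And>N. AE w in M. norm (\<Sum>k<N. a k w) \<le> D w" using le by simp
  note dom = D lim bd
  show "integrable M s" by (rule integrable_dominated_convergence[OF _ _ dom]) measurable
  have part: "integrable M (\<lambda>w. \<Sum>k<N. a k w)" for N
    by (rule integrable_dominated_convergence2[OF _ _ dom]) measurable
  have "integrable M (\<lambda>w. (\<Sum>k<Suc k. a k w) - (\<Sum>k<k. a k w))" for k
    by (intro Bochner_Integration.integrable_diff part)
  then show ak: "integrable M (a k)" for k by simp
  have "(\<lambda>N. \<integral>w. (\<Sum>k<N. a k w) \<partial>M) \<longlonglongrightarrow> (\<integral>w. s w \<partial>M)"
    by (rule integral_dominated_convergence[OF _ _ dom]) measurable
  then show "(\<lambda>k. \<integral>w. a k w \<partial>M) sums (\<integral>w. s w \<partial>M)"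
    using ak by (simp add: sums_def)
qed

lemma exp_sums: "(\<lambda>k. x ^ k / fact k) sums exp (x::real)"
  using exp_converges[of x] by (simp add: divide_inverse mult.commute)

lemma sum_le_exp:
  fixes x :: real
  assumes "\<And>k. \<bar>c k\<bar> \<le> 1 / fact k"
  shows "\<bar>\<Sum>k<N. c k * x ^ k\<bar> \<le> exp \<bar>x\<bar>"
proof -
  have "\<bar>\<Sum>k<N. c k * x ^ k\<bar> \<le> (\<Sum>k<N. \<bar>c k * x ^ k\<bar>)" by (rule sum_abs)
  also have "\<dots> \<le> (\<Sum>k<N. \<bar>x\<bar> ^ k / fact k)"
    using assms by (intro sum_mono) (auto simp: abs_mult power_abs divide_inverse mult.commute[of _ "inverse _"] intro!: mult_right_mono)
  also have "\<dots> \<le> exp \<bar>x\<bar>"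
    using exp_sums[of "\<bar>x\<bar>"] by (intro sum_le_suminf[THEN order_trans]) (auto simp: sums_iff)
  finally show ?thesis .
qed

lemma integral_power_series_sums:
  fixes Y \<xi> :: "'w \<Rightarrow> real"
  assumes [measurable]: "Y \<in> borel_measurable M" "\<xi> \<in> borel_measurable M" "f \<in> borel_measurable borel"
    and int: "integrable M (\<lambda>w. \<xi> w * exp \<bar>t * Y w\<bar>)"
    and c: "\<And>k. \<bar>c k\<bar> \<le> 1 / fact k" and f: "\<And>x. (\<lambda>k. c k * x ^ k) sums f x"
  shows "(\<lambda>k. c k * (\<integral>w. \<xi> w * (Y w) ^ k \<partial>M) * t ^ k) sums (\<integral>w. \<xi> w * f (t * Y w) \<partial>M)"
proof -
  have "(\<lambda>k. \<integral>w. \<xi> w * (c k * (t * Y w) ^ k) \<partial>M) sums (\<integral>w. \<xi> w * f (t * Y w) \<partial>M)"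
  proof (rule integral_sums_dominated)
    show "integrable M (\<lambda>w. \<bar>\<xi> w * exp \<bar>t * Y w\<bar>\<bar>)" using int by (rule integrable_abs)
    show "AE w in M. \<bar>\<Sum>k<N. \<xi> w * (c k * (t * Y w) ^ k)\<bar> \<le> \<bar>\<xi> w * exp \<bar>t * Y w\<bar>\<bar>" for N
    proof (rule AE_I2)
      fix w
      have "\<bar>\<Sum>k<N. \<xi> w * (c k * (t * Y w) ^ k)\<bar> = \<bar>\<xi> w\<bar> * \<bar>\<Sum>k<N. c k * (t * Y w) ^ k\<bar>"
        unfolding sum_distrib_left[symmetric] by (rule abs_mult)
      also have "\<dots> \<le> \<bar>\<xi> w\<bar> * exp \<bar>t * Y w\<bar>" by (intro mult_left_mono sum_le_exp c) simp
      also have "\<dots> = \<bar>\<xi> w * exp \<bar>t * Y w\<bar>\<bar>" by (subst abs_mult[of "\<xi> w"]) simp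
      finally show "\<bar>\<Sum>k<N. \<xi> w * (c k * (t * Y w) ^ k)\<bar> \<le> \<bar>\<xi> w * exp \<bar>t * Y w\<bar>\<bar>" .
    qed
    show "AE w in M. (\<lambda>k. \<xi> w * (c k * (t * Y w) ^ k)) sums (\<xi> w * f (t * Y w))"
      by (intro AE_I2 sums_mult f)
  qed measurable
  moreover have "(\<integral>w. \<xi> w * (c k * (t * Y w) ^ k) \<partial>M) = c k * (\<integral>w. \<xi> w * (Y w) ^ k \<partial>M) * t ^ k" for k
  proof -
    have "(\<lambda>w. \<xi> w * (c k * (t * Y w) ^ k)) = (\<lambda>w. c k * t ^ k * (\<xi> w * (Y w) ^ k))"
      by (auto simp: power_mult_distrib)
    then show ?thesis by simp
  qed
  ultimately show ?thesis by simp
qed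

text \<open>The positive and negative parts of \<open>Z\<close> have the same total mass. Normalised to probability
  densities, they push forward along \<open>Y\<close> to laws with the same characteristic function, so these
  laws coincide.\<close>

lemma integral_indicator_eq_0_if_fourier_0:
  fixes Y Z :: "'w \<Rightarrow> real"
  assumes Z: "integrable M Z" and Y [measurable]: "Y \<in> borel_measurable M"
    and cos: "\<And>t. (\<integral>w. Z w * cos (t * Y w) \<partial>M) = 0"
    and sin: "\<And>t. (\<integral>w. Z w * sin (t * Y w) \<partial>M) = 0"
    and B [measurable]: "B \<in> sets borel"
  shows "(\<integral>w. Z w * indicator B (Y w) \<partial>M) = 0"
proof -
  have [measurable]: "Z \<in> borel_measurable M" using Z by simp
  define p n where "p w = max 0 (Z w)" and "n w = max 0 (- Z w)" for w
  have Z_eq: "Z w = p w - n w" for w by (simp add: p_def n_def)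
  have p: "integrable M p" "\<And>w. 0 \<le> p w" and n: "integrable M n" "\<And>w. 0 \<le> n w"
    using Z by (auto simp: p_def[abs_def] n_def[abs_def])
  have [measurable]: "p \<in> borel_measurable M" "n \<in> borel_measurable M" using p n by auto
  define c where "c = (\<integral>w. p w \<partial>M)"
  have "(\<integral>w. Z w \<partial>M) = 0" using cos[of 0] by simp
  then have cn: "c = (\<integral>w. n w \<partial>M)" unfolding Z_eq c_def using p n by simp
  show ?thesis
  proof (cases "c = 0")
    case True
    have "AE w in M. p w = 0"
      using p True by (subst integral_nonneg_eq_0_iff_AE[symmetric]) (auto simp: c_def)
    moreover have "AE w in M. n w = 0"
      using n True cn by (subst integral_nonneg_eq_0_iff_AE[symmetric]) auto
    ultimately have "AE w in M. Z w * indicator B (Y w) = 0"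
      by eventually_elim (simp add: Z_eq)
    then show ?thesis by (rule integral_eq_zero_AE)
  next
    case False
    have "0 \<le> c" using p by (simp add: c_def)
    with False have c: "0 < c" by simp
    define \<mu> where "\<mu> q = distr (density M (\<lambda>w. ennreal (q w / c))) borel Y" for q
    have dist: "real_distribution (\<mu> q)"
      if q: "integrable M q" "\<And>w. 0 \<le> q w" "(\<integral>w. q w \<partial>M) = c" for q
    proof -
      have [measurable]: "q \<in> borel_measurable M" using q by auto
      have "emeasure (density M (\<lambda>w. ennreal (q w / c))) (space M) = (\<integral>\<^sup>+w. ennreal (q w / c) \<partial>M)"
        by (simp add: emeasure_density cong: nn_integral_cong)
      also have "\<dots> = ennreal (\<integral>w. q w / c \<partial>M)"
        using q c by (intro nn_integral_eq_integral) auto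
      also have "\<dots> = 1" using q c by simp
      finally interpret N: prob_space "density M (\<lambda>w. ennreal (q w / c))"
        by (intro prob_spaceI) simp
      show ?thesis unfolding \<mu>_def by (rule N.real_distribution_distr) simp
    qed
    have int: "(\<integral>x. f x \<partial>(\<mu> q)) = (\<integral>w. (q w / c) *\<^sub>R f (Y w) \<partial>M)"
      if "integrable M q" "\<And>w. 0 \<le> q w" "f \<in> borel_measurable borel"
      for q and f :: "real \<Rightarrow> 'b::{banach, second_countable_topology}"
    proof -
      have [measurable]: "q \<in> borel_measurable M" "f \<in> borel_measurable borel" using that by auto
      have "(\<integral>x. f x \<partial>(\<mu> q)) = (\<integral>w. f (Y w) \<partial>(density M (\<lambda>w. ennreal (q w / c))))"
        unfolding \<mu>_def by (rule integral_distr) auto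
      also have "\<dots> = (\<integral>w. (q w / c) *\<^sub>R f (Y w) \<partial>M)"
        using that c by (intro integral_density) auto
      finally show ?thesis .
    qed
    have "char (\<mu> p) = char (\<mu> n)"
    proof
      fix t
      have bd: "integrable M (\<lambda>w. (q w / c) * g (t * Y w))"
        if "integrable M q" "\<And>x. \<bar>g x\<bar> \<le> 1" "g \<in> borel_measurable borel" for q and g :: "real \<Rightarrow> real"
      proof (rule Bochner_Integration.integrable_bound)
        show "integrable M (\<lambda>w. q w / c)" using that(1) by simp
        show "(\<lambda>w. (q w / c) * g (t * Y w)) \<in> borel_measurable M"
          using borel_measurable_integrable[OF that(1)] that(3) by measurable
        show "AE w in M. norm (q w / c * g (t * Y w)) \<le> norm (q w / c)"
          using that(2) by (intro AE_I2) (simp add: abs_mult mult_left_le divide_right_mono)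
      qed
      have ch: "char (\<mu> q) t = of_real (\<integral>w. (q w / c) * cos (t * Y w) \<partial>M) +
          \<i> * of_real (\<integral>w. (q w / c) * sin (t * Y w) \<partial>M)"
        if q: "integrable M q" "\<And>w. 0 \<le> q w" for q
      proof -
        have euler: "iexp x = of_real (cos x) + \<i> * of_real (sin x)" for x :: real
          by (simp add: exp_Euler cos_of_real sin_of_real)
        have "char (\<mu> q) t = (\<integral>w. (q w / c) *\<^sub>R iexp (t * Y w) \<partial>M)"
          unfolding char_def using q by (subst int) auto
        also have "(\<lambda>w. (q w / c) *\<^sub>R iexp (t * Y w)) =
            (\<lambda>w. of_real (q w / c * cos (t * Y w)) + \<i> * of_real (q w / c * sin (t * Y w)))"
          by (rule ext, subst euler) (simp add: scaleR_conv_of_real algebra_simps)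
        also have "(\<integral>w. of_real (q w / c * cos (t * Y w)) + \<i> * of_real (q w / c * sin (t * Y w)) \<partial>M) =
            of_real (\<integral>w. (q w / c) * cos (t * Y w) \<partial>M) +
            \<i> * of_real (\<integral>w. (q w / c) * sin (t * Y w) \<partial>M)"
          using bd[OF q(1), of cos] bd[OF q(1), of sin]
          by (subst Bochner_Integration.integral_add)
            (auto simp del: of_real_mult of_real_divide intro!: integrable_of_real)
        finally show ?thesis .
      qed
      let ?E = "\<lambda>q g. \<integral>w. (q w / c) * g (t * Y w) \<partial>M"
      have eq: "?E p g = ?E n g"
        if "\<And>x. \<bar>g x\<bar> \<le> 1" "g \<in> borel_measurable borel" "(\<integral>w. Z w * g (t * Y w) \<partial>M) = 0" for g
      proof -
        have "?E p g - ?E n g =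
            (\<integral>w. (p w / c) * g (t * Y w) - (n w / c) * g (t * Y w) \<partial>M)"
          using bd[OF p(1) that(1,2)] bd[OF n(1) that(1,2)] by simp
        also have "\<dots> = (\<integral>w. (1 / c) * (Z w * g (t * Y w)) \<partial>M)"
          by (intro Bochner_Integration.integral_cong refl) (simp add: Z_eq left_diff_distrib diff_divide_distrib)
        also have "\<dots> = 0" unfolding integral_mult_right_zero that(3) by simp
        finally show ?thesis by simp
      qed
      show "char (\<mu> p) t = char (\<mu> n) t"
        using eq[of cos] eq[of sin] cos[of t] sin[of t] False by (auto simp add: ch p n)
    qed
    then have "\<mu> p = \<mu> n"
      using p n cn by (intro Levy_uniqueness dist) (auto simp: c_def)
    then have eqB: "(\<integral>w. (p w / c) * indicator B (Y w) \<partial>M) = (\<integral>w. (n w / c) * indicator B (Y w) \<partial>M)"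
      using int[OF p, of "indicator B :: real \<Rightarrow> real"] int[OF n, of "indicator B :: real \<Rightarrow> real"]
        borel_measurable_indicator[OF B, where 'b = real] by (simp only: real_scaleR_def)
    have "integrable M (\<lambda>w. q w / c * indicator B (Y w))" if "integrable M q" for q
    proof (rule Bochner_Integration.integrable_bound)
      show "integrable M (\<lambda>w. q w / c)" using that by simp
      show "(\<lambda>w. q w / c * indicator B (Y w)) \<in> borel_measurable M"
        using borel_measurable_integrable[OF that] by measurable
    qed (auto simp: indicator_def)
    then have "(\<integral>w. p w / c * indicator B (Y w) - n w / c * indicator B (Y w) \<partial>M) = 0"
      using p n eqB by simp
    also have "(\<lambda>w. p w / c * indicator B (Y w) - n w / c * indicator B (Y w)) =
        (\<lambda>w. (1 / c) * (Z w * indicator B (Y w)))"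
      by (auto simp: Z_eq left_diff_distrib diff_divide_distrib)
    finally show ?thesis using c by simp
  qed
qed

lemma cylinder_indicator_measurable:
  fixes Y :: "'i \<Rightarrow> 'w \<Rightarrow> real"
  assumes "\<And>i B. (i, B) \<in> set ps \<Longrightarrow> Y i \<in> borel_measurable M \<and> B \<in> sets borel"
  shows "(\<lambda>w. \<Prod>(i, B)\<leftarrow>ps. indicator B (Y i w) :: real) \<in> borel_measurable M"
  using assms
proof (induction ps)
  case (Cons p ps)
  obtain i B where p: "p = (i, B)" by (cases p)
  have [measurable]: "B \<in> sets borel" "Y i \<in> borel_measurable M" using Cons.prems p by auto
  have [measurable]: "(\<lambda>w. (\<Prod>(i, B)\<leftarrow>ps. indicator B (Y i w)) :: real) \<in> borel_measurable M"
    using Cons by auto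
  show ?case by (simp add: p)
qed simp

text \<open>The finite intersections \<open>C ps\<close> of conditions on single coordinates form an intersection-stable
  generator, and the sets over which \<open>\<xi>\<close> integrates to 0 are closed under the operations of a
  Dynkin system.\<close>

lemma integral_indicator_eq_0_if_cylinders_0:
  fixes Y :: "'i \<Rightarrow> 'w \<Rightarrow> real" and \<xi> :: "'w \<Rightarrow> real"
  assumes Y [measurable]: "\<And>i. i \<in> J \<Longrightarrow> Y i \<in> borel_measurable M" and \<xi>: "integrable M \<xi>"
    and cyl: "\<And>ps. (\<And>i B. (i, B) \<in> set ps \<Longrightarrow> i \<in> J \<and> B \<in> sets borel) \<Longrightarrow>
      (\<integral>w. \<xi> w * (\<Prod>(i, B)\<leftarrow>ps. indicator B (Y i w)) \<partial>M) = 0"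
    and A: "A \<in> sigma_sets (space M) {Y i -` B \<inter> space M |i B. i \<in> J \<and> B \<in> sets borel}"
  shows "(\<integral>w. \<xi> w * indicator A w \<partial>M) = 0"
proof -
  let ?G = "{Y i -` B \<inter> space M |i B. i \<in> J \<and> B \<in> sets borel}"
  define C where "C ps = {w\<in>space M. \<forall>(i, B)\<in>set ps. Y i w \<in> B}" for ps
  define H where "H = {C ps |ps. \<forall>(i, B)\<in>set ps. i \<in> J \<and> B \<in> sets borel}"
  have ind: "indicator (C ps) w = (\<Prod>(i, B)\<leftarrow>ps. indicator B (Y i w) :: real)" if "w \<in> space M" for ps w
  proof (induction ps)
    case Nil
    show ?case using that by (simp add: C_def)
  next
    case (Cons q ps)
    have "indicator (C (q # ps)) w = (indicator (snd q) (Y (fst q) w) * indicator (C ps) w :: real)"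
      by (auto simp: C_def indicator_def)
    then show ?case by (simp add: Cons split_def)
  qed
  have H_Pow: "H \<subseteq> Pow (space M)" by (auto simp: H_def C_def)
  have stable: "Int_stable H"
  proof (rule Int_stableI)
    fix a b assume "a \<in> H" "b \<in> H"
    then obtain ps qs where "a = C ps" "b = C qs" "\<forall>(i, B)\<in>set ps. i \<in> J \<and> B \<in> sets borel"
      "\<forall>(i, B)\<in>set qs. i \<in> J \<and> B \<in> sets borel" by (auto simp: H_def)
    moreover have "C ps \<inter> C qs = C (ps @ qs)" by (auto simp: C_def)
    ultimately show "a \<inter> b \<in> H" unfolding H_def by (intro CollectI exI[of _ "ps @ qs"]) auto
  qed
  have "?G \<subseteq> H"
  proof
    fix a assume "a \<in> ?G"
    then obtain i B where "a = Y i -` B \<inter> space M" "i \<in> J" "B \<in> sets borel" by auto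
    then show "a \<in> H" unfolding H_def by (intro CollectI exI[of _ "[(i, B)]"]) (auto simp: C_def)
  qed
  then have A': "A \<in> sigma_sets (space M) H" using A sigma_sets_mono' by blast
  have C_sets: "C ps \<in> sets M" if "\<forall>(i, B)\<in>set ps. i \<in> J \<and> B \<in> sets borel" for ps
    using that
  proof (induction ps)
    case Nil
    then show ?case by (simp add: C_def)
  next
    case (Cons q ps)
    obtain i B where q: "q = (i, B)" by (cases q)
    have "C (q # ps) = (Y i -` B \<inter> space M) \<inter> C ps" by (auto simp: C_def q)
    moreover have "Y i -` B \<inter> space M \<in> sets M" using Cons.prems by (intro measurable_sets[OF Y]) (auto simp: q)
    ultimately show ?case using Cons by auto
  qed
  have HM: "sigma_sets (space M) H \<subseteq> sets M"
    using C_sets by (intro sets.sigma_sets_subset) (auto simp: H_def)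
  have prod_int: "integrable M (\<lambda>w. \<xi> w * indicator a w)" if "a \<in> sets M" for a
    using integrable_real_mult_indicator[OF that \<xi>] by simp
  have tot: "(\<integral>w. \<xi> w \<partial>M) = 0" using cyl[of "[]"] by simp
  show ?thesis
    using stable H_Pow A'
  proof (induction rule: sigma_sets_induct_disjoint)
    case (basic a)
    then obtain ps where ps: "a = C ps" "\<forall>(i, B)\<in>set ps. i \<in> J \<and> B \<in> sets borel" by (auto simp: H_def)
    have "(\<integral>w. \<xi> w * indicator a w \<partial>M) = (\<integral>w. \<xi> w * (\<Prod>(i, B)\<leftarrow>ps. indicator B (Y i w)) \<partial>M)"
      by (intro Bochner_Integration.integral_cong refl) (simp add: ps(1) ind)
    also have "\<dots> = 0" using ps(2) by (intro cyl) auto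
    finally show ?case .
  next
    case empty
    then show ?case by simp
  next
    case (compl a)
    then have a: "a \<in> sets M" using HM by auto
    have "(\<integral>w. \<xi> w * indicator (space M - a) w \<partial>M) = (\<integral>w. \<xi> w - \<xi> w * indicator a w \<partial>M)"
      by (intro Bochner_Integration.integral_cong refl) (auto simp: indicator_def)
    also have "\<dots> = 0" using compl prod_int[OF a] \<xi> tot by simp
    finally show ?case .
  next
    case (union a)
    then have a: "\<And>i. a i \<in> sets M" using HM by auto
    have "(\<lambda>i. \<integral>w. \<xi> w * indicator (a i) w \<partial>M) sums (\<integral>w. \<xi> w * indicator (\<Union>i. a i) w \<partial>M)"
    proof (rule integral_sums_dominated[where D = "\<lambda>w. \<bar>\<xi> w\<bar>"])
      show "(\<lambda>w. \<xi> w * indicator (a i) w) \<in> borel_measurable M" for i using prod_int[OF a] by auto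
      show "(\<lambda>w. \<xi> w * indicator (\<Union>i. a i) w) \<in> borel_measurable M"
        using prod_int[of "\<Union>i. a i"] a by auto
      show "AE w in M. (\<lambda>i. \<xi> w * indicator (a i) w) sums (\<xi> w * indicator (\<Union>i. a i) w)"
        using indicator_sums[of a] union(1)
        by (intro AE_I2 sums_mult) (auto simp: disjoint_family_on_def)
      show "AE w in M. \<bar>\<Sum>i<N. \<xi> w * indicator (a i) w\<bar> \<le> \<bar>\<xi> w\<bar>" for N
      proof (intro AE_I2)
        fix w
        have "(\<Sum>i<N. indicator (a i) w :: real) = indicator (\<Union>i<N. a i) w"
          using union(1) by (intro indicator_UN_disjoint[symmetric]) (auto simp: disjoint_family_on_def)
        then show "\<bar>\<Sum>i<N. \<xi> w * indicator (a i) w\<bar> \<le> \<bar>\<xi> w\<bar>"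
          by (simp add: sum_distrib_left[symmetric] abs_mult indicator_def)
      qed
    qed (use \<xi> in auto)
    then show ?case using union by (simp add: sums_iff)
  qed
qed

lemma AE_eq_0_if_integrals_0:
  fixes \<xi> :: "'w \<Rightarrow> real"
  assumes F: "subalgebra M F" and \<xi>: "\<xi> \<in> borel_measurable F" "integrable M \<xi>"
    and zero: "\<And>A. A \<in> sets F \<Longrightarrow> (\<integral>w. \<xi> w * indicator A w \<partial>M) = 0"
  shows "AE w in M. \<xi> w = 0"
proof -
  have sp: "space F = space M" using F by (simp add: subalgebra_def)
  have sub: "A \<in> sets M" if "A \<in> sets F" for A using F that by (auto simp: subalgebra_def)
  define P N where "P = {w\<in>space F. 0 < \<xi> w}" and "N = {w\<in>space F. \<xi> w < 0}"
  have PN: "P \<in> sets F" "N \<in> sets F" unfolding P_def N_def using \<xi>(1) by measurable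
  have int: "integrable M (\<lambda>w. \<xi> w * indicator A w)" if "A \<in> sets F" for A
    using integrable_real_mult_indicator[OF sub[OF that] \<xi>(2)] by simp
  have "AE w in M. \<xi> w * indicator P w = 0"
    using int[OF PN(1)] zero[OF PN(1)]
    by (subst (asm) integral_nonneg_eq_0_iff_AE) (auto simp: P_def indicator_def)
  moreover have "AE w in M. - (\<xi> w * indicator N w) = 0"
    using int[OF PN(2)] zero[OF PN(2)]
    by (subst integral_nonneg_eq_0_iff_AE[symmetric]) (auto simp: N_def indicator_def)
  ultimately show ?thesis
    using AE_space
  proof eventually_elim
    case (elim w)
    then show ?case by (cases "\<xi> w" "0::real" rule: linorder_cases) (auto simp: P_def N_def sp)
  qed
qed

section \<open>Hermite polynomials\<close>

text \<open>The Taylor coefficients at 0 of \<open>exp (- t\<^sup>2 / 2)\<close>.\<close>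

definition half_square_coeff :: "nat \<Rightarrow> real" where
  "half_square_coeff m = (if even m then (- 1 / 2) ^ (m div 2) / fact (m div 2) else 0)"

lemma half_square_coeff_rec:
  "real (Suc (Suc m)) * half_square_coeff (Suc (Suc m)) = - half_square_coeff m"
proof (cases "even m")
  case True
  then obtain j where j: "m = 2 * j" by (elim evenE)
  have "half_square_coeff (Suc (Suc m)) = (- 1 / 2) * (- 1 / 2) ^ j / (real (Suc j) * fact j)"
    by (simp add: half_square_coeff_def j)
  moreover have "real (Suc (Suc m)) = 2 * real (Suc j)" by (simp add: j)
  ultimately show ?thesis by (simp add: half_square_coeff_def j del: of_nat_Suc)
next
  case False
  then show ?thesis by (simp add: half_square_coeff_def)
qed

lemma exp_neg_half_square_sums:
  "(\<lambda>m. t ^ m * half_square_coeff m) sums exp (- (t\<^sup>2 / 2))" (is ?exp)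
  "(\<lambda>m. norm (t ^ m * half_square_coeff m)) sums exp (t\<^sup>2 / 2)" (is ?abs)
proof -
  have reindex: "f sums s" if "(\<lambda>n. f (2 * n)) sums s" "\<And>n. odd n \<Longrightarrow> f n = 0" for f :: "nat \<Rightarrow> real" and s
  proof -
    have "n \<notin> range ((*) 2) \<Longrightarrow> f n = 0" for n using that(2) by (auto elim!: evenE)
    then show ?thesis
      using sums_mono_reindex[of "\<lambda>n. 2 * n" f s] that(1) by (auto simp: strict_mono_def)
  qed
  have "(\<lambda>n. t ^ (2 * n) * half_square_coeff (2 * n)) = (\<lambda>n. (- (t\<^sup>2 / 2)) ^ n / fact n)"
    unfolding half_square_coeff_def
    by (rule ext) (simp add: power_mult, simp flip: power_mult_distrib add: mult.commute)
  then have "(\<lambda>n. t ^ (2 * n) * half_square_coeff (2 * n)) sums exp (- (t\<^sup>2 / 2))"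
    by (simp only: exp_sums)
  then show ?exp by (rule reindex) (simp add: half_square_coeff_def)
  have "(\<lambda>n. norm (t ^ (2 * n) * half_square_coeff (2 * n))) = (\<lambda>n. (t\<^sup>2 / 2) ^ n / fact n)"
    unfolding half_square_coeff_def
    by (rule ext) (simp add: power_mult abs_mult power_abs power_divide)
  then have "(\<lambda>n. norm (t ^ (2 * n) * half_square_coeff (2 * n))) sums exp (t\<^sup>2 / 2)"
    by (simp only: exp_sums)
  then show ?abs by (rule reindex) (simp add: half_square_coeff_def)
qed

text \<open>This is the Cauchy product of the series of \<open>exp (t x)\<close> and \<open>exp (- t\<^sup>2 / 2)\<close>. The convolution
  satisfies the recursion of the Hermite polynomials: write the factor \<open>k + 2\<close> as the sum of the two
  summation indices and apply the recursion of each series.\<close>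

lemma hermite_convolution:
  "hermite k x / fact k = (\<Sum>i\<le>k. x ^ i / fact i * half_square_coeff (k - i))"
proof -
  let ?\<alpha> = "\<lambda>i. x ^ i / fact i" and ?\<beta> = "half_square_coeff"
  define e where "e k = (\<Sum>i\<le>k. ?\<alpha> i * ?\<beta> (k - i))" for k
  have rec: "real (Suc (Suc k)) * e (Suc (Suc k)) = x * e (Suc k) - e k" for k
  proof -
    have split: "S * (A * B) = p * A * B + A * (q * B)" if "S = p + q" for S p q A B :: real
      using that by (simp add: algebra_simps)
    have "real (Suc (Suc k)) * e (Suc (Suc k)) =
        (\<Sum>i\<le>Suc (Suc k). real i * ?\<alpha> i * ?\<beta> (Suc (Suc k) - i)) +
        (\<Sum>i\<le>Suc (Suc k). ?\<alpha> i * (real (Suc (Suc k) - i) * ?\<beta> (Suc (Suc k) - i)))"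
      unfolding e_def sum_distrib_left sum.distrib[symmetric]
    proof (intro sum.cong refl)
      fix i assume "i \<in> {..Suc (Suc k)}"
      then have "real (Suc (Suc k)) = real i + real (Suc (Suc k) - i)" by simp
      then show "real (Suc (Suc k)) * (?\<alpha> i * ?\<beta> (Suc (Suc k) - i)) =
          real i * ?\<alpha> i * ?\<beta> (Suc (Suc k) - i) +
          ?\<alpha> i * (real (Suc (Suc k) - i) * ?\<beta> (Suc (Suc k) - i))"
        by (rule split)
    qed
    also have "(\<Sum>i\<le>Suc (Suc k). real i * ?\<alpha> i * ?\<beta> (Suc (Suc k) - i)) = x * e (Suc k)"
      unfolding e_def sum_distrib_left
      by (subst sum.atMost_Suc_shift) (auto intro!: sum.cong simp: field_simps simp del: of_nat_Suc)
    also have "(\<Sum>i\<le>Suc (Suc k). ?\<alpha> i * (real (Suc (Suc k) - i) * ?\<beta> (Suc (Suc k) - i))) =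
        (\<Sum>i\<le>k. ?\<alpha> i * (real (Suc (Suc (k - i))) * ?\<beta> (Suc (Suc (k - i)))))"
      by (simp add: half_square_coeff_def[of "Suc 0"] Suc_diff_le del: of_nat_Suc cong: sum.cong_simp)
         (intro sum.cong refl, simp add: of_nat_diff)
    also have "\<dots> = - e k"
      unfolding half_square_coeff_rec e_def by (simp add: sum_negf)
    finally show ?thesis by simp
  qed
  have "hermite k x / fact k = e k" for k
  proof (induction k rule: less_induct)
    case (less k)
    consider "k = 0" | "k = 1" | m where "k = Suc (Suc m)" by (metis One_nat_def not0_implies_Suc)
    then show ?case
    proof cases
      case (3 m)
      have "real (Suc (Suc m)) * (hermite k x / fact k) =
          hermite (Suc (Suc m)) x / fact (Suc m)"
        unfolding 3 by (subst fact_Suc[of "Suc m"]) (simp del: hermite.simps fact_Suc of_nat_Suc)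
      also have "\<dots> = x * (hermite (Suc m) x / fact (Suc m)) - hermite m x / fact m"
        by (simp add: diff_divide_distrib del: of_nat_Suc)
      also have "\<dots> = real (Suc (Suc m)) * e k"
        using less[of "Suc m"] less[of m] 3 rec[of m] by simp
      finally show ?thesis by (subst (asm) mult_cancel_left) simp
    qed (auto simp: e_def half_square_coeff_def)
  qed
  then show ?thesis by (simp add: e_def)
qed

text \<open>The bound on the partial sums does not depend on \<open>N\<close>, which makes the series converge in $L^2$ when
  a Gaussian variable is inserted for \<open>x\<close>. It holds because the Cauchy product may be taken of the
  series of absolute values.\<close>

lemma hermite_generating_function:
  "(\<lambda>k. hermite k x / fact k * t ^ k) sums exp (t * x - t\<^sup>2 / 2)" (is ?sums)
  "\<bar>\<Sum>k<N. hermite k x / fact k * t ^ k\<bar> \<le> exp (\<bar>t * x\<bar> + t\<^sup>2 / 2)" (is ?le)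
proof -
  define a b where "a i = (t * x) ^ i / fact i" and "b m = t ^ m * half_square_coeff m" for i m
  have prod: "hermite k x / fact k * t ^ k = (\<Sum>i\<le>k. a i * b (k - i))" for k
    unfolding hermite_convolution sum_distrib_right a_def b_def
  proof (intro sum.cong refl)
    fix i assume "i \<in> {..k}"
    then have "t ^ k = t ^ i * t ^ (k - i)" by (simp flip: power_add)
    then show "x ^ i / fact i * half_square_coeff (k - i) * t ^ k =
        (t * x) ^ i / fact i * (t ^ (k - i) * half_square_coeff (k - i))"
      by (simp add: power_mult_distrib)
  qed
  have a: "a sums exp (t * x)" unfolding a_def by (rule exp_sums)
  have "(\<lambda>i. norm (a i)) = (\<lambda>i. \<bar>t * x\<bar> ^ i / fact i)" by (auto simp: a_def power_abs)
  then have na: "(\<lambda>i. norm (a i)) sums exp \<bar>t * x\<bar>" using exp_sums[of "\<bar>t * x\<bar>"] by simp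
  have b: "b sums exp (- (t\<^sup>2 / 2))" and nb: "(\<lambda>m. norm (b m)) sums exp (t\<^sup>2 / 2)"
    using exp_neg_half_square_sums[of t] unfolding b_def by auto
  have "(\<lambda>k. \<Sum>i\<le>k. a i * b (k - i)) sums (suminf a * suminf b)"
    by (rule Cauchy_product_sums) (use na nb sums_summable in auto)
  also have "suminf a * suminf b = exp (t * x) * exp (- (t\<^sup>2 / 2))"
    using sums_unique[OF a] sums_unique[OF b] by (simp only:)
  also have "\<dots> = exp (t * x - t\<^sup>2 / 2)" by (simp flip: exp_add)
  finally show ?sums unfolding prod .
  have d: "(\<lambda>k. \<Sum>i\<le>k. norm (a i) * norm (b (k - i))) sums (exp \<bar>t * x\<bar> * exp (t\<^sup>2 / 2))"
  proof -
    have "(\<lambda>k. \<Sum>i\<le>k. norm (a i) * norm (b (k - i))) sums ((\<Sum>i. norm (a i)) * (\<Sum>i. norm (b i)))"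
      by (rule Cauchy_product_sums) (use sums_summable[OF na] sums_summable[OF nb] in simp_all)
    then show ?thesis using sums_unique[OF na] sums_unique[OF nb] by (simp only:)
  qed
  have "\<bar>\<Sum>k<N. hermite k x / fact k * t ^ k\<bar> \<le> (\<Sum>k<N. \<Sum>i\<le>k. norm (a i) * norm (b (k - i)))"
    unfolding prod by (intro sum_abs[THEN order_trans] sum_mono) (auto simp: abs_mult intro: sum_abs[THEN order_trans])
  also have "\<dots> \<le> (\<Sum>k. \<Sum>i\<le>k. norm (a i) * norm (b (k - i)))"
    using d by (intro sum_le_suminf) (auto simp: sums_iff intro!: sum_nonneg)
  also have "\<dots> = exp (\<bar>t * x\<bar> + t\<^sup>2 / 2)" unfolding sums_unique[OF d, symmetric] by (simp add: exp_add)
  finally show ?le .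
qed

lemma hermite_measurable [measurable]: "hermite k \<in> borel_measurable borel"
proof (induction k rule: less_induct)
  case (less k)
  consider "k = 0" | "k = 1" | m where "k = Suc (Suc m)" by (metis One_nat_def not0_implies_Suc)
  then show ?case
  proof cases
    case (3 m)
    have [measurable]: "hermite m \<in> borel_measurable borel" "hermite (Suc m) \<in> borel_measurable borel"
      using less 3 by auto
    have "hermite k = (\<lambda>x. x * hermite (Suc m) x - real (Suc m) * hermite m x)"
      unfolding 3 by auto
    then show ?thesis by simp
  next
    case 2
    then have "hermite k = (\<lambda>x. x)" by auto
    then show ?thesis by simp
  next
    case 1
    then have "hermite k = (\<lambda>x. 1)" by auto
    then show ?thesis by simp
  qed
qed

section \<open>Isonormal Gaussian processes\<close>

text \<open>Gaussianity enters only through the Laplace transform. Together with linearity, the exponential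
  moments determine all joint moments, for instance \<open>integral_wick_exp_mult\<close>.\<close>

locale isonormal_process = prob_space M for M :: "'w measure" +
  fixes I :: "'h::{real_inner,banach} \<Rightarrow> 'w \<Rightarrow> real"
  assumes I_measurable [measurable]: "\<And>h. I h \<in> borel_measurable M"
    and I_linear: "\<And>g h a b. AE w in M. I (a *\<^sub>R g + b *\<^sub>R h) w = a * I g w + b * I h w"
    and I_square: "\<And>h. (\<integral>w. (I h w)\<^sup>2 \<partial>M) = (norm h)\<^sup>2"
    and exp_I_integrable: "\<And>h. integrable M (\<lambda>w. exp (I h w))"
    and integral_exp_I: "\<And>h. (\<integral>w. exp (I h w) \<partial>M) = exp ((norm h)\<^sup>2 / 2)"
begin

lemma I_scaleR: "AE w in M. I (a *\<^sub>R h) w = a * I h w"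
  using I_linear[of a h 0 h] by simp

lemma I_add_scaleR: "AE w in M. I (g + t *\<^sub>R h) w = I g w + t * I h w"
  using I_linear[of 1 g t h] by simp

lemma exp_scaled_integrable: "integrable M (\<lambda>w. exp (a * I h w))"
  using exp_I_integrable[of "a *\<^sub>R h"] I_scaleR[of a h]
  by (subst integrable_cong_AE[where g = "\<lambda>w. exp (I (a *\<^sub>R h) w)"]) auto

lemma exp_abs_integrable: "integrable M (\<lambda>w. exp (\<bar>a * I h w\<bar> + b))"
proof (rule Bochner_Integration.integrable_bound)
  show "integrable M (\<lambda>w. exp b * (exp (a * I h w) + exp ((- a) * I h w)))"
    using exp_scaled_integrable by (intro integrable_mult_right Bochner_Integration.integrable_add) blast+
  show "AE w in M. norm (exp (\<bar>a * I h w\<bar> + b)) \<le> norm (exp b * (exp (a * I h w) + exp ((- a) * I h w)))"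
  proof (rule AE_I2)
    fix w
    define y where "y = a * I h w"
    have "exp \<bar>y\<bar> \<le> exp y + exp (- y)" by (simp add: abs_if)
    then have "exp (\<bar>y\<bar> + b) \<le> exp b * (exp y + exp (- y))" by (simp add: exp_add mult.commute)
    then have "norm (exp (\<bar>y\<bar> + b)) \<le> norm (exp b * (exp y + exp (- y)))" by simp
    then show "norm (exp (\<bar>a * I h w\<bar> + b)) \<le> norm (exp b * (exp (a * I h w) + exp ((- a) * I h w)))"
      by (simp only: y_def mult_minus_left)
  qed
qed measurable

lemma sq_integrable_exp_abs: "sq_integrable M (\<lambda>w. exp (\<bar>a * I h w\<bar> + b))"
proof -
  have "(exp (\<bar>a * I h w\<bar> + b))\<^sup>2 = exp (\<bar>(2 * a) * I h w\<bar> + 2 * b)" for w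
    by (simp add: power2_eq_square abs_mult flip: exp_add)
  then show ?thesis using exp_abs_integrable[of "2 * a" h "2 * b"]
    by (simp add: sq_integrable_def)
qed

lemma wick_exp_I: "wick_exp M (I h) w = exp (I h w - (norm h)\<^sup>2 / 2)"
  by (simp add: wick_exp_def I_square)

lemma wick_exp_I_scaleR:
  "AE w in M. wick_exp M (I (t *\<^sub>R h)) w = exp (t * I h w - t\<^sup>2 * (norm h)\<^sup>2 / 2)"
  using I_scaleR[of t h] by eventually_elim (simp add: wick_exp_I power_mult_distrib)

lemma wick_exp_measurable [measurable]: "wick_exp M (I h) \<in> borel_measurable M"
  unfolding wick_exp_I by measurable

lemma sq_integrable_dominated:
  assumes "sq_integrable M g" "f \<in> borel_measurable M" "AE w in M. \<bar>f w\<bar> \<le> g w"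
  shows "sq_integrable M f"
proof -
  have "integrable M (\<lambda>w. (f w)\<^sup>2)"
  proof (rule Bochner_Integration.integrable_bound)
    show "integrable M (\<lambda>w. (g w)\<^sup>2)" using assms(1) by (simp add: sq_integrable_def)
    show "(\<lambda>w. (f w)\<^sup>2) \<in> borel_measurable M" using assms(2) by measurable
    show "AE w in M. norm ((f w)\<^sup>2) \<le> norm ((g w)\<^sup>2)"
      using assms(3)
    proof eventually_elim
      case (elim w)
      then have "\<bar>f w\<bar>\<^sup>2 \<le> (g w)\<^sup>2" by (intro power_mono) auto
      then show ?case by simp
    qed
  qed
  with assms(2) show ?thesis by (simp add: sq_integrable_def)
qed

lemma sq_integrable_wick_exp: "sq_integrable M (wick_exp M (I h))"
proof (rule sq_integrable_dominated)
  show "sq_integrable M (\<lambda>w. exp (\<bar>1 * I h w\<bar> + 0))" by (rule sq_integrable_exp_abs)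
  show "AE w in M. \<bar>wick_exp M (I h) w\<bar> \<le> exp (\<bar>1 * I h w\<bar> + 0)"
  proof (rule AE_I2)
    fix w
    have "I h w - (norm h)\<^sup>2 / 2 \<le> \<bar>I h w\<bar>"
      using abs_ge_self[of "I h w"] zero_le_power2[of "norm h"] by argo
    then show "\<bar>wick_exp M (I h) w\<bar> \<le> exp (\<bar>1 * I h w\<bar> + 0)" by (simp add: wick_exp_I)
  qed
qed measurable

lemma integral_wick_exp_mult:
  "(\<integral>w. wick_exp M (I g) w * wick_exp M (I h) w \<partial>M) = exp (g \<bullet> h)"
proof -
  have "(\<integral>w. wick_exp M (I g) w * wick_exp M (I h) w \<partial>M) =
      (\<integral>w. exp (- ((norm g)\<^sup>2 / 2 + (norm h)\<^sup>2 / 2)) * exp (I (g + 1 *\<^sub>R h) w) \<partial>M)"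
    using I_add_scaleR[of g 1 h]
    by (intro integral_cong_AE) (auto simp: wick_exp_I algebra_simps simp flip: exp_add)
  also have "\<dots> = exp (- ((norm g)\<^sup>2 / 2 + (norm h)\<^sup>2 / 2)) * exp ((norm (g + h))\<^sup>2 / 2)"
    by (simp only: integral_mult_right_zero integral_exp_I scaleR_one)
  also have "\<dots> = exp (- ((norm g)\<^sup>2 / 2 + (norm h)\<^sup>2 / 2) + (norm (g + h))\<^sup>2 / 2)"
    by (rule mult_exp_exp)
  also have "- ((norm g)\<^sup>2 / 2 + (norm h)\<^sup>2 / 2) + (norm (g + h))\<^sup>2 / 2 = g \<bullet> h"
    by (simp add: power2_norm_eq_inner inner_add inner_commute field_simps)
  finally show ?thesis .
qed

text \<open>Analytic continuation from real to imaginary exponents: for a fixed \<open>h\<close>, the $S$-transform along the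
  ray through \<open>h\<close> is up to a factor a power series whose \<open>k\<close>th coefficient is the \<open>k\<close>th moment of
  \<open>I h\<close> weighted with \<open>\<xi>\<close>, divided by \<open>k!\<close>. Only these moments enter the series of cosine and
  sine.\<close>

lemma fourier_eq_0_if_S_transform_0:
  assumes \<xi>: "sq_integrable M \<xi>" and S: "\<And>h. S_transform M I \<xi> h = 0"
  shows "(\<integral>w. \<xi> w * cos (I h w) \<partial>M) = 0" "(\<integral>w. \<xi> w * sin (I h w) \<partial>M) = 0"
proof -
  have [measurable]: "\<xi> \<in> borel_measurable M" using \<xi> by (rule sq_integrable_measurable)
  have int: "integrable M (\<lambda>w. \<xi> w * exp \<bar>t * I h w\<bar>)" for t
    using sq_integrable_mult[OF \<xi> sq_integrable_exp_abs[of t h 0]] by simp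
  have "(\<integral>w. \<xi> w * exp (t * I h w) \<partial>M) = 0" for t
  proof -
    have "0 = S_transform M I \<xi> (t *\<^sub>R h)" by (simp add: S)
    also have "\<dots> = (\<integral>w. exp (- (t\<^sup>2 * (norm h)\<^sup>2 / 2)) * (\<xi> w * exp (t * I h w)) \<partial>M)"
      unfolding S_transform_def using wick_exp_I_scaleR[of t h]
      by (intro integral_cong_AE) (auto simp: mult_exp_exp)
    also have "\<dots> = exp (- (t\<^sup>2 * (norm h)\<^sup>2 / 2)) * (\<integral>w. \<xi> w * exp (t * I h w) \<partial>M)"
      by (rule integral_mult_right_zero)
    finally show ?thesis by simp
  qed
  then have "(\<lambda>k. 1 / fact k * (\<integral>w. \<xi> w * I h w ^ k \<partial>M) * t ^ k) sums 0" for t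
    using integral_power_series_sums[of "I h" M \<xi> exp t "\<lambda>k. 1 / fact k"] exp_sums int by simp
  then have "1 / fact k * (\<integral>w. \<xi> w * I h w ^ k \<partial>M) = 0" for k
    using power_series_eq_imp_coeff_eq[of "\<lambda>k. 1 / fact k * (\<integral>w. \<xi> w * I h w ^ k \<partial>M)" "\<lambda>_. 0" "\<lambda>_. 0"]
    by simp
  then have mom: "(\<integral>w. \<xi> w * I h w ^ k \<partial>M) = 0" for k by simp
  have series: "f \<in> borel_measurable borel \<Longrightarrow> (\<And>k. \<bar>c k\<bar> \<le> 1 / fact k) \<Longrightarrow> (\<And>x. (\<lambda>k. c k * x ^ k) sums f x) \<Longrightarrow>
      (\<integral>w. \<xi> w * f (I h w) \<partial>M) = 0" for f :: "real \<Rightarrow> real" and c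
    using integral_power_series_sums[of "I h" M \<xi> f 1 c] int[of 1] mom by (simp add: sums_iff)
  show "(\<integral>w. \<xi> w * cos (I h w) \<partial>M) = 0"
    by (rule series[of cos cos_coeff])
      (use cos_converges in \<open>auto simp: cos_coeff_def real_scaleR_def[symmetric] simp del: real_scaleR_def\<close>)
  show "(\<integral>w. \<xi> w * sin (I h w) \<partial>M) = 0"
    by (rule series[of sin sin_coeff])
      (use sin_converges in \<open>auto simp: sin_coeff_def real_scaleR_def[symmetric] simp del: real_scaleR_def\<close>)
qed

text \<open>Indicators are introduced one at a time. By the addition theorems, the product of a trigonometric
  function of \<open>I h\<close> with one of \<open>t * I g\<close> is again a combination of trigonometric functions of
  \<open>I (h + t g)\<close> and \<open>I (h - t g)\<close>, to which the induction hypothesis applies; so the Fourier transform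
  in the direction \<open>g\<close> vanishes and can be exchanged for an indicator. The claim is made for cosine
  and sine simultaneously, because the addition theorems mix them.\<close>

lemma cylinder_eq_0_if_S_transform_0:
  assumes \<xi>: "sq_integrable M \<xi>" and S: "\<And>h. S_transform M I \<xi> h = 0"
    and B: "\<And>g B. (g, B) \<in> set ps \<Longrightarrow> B \<in> sets borel"
  shows "(\<integral>w. \<xi> w * (\<Prod>(g, B)\<leftarrow>ps. indicator B (I g w)) * cos (I h w) \<partial>M) = 0 \<and>
    (\<integral>w. \<xi> w * (\<Prod>(g, B)\<leftarrow>ps. indicator B (I g w)) * sin (I h w) \<partial>M) = 0"
  using B
proof (induction ps arbitrary: h)
  case Nil
  then show ?case using fourier_eq_0_if_S_transform_0[OF \<xi> S] by simp
next
  case (Cons q ps)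
  obtain g B where q: "q = (g, B)" by (cases q)
  have [measurable]: "B \<in> sets borel" "\<xi> \<in> borel_measurable M"
    using Cons.prems[of g B] q \<xi> by auto
  have \<xi>_int: "integrable M \<xi>" using \<xi> by (rule sq_integrable_integrable)
  define W where "W w = \<xi> w * (\<Prod>(g, B)\<leftarrow>ps. indicator B (I g w))" for w
  have "(\<lambda>w. (\<Prod>(g, B)\<leftarrow>ps. indicator B (I g w)) :: real) \<in> borel_measurable M"
    using Cons.prems by (intro cylinder_indicator_measurable) auto
  then have [measurable]: "W \<in> borel_measurable M" unfolding W_def by measurable
  have prod_le: "\<bar>\<Prod>(g, B)\<leftarrow>ps. indicator B (I g w) :: real\<bar> \<le> 1" for w
    by (induction ps) (auto simp: indicator_def)
  have W_int: "integrable M (\<lambda>w. W w * f w)" if "f \<in> borel_measurable M" "\<And>w. \<bar>f w\<bar> \<le> 1" for f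
  proof (rule Bochner_Integration.integrable_bound[OF \<xi>_int])
    show "(\<lambda>w. W w * f w) \<in> borel_measurable M" using that by measurable
    show "AE w in M. norm (W w * f w) \<le> norm (\<xi> w)"
    proof (rule AE_I2)
      fix w
      have "\<bar>(\<Prod>(g, B)\<leftarrow>ps. indicator B (I g w)) * f w\<bar> \<le> 1 * 1"
        unfolding abs_mult using prod_le that(2) by (intro mult_mono) auto
      then show "norm (W w * f w) \<le> norm (\<xi> w)"
        by (simp add: W_def abs_mult mult.assoc mult_left_le)
    qed
  qed
  have IH: "(\<integral>w. W w * cos (I h w) \<partial>M) = 0" "(\<integral>w. W w * sin (I h w) \<partial>M) = 0" for h
    using Cons.IH[of h] Cons.prems unfolding W_def by auto
  \<comment> \<open>the four addition theorems in one form: \<open>p\<close> is the function on the right-hand side and \<open>c\<close> is a sign\<close>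
  have two: "(\<integral>w. W w * f (I h w) * k (t * I g w) \<partial>M) = 0"
    if eq: "\<And>x y. f x * k y = (p (x + y) + c * p (x - y)) / 2"
      and p: "p \<in> {cos, sin}" and [measurable]: "f \<in> borel_measurable borel" "k \<in> borel_measurable borel"
    for f k p :: "real \<Rightarrow> real" and t c
  proof -
    have [measurable]: "p \<in> borel_measurable borel" and p1: "\<And>x. \<bar>p x\<bar> \<le> 1"
      and p0: "\<And>h. (\<integral>w. W w * p (I h w) \<partial>M) = 0" using p IH by auto
    have int: "integrable M (\<lambda>w. W w * p (I h w))" for h using p1 by (intro W_int) auto
    have "(\<integral>w. W w * f (I h w) * k (t * I g w) \<partial>M) =
        (\<integral>w. 1 / 2 * (W w * p (I (h + t *\<^sub>R g) w)) + c / 2 * (W w * p (I (h + (- t) *\<^sub>R g) w)) \<partial>M)"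
    proof (rule integral_cong_AE)
      show "AE w in M. W w * f (I h w) * k (t * I g w) =
          1 / 2 * (W w * p (I (h + t *\<^sub>R g) w)) + c / 2 * (W w * p (I (h + (- t) *\<^sub>R g) w))"
        using I_add_scaleR[of h t g] I_add_scaleR[of h "- t" g]
      proof eventually_elim
        case (elim w)
        show ?case unfolding elim mult.assoc eq by (simp add: field_simps)
      qed
    qed measurable
    also have "\<dots> = 0" using int by (simp add: p0)
    finally show ?thesis .
  qed
  have final: "(\<integral>w. W w * f (I h w) * indicator B (I g w) \<partial>M) = 0"
    if f: "f \<in> {cos, sin}" for f
  proof (rule integral_indicator_eq_0_if_fourier_0)
    show "integrable M (\<lambda>w. W w * f (I h w))" using f by (intro W_int) auto
    show "(\<integral>w. W w * f (I h w) * cos (t * I g w) \<partial>M) = 0" for t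
      using f by (intro two[of f cos f 1]) (auto simp: cos_times_cos sin_times_cos)
    show "(\<integral>w. W w * f (I h w) * sin (t * I g w) \<partial>M) = 0" for t
    proof (cases "f = cos")
      case True
      then show ?thesis by (intro two[of f sin sin "-1"]) (auto simp: cos_times_sin)
    next
      case False
      then have "f = sin" using f by auto
      have *: "(\<integral>w. W w * (- sin (I h w)) * sin (t * I g w) \<partial>M) = 0"
        by (intro two[of "\<lambda>x. - sin x" sin cos "-1"]) (auto simp: sin_times_sin field_simps)
      have "(\<integral>w. W w * f (I h w) * sin (t * I g w) \<partial>M) =
          - (\<integral>w. W w * (- sin (I h w)) * sin (t * I g w) \<partial>M)"
        unfolding \<open>f = sin\<close> by (subst integral_minus[symmetric]) simp
      then show ?thesis using * by simp
    qed
  qed measurable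
  show ?case using final[of cos] final[of sin] by (simp add: q W_def ac_simps)
qed

lemma wick_exp_hermite_expansion:
  assumes h: "norm h = 1"
  shows "(\<lambda>N. \<integral>w. ((\<Sum>k<N. t ^ k / fact k * hermite k (I h w)) - wick_exp M (I (t *\<^sub>R h)) w)\<^sup>2 \<partial>M)
    \<longlonglongrightarrow> 0"
proof -
  let ?s = "\<lambda>N w. \<Sum>k<N. t ^ k / fact k * hermite k (I h w)" and ?e = "wick_exp M (I (t *\<^sub>R h))"
  let ?w = "\<lambda>w. exp (\<bar>t * I h w\<bar> + t\<^sup>2 / 2)"
  have e: "AE w in M. ?e w = exp (t * I h w - t\<^sup>2 / 2)" using wick_exp_I_scaleR[of t h] h by simp
  have s_eq: "?s N w = (\<Sum>k<N. hermite k (I h w) / fact k * t ^ k)" for N w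
    by (intro sum.cong) auto
  have s_le: "\<bar>?s N w\<bar> \<le> ?w w" for N w
    unfolding s_eq by (rule hermite_generating_function(2))
  have "(\<lambda>N. \<integral>w. (?s N w - ?e w)\<^sup>2 \<partial>M) \<longlonglongrightarrow> (\<integral>w. 0 \<partial>M)"
  proof (rule integral_dominated_convergence)
    show "integrable M (\<lambda>w. (2 * ?w w)\<^sup>2)"
      using sq_integrable_scale[OF sq_integrable_exp_abs[of t h "t\<^sup>2 / 2"], of 2]
      by (simp add: sq_integrable_def)
    show "AE w in M. (\<lambda>N. (?s N w - ?e w)\<^sup>2) \<longlonglongrightarrow> 0"
      using e
    proof eventually_elim
      case (elim w)
      have "(\<lambda>N. ?s N w) \<longlonglongrightarrow> ?e w"
        using hermite_generating_function(1)[of "I h w" t] unfolding s_eq sums_def elim .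
      then show ?case by (intro tendsto_null_power tendsto_eq_intros) (auto intro: LIM_zero)
    qed
    show "AE w in M. norm ((?s N w - ?e w)\<^sup>2) \<le> (2 * ?w w)\<^sup>2" for N
      using e
    proof eventually_elim
      case (elim w)
      have "t * I h w - t\<^sup>2 / 2 \<le> \<bar>t * I h w\<bar> + t\<^sup>2 / 2"
        using abs_ge_self[of "t * I h w"] zero_le_power2[of t] by argo
      then have "\<bar>?e w\<bar> \<le> ?w w" unfolding elim by simp
      with s_le[of w N] have "\<bar>?s N w - ?e w\<bar> \<le> 2 * ?w w" by linarith
      then have "\<bar>?s N w - ?e w\<bar>\<^sup>2 \<le> (2 * ?w w)\<^sup>2" by (intro power_mono) auto
      then show ?case by simp
    qed
  qed measurable
  then show ?thesis by simp
qed

end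

section \<open>The Wiener integral as an isonormal process\<close>

text \<open>Completion of the square in the exponent.\<close>

lemma exp_mult_normal_density:
  assumes "0 < \<sigma>"
  shows "normal_density 0 \<sigma> x * exp x = exp (\<sigma>\<^sup>2 / 2) * normal_density (\<sigma>\<^sup>2) \<sigma> x"
proof -
  have "- x\<^sup>2 / (2 * \<sigma>\<^sup>2) + x = \<sigma>\<^sup>2 / 2 + - (x - \<sigma>\<^sup>2)\<^sup>2 / (2 * \<sigma>\<^sup>2)"
    using assms by (simp add: power2_eq_square field_simps)
  then have "exp (- x\<^sup>2 / (2 * \<sigma>\<^sup>2)) * exp x = exp (\<sigma>\<^sup>2 / 2) * exp (- (x - \<sigma>\<^sup>2)\<^sup>2 / (2 * \<sigma>\<^sup>2))"
    by (simp only: mult_exp_exp)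
  then show ?thesis by (simp add: normal_density_def)
qed

lemma (in prob_space) centered_gaussian_exp_moment:
  assumes Y [measurable]: "Y \<in> borel_measurable M" and g: "centered_gaussian M Y"
  shows "integrable M (\<lambda>w. exp (Y w))" "(\<integral>w. exp (Y w) \<partial>M) = exp ((\<integral>w. (Y w)\<^sup>2 \<partial>M) / 2)"
proof -
  have "integrable M (\<lambda>w. exp (Y w)) \<and> (\<integral>w. exp (Y w) \<partial>M) = exp ((\<integral>w. (Y w)\<^sup>2 \<partial>M) / 2)"
    using g unfolding centered_gaussian_def
  proof (elim disjE exE conjE)
    assume zero: "AE w in M. Y w = 0"
    have "(\<integral>w. (Y w)\<^sup>2 \<partial>M) = 0"
      using zero by (intro integral_eq_zero_AE) auto
    moreover have "(\<integral>w. exp (Y w) \<partial>M) = (\<integral>w. 1 \<partial>M)"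
      using zero by (intro integral_cong_AE) auto
    moreover have "integrable M (\<lambda>w. exp (Y w)) \<longleftrightarrow> integrable M (\<lambda>w. 1::real)"
      using zero by (intro integrable_cong_AE) auto
    ultimately show ?thesis by (simp add: prob_space)
  next
    fix \<sigma> :: real assume \<sigma>: "0 < \<sigma>" and d: "distributed M lborel Y (\<lambda>x. ennreal (normal_density 0 \<sigma> x))"
    have "(\<integral>w. (Y w)\<^sup>2 \<partial>M) = \<sigma>\<^sup>2"
      using normal_distributed_variance[OF \<sigma> d] normal_distributed_expectation[OF \<sigma> d] by simp
    moreover have "integrable lborel (\<lambda>x. normal_density 0 \<sigma> x * exp x)"
      unfolding exp_mult_normal_density[OF \<sigma>] using \<sigma> by simp
    then have "integrable M (\<lambda>w. exp (Y w))" using distributed_integrable[OF d, of exp] by simp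
    moreover have "(\<integral>x. normal_density 0 \<sigma> x * exp x \<partial>lborel) = exp (\<sigma>\<^sup>2 / 2)"
      unfolding exp_mult_normal_density[OF \<sigma>] using \<sigma> by simp
    then have "(\<integral>w. exp (Y w) \<partial>M) = exp (\<sigma>\<^sup>2 / 2)" using distributed_integral[OF d, of exp] by simp
    ultimately show ?thesis by simp
  qed
  then show "integrable M (\<lambda>w. exp (Y w))" "(\<integral>w. exp (Y w) \<partial>M) = exp ((\<integral>w. (Y w)\<^sup>2 \<partial>M) / 2)"
    by auto
qed

text \<open>Used with the Cauchy-Schwarz inequality to derive convergence of exponential moments from
  convergence in $L^2$.\<close>

lemma abs_exp_diff_le: "\<bar>exp x - exp y\<bar> \<le> \<bar>x - y\<bar> * (exp x + exp (y::real))"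
proof -
  have *: "exp v - exp u \<le> (v - u) * (exp u + exp v)" if "u \<le> v" for u v :: real
  proof -
    have "1 + (u - v) \<le> exp (u - v)" by (rule exp_ge_add_one_self)
    then have "exp v * (1 + (u - v)) \<le> exp v * exp (u - v)" by simp
    also have "\<dots> = exp u" by (simp add: mult_exp_exp)
    finally have "exp v - exp u \<le> (v - u) * exp v" by (simp add: algebra_simps)
    also have "\<dots> \<le> (v - u) * (exp u + exp v)" using that by (intro mult_left_mono) auto
    finally show ?thesis .
  qed
  show ?thesis
  proof (cases "x \<le> y")
    case True
    then show ?thesis using *[OF True] by (simp add: add.commute)
  next
    case False
    then show ?thesis using *[of y x] by (simp add: add.commute)
  qed
qed

locale wiener_integral_space =
  fixes M :: "'w measure" and T :: real and X :: "real \<Rightarrow> 'w \<Rightarrow> real"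
    and emb :: "(real \<Rightarrow> real) \<Rightarrow> 'h::{real_inner,banach}" and I :: "'h \<Rightarrow> 'w \<Rightarrow> real"
  assumes T_pos: "0 < T" and prob: "prob_space M"
    and gaussian: "measurable_centered_gaussian_process M T X"
    and integrands: "integrand_space M T X emb"
    and wiener: "wiener_integral M T X emb I"
begin

sublocale prob_space M by (rule prob)

lemma X_measurable:
  assumes "s \<in> {0..T}"
  shows "X s \<in> borel_measurable M"
proof -
  have "(\<lambda>(t, w). X t w) \<in> borel_measurable (restrict_space borel {0..T} \<Otimes>\<^sub>M M)"
    using gaussian unfolding measurable_centered_gaussian_process_def by blast
  from measurable_Pair2[OF this, of s] assms show ?thesis by (simp add: space_restrict_space)
qed

lemma sets_process_filtration: "sets (process_filtration M X T) =
    sigma_sets (space M) {X s -` B \<inter> space M |s B. s \<in> {0..T} \<and> B \<in> sets borel}"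
  unfolding process_filtration_def by (rule sets_measure_of) auto

lemma subalgebra_process_filtration: "subalgebra M (process_filtration M X T)"
proof -
  have "space (process_filtration M X T) = space M"
    unfolding process_filtration_def by (rule space_measure_of) auto
  moreover have "sets (process_filtration M X T) \<subseteq> sets M"
    unfolding sets_process_filtration
    by (intro sets.sigma_sets_subset) (auto intro: measurable_sets[OF X_measurable])
  ultimately show ?thesis by (simp add: subalgebra_def)
qed

lemma L2X_sq_integrable: "\<xi> \<in> L2X M T X \<Longrightarrow> sq_integrable M \<xi>"
  using measurable_from_subalg[OF subalgebra_process_filtration]
  by (auto simp: L2X_def sq_integrable_def)

lemma L2XI: "\<xi> \<in> borel_measurable (process_filtration M X T) \<Longrightarrow> sq_integrable M \<xi> \<Longrightarrow> \<xi> \<in> L2X M T X"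
  by (simp add: L2X_def sq_integrable_def)

lemma I_sq_integrable: "sq_integrable M (I h)"
  using wiener by (intro L2X_sq_integrable)
    (auto simp: wiener_integral_def first_chaos_def L2_closed_span_def)

lemma I_lin: "AE w in M. I (a *\<^sub>R g + b *\<^sub>R h) w = a * I g w + b * I h w"
  and I_sq: "(\<integral>w. (I h w)\<^sup>2 \<partial>M) = (norm h)\<^sup>2"
  and I_indicator: "t \<in> {0..T} \<Longrightarrow> AE w in M. I (emb (indicator {0<..t})) w = X t w"
  using wiener unfolding wiener_integral_def by blast+

lemma indicator_in_step_functions: "t \<in> {0..T} \<Longrightarrow> indicator {0<..t} \<in> step_functions T"
  unfolding step_functions_def by (intro CollectI exI[of _ "{t}"] exI[of _ "\<lambda>_. 1"]) auto

lemma emb_linear: "f \<in> step_functions T \<Longrightarrow> g \<in> step_functions T \<Longrightarrow>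
    emb (\<lambda>u. a * f u + b * g u) = a *\<^sub>R emb f + b *\<^sub>R emb g"
  using integrands unfolding integrand_space_def by blast

lemma emb_step_function:
  assumes "finite S" "S \<subseteq> {0..T}"
  shows "emb (\<lambda>u. \<Sum>t\<in>S. a t * indicator {0<..t} u) = (\<Sum>t\<in>S. a t *\<^sub>R emb (indicator {0<..t}))"
  using assms
proof (induction S rule: finite_induct)
  case empty
  have "indicator {0<..0::real} \<in> step_functions T" using T_pos by (intro indicator_in_step_functions) auto
  from emb_linear[OF this this, of 0 0] show ?case by simp
next
  case (insert t S)
  have "(\<lambda>u. \<Sum>t\<in>S. a t * indicator {0<..t} u) \<in> step_functions T"
    using insert unfolding step_functions_def by blast
  note lin = emb_linear[OF indicator_in_step_functions this, of t "a t" 1]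
  have eq: "(\<lambda>u. \<Sum>t\<in>insert t S. a t * indicator {0<..t} u) =
      (\<lambda>u. a t * indicator {0<..t} u + 1 * (\<Sum>t\<in>S. a t * indicator {0<..t} u))"
    by (rule ext) (simp only: sum.insert[OF insert(1,2)] mult_1)
  have "emb (\<lambda>u. \<Sum>t\<in>S. a t * indicator {0<..t} u) = (\<Sum>t\<in>S. a t *\<^sub>R emb (indicator {0<..t}))"
    using insert by blast
  then show ?case
    using insert.prems unfolding eq by (subst lin) (simp_all only: sum.insert[OF insert(1,2)] scaleR_one, auto)
qed

lemma I_step_function:
  assumes "finite S" "S \<subseteq> {0..T}"
  shows "AE w in M. I (\<Sum>t\<in>S. a t *\<^sub>R emb (indicator {0<..t})) w = (\<Sum>t\<in>S. a t * X t w)"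
  using assms
proof (induction S rule: finite_induct)
  case empty
  show ?case using I_lin[of 0 0 0 0] by simp
next
  case (insert t S)
  let ?g = "\<Sum>t\<in>S. a t *\<^sub>R emb (indicator {0<..t})"
  have "AE w in M. I ?g w = (\<Sum>t\<in>S. a t * X t w)" using insert by auto
  moreover have "AE w in M. I (emb (indicator {0<..t})) w = X t w" using insert by (intro I_indicator) auto
  ultimately show ?case
    using I_lin[of "a t" "emb (indicator {0<..t})" 1 ?g]
    by eventually_elim (use insert in simp)
qed

definition step_vectors :: "'h set" where
  "step_vectors = {\<Sum>t\<in>S. a t *\<^sub>R emb (indicator {0<..t}) |S a. finite S \<and> S \<subseteq> {0..T}}"

lemma closure_step_vectors: "closure step_vectors = UNIV"
proof -
  have "emb ` step_functions T \<subseteq> step_vectors"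
    unfolding step_functions_def step_vectors_def using emb_step_function by blast
  moreover have "closure (emb ` step_functions T) = UNIV"
    using integrands unfolding integrand_space_def by blast
  ultimately show ?thesis using closure_mono by blast
qed

lemma exp_I_step_vector:
  assumes "g \<in> step_vectors"
  shows "integrable M (\<lambda>w. exp (I g w))" "(\<integral>w. exp (I g w) \<partial>M) = exp ((norm g)\<^sup>2 / 2)"
proof -
  obtain S a where S: "finite S" "S \<subseteq> {0..T}" and g: "g = (\<Sum>t\<in>S. a t *\<^sub>R emb (indicator {0<..t}))"
    using assms unfolding step_vectors_def by blast
  let ?Y = "\<lambda>w. \<Sum>t\<in>S. a t * X t w"
  have Y [measurable]: "?Y \<in> borel_measurable M"
    using S X_measurable by (intro borel_measurable_sum borel_measurable_times) auto
  have [measurable]: "I g \<in> borel_measurable M"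
    using I_sq_integrable by (rule sq_integrable_measurable)
  have ae: "AE w in M. I g w = ?Y w" unfolding g by (rule I_step_function[OF S])
  have cg: "centered_gaussian M ?Y"
    using gaussian S unfolding measurable_centered_gaussian_process_def by blast
  have "(\<integral>w. (?Y w)\<^sup>2 \<partial>M) = (\<integral>w. (I g w)\<^sup>2 \<partial>M)" using ae by (intro integral_cong_AE) auto
  then have sq: "(\<integral>w. (?Y w)\<^sup>2 \<partial>M) = (norm g)\<^sup>2" by (simp only: I_sq)
  have "integrable M (\<lambda>w. exp (I g w)) \<longleftrightarrow> integrable M (\<lambda>w. exp (?Y w))"
    using ae by (intro integrable_cong_AE) auto
  then show "integrable M (\<lambda>w. exp (I g w))" using centered_gaussian_exp_moment(1)[OF Y cg] by blast
  have "(\<integral>w. exp (I g w) \<partial>M) = (\<integral>w. exp (?Y w) \<partial>M)" using ae by (intro integral_cong_AE) auto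
  then show "(\<integral>w. exp (I g w) \<partial>M) = exp ((norm g)\<^sup>2 / 2)"
    using centered_gaussian_exp_moment(2)[OF Y cg] sq by simp
qed

text \<open>These second moments are uniformly bounded along a convergent sequence of step vectors, which is
  what allows the passage to the limit in \<open>exp_moment_I\<close>.\<close>

lemma exp_double_I_step_vector:
  assumes "g \<in> step_vectors"
  shows "sq_integrable M (\<lambda>w. exp (I g w))" "(\<integral>w. (exp (I g w))\<^sup>2 \<partial>M) = exp (2 * (norm g)\<^sup>2)"
proof -
  obtain S a where S: "finite S" "S \<subseteq> {0..T}" and g: "g = (\<Sum>t\<in>S. a t *\<^sub>R emb (indicator {0<..t}))"
    using assms unfolding step_vectors_def by blast
  have "2 *\<^sub>R g = (\<Sum>t\<in>S. (2 * a t) *\<^sub>R emb (indicator {0<..t}))" by (simp add: g scaleR_sum_right)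
  then have "2 *\<^sub>R g \<in> step_vectors"
    using S unfolding step_vectors_def by (intro CollectI exI[of _ S] exI[of _ "\<lambda>t. 2 * a t"]) simp
  note e = exp_I_step_vector[OF this]
  have [measurable]: "I h \<in> borel_measurable M" for h
    using I_sq_integrable by (rule sq_integrable_measurable)
  have ae: "AE w in M. (exp (I g w))\<^sup>2 = exp (I (2 *\<^sub>R g) w)"
    using I_lin[of 2 g 0 g] by eventually_elim (simp add: exp_double)
  have "integrable M (\<lambda>w. (exp (I g w))\<^sup>2) \<longleftrightarrow> integrable M (\<lambda>w. exp (I (2 *\<^sub>R g) w))"
    using ae by (intro integrable_cong_AE) auto
  then show "sq_integrable M (\<lambda>w. exp (I g w))" using e by (simp add: sq_integrable_def)
  have "(\<integral>w. (exp (I g w))\<^sup>2 \<partial>M) = (\<integral>w. exp (I (2 *\<^sub>R g) w) \<partial>M)"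
    using ae by (intro integral_cong_AE) auto
  then show "(\<integral>w. (exp (I g w))\<^sup>2 \<partial>M) = exp (2 * (norm g)\<^sup>2)"
    using e by (simp add: power_mult_distrib)
qed

text \<open>Step vectors are dense, so \<open>I h\<close> is the $L^2$-limit of linear combinations of the process, for which
  the claim is the Laplace transform of a centered normal law. Fatou's lemma bounds the second moment of
  \<open>exp (I h)\<close>, and then \<open>abs_exp_diff_le\<close> and the Cauchy-Schwarz inequality carry the exponential moments
  to the limit.\<close>

lemma exp_moment_I:
  "integrable M (\<lambda>w. exp (I h w))" "(\<integral>w. exp (I h w) \<partial>M) = exp ((norm h)\<^sup>2 / 2)"
proof -
  have meas [measurable]: "I h \<in> borel_measurable M" for h
    using I_sq_integrable by (rule sq_integrable_measurable)
  have "h \<in> closure step_vectors" by (simp add: closure_step_vectors)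
  then obtain g where g: "\<And>n. g n \<in> step_vectors" and lim: "g \<longlonglongrightarrow> h"
    unfolding closure_sequential by blast
  have dist: "(\<integral>w. (I (g n) w - I h w)\<^sup>2 \<partial>M) = (norm (g n - h))\<^sup>2" for n
  proof -
    have "(\<integral>w. (I (g n) w - I h w)\<^sup>2 \<partial>M) = (\<integral>w. (I (g n - h) w)\<^sup>2 \<partial>M)"
    proof (rule integral_cong_AE)
      show "AE w in M. (I (g n) w - I h w)\<^sup>2 = (I (g n - h) w)\<^sup>2"
        using I_lin[of 1 "g n" "-1" h] by eventually_elim simp
    qed measurable
    then show ?thesis by (simp only: I_sq)
  qed
  have "(\<lambda>n. norm (g n - h)) \<longlonglongrightarrow> 0" using lim by (simp add: LIM_zero tendsto_norm_zero)
  then have lim2: "(\<lambda>n. \<integral>w. (I (g n) w - I h w)\<^sup>2 \<partial>M) \<longlonglongrightarrow> 0"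
    unfolding dist by (intro tendsto_null_power) auto
  from L2_tendsto_AE_subseq[OF I_sq_integrable I_sq_integrable lim2]
  obtain r :: "nat \<Rightarrow> nat" where r: "strict_mono r" "AE w in M. (\<lambda>n. I (g (r n)) w) \<longlonglongrightarrow> I h w" .
  obtain K where K: "\<And>n. norm (g n) \<le> K"
    using convergent_imp_Bseq[OF convergentI[OF lim]] by (auto simp: Bseq_def)
  have sq_le: "(\<integral>w. (exp (I (g n) w))\<^sup>2 \<partial>M) \<le> exp (2 * K\<^sup>2)" for n
    unfolding exp_double_I_step_vector(2)[OF g] using K[of n] by (simp add: power_mono)
  have "AE w in M. (\<lambda>n. exp (I (g (r n)) w)) \<longlonglongrightarrow> exp (I h w)"
    using r(2) by eventually_elim (intro tendsto_intros)
  note lim_exp = this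
  have meas_exp: "(\<lambda>w. exp (I h w)) \<in> borel_measurable M" by measurable
  have sqh: "sq_integrable M (\<lambda>w. exp (I h w))"
    by (rule sq_integrable_limit(1)[OF exp_double_I_step_vector(1)[OF g] meas_exp lim_exp
          always_eventually[OF allI[OF sq_le]]])
  then show int: "integrable M (\<lambda>w. exp (I h w))" by (rule sq_integrable_integrable)
  let ?A = "2 * exp (2 * K\<^sup>2) + 2 * (\<integral>w. (exp (I h w))\<^sup>2 \<partial>M)"
  let ?d = "\<lambda>n. (\<integral>w. exp (I (g n) w) \<partial>M) - (\<integral>w. exp (I h w) \<partial>M)"
  have d_le: "(?d n)\<^sup>2 \<le> (norm (g n - h))\<^sup>2 * ?A" for n
  proof -
    note sqn = exp_double_I_step_vector(1)[OF g[of n]]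
    note sum = sq_integrable_add[OF sqn sqh]
    have dif: "sq_integrable M (\<lambda>w. \<bar>I (g n) w - I h w\<bar>)"
      using sq_integrable_diff[OF I_sq_integrable I_sq_integrable, of "g n" h]
      by (simp add: sq_integrable_def)
    have "\<bar>?d n\<bar> = \<bar>\<integral>w. exp (I (g n) w) - exp (I h w) \<partial>M\<bar>"
      using exp_I_step_vector(1)[OF g] int by simp
    also have "\<dots> \<le> (\<integral>w. \<bar>exp (I (g n) w) - exp (I h w)\<bar> \<partial>M)" by (rule integral_abs_bound)
    also have "\<dots> \<le> (\<integral>w. \<bar>I (g n) w - I h w\<bar> * (exp (I (g n) w) + exp (I h w)) \<partial>M)"
      using exp_I_step_vector(1)[OF g] int sq_integrable_mult[OF dif sum]
      by (intro integral_mono abs_exp_diff_le) auto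
    finally have "(?d n)\<^sup>2 \<le> (\<integral>w. \<bar>I (g n) w - I h w\<bar> * (exp (I (g n) w) + exp (I h w)) \<partial>M)\<^sup>2"
      using power_mono[of "\<bar>?d n\<bar>" _ 2] by simp
    also have "\<dots> \<le> (\<integral>w. \<bar>I (g n) w - I h w\<bar>\<^sup>2 \<partial>M) * (\<integral>w. (exp (I (g n) w) + exp (I h w))\<^sup>2 \<partial>M)"
      by (rule integral_cauchy_schwarz[OF dif sum])
    also have "\<dots> = (norm (g n - h))\<^sup>2 * (\<integral>w. (exp (I (g n) w) + exp (I h w))\<^sup>2 \<partial>M)"
      by (simp add: dist)
    also have "\<dots> \<le> (norm (g n - h))\<^sup>2 * ?A"
      using integral_sq_triangle[OF sqn sqh] sq_le[of n] by (intro mult_left_mono) auto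
    finally show ?thesis .
  qed
  have "(\<lambda>n. (?d n)\<^sup>2) \<longlonglongrightarrow> 0"
  proof (rule Lim_null_comparison)
    show "\<forall>\<^sub>F n in sequentially. norm ((?d n)\<^sup>2) \<le> (norm (g n - h))\<^sup>2 * ?A"
      using d_le by (intro always_eventually allI) simp
    show "(\<lambda>n. (norm (g n - h))\<^sup>2 * ?A) \<longlonglongrightarrow> 0"
      using lim2 unfolding dist by (rule tendsto_mult_left_zero)
  qed
  then have "(\<lambda>n. ?d n) \<longlonglongrightarrow> 0" by (simp add: tendsto_null_power)
  then have "(\<lambda>n. exp ((norm (g n))\<^sup>2 / 2)) \<longlonglongrightarrow> (\<integral>w. exp (I h w) \<partial>M)"
    unfolding exp_I_step_vector(2)[OF g] by (rule LIM_zero_cancel)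
  moreover have "(\<lambda>n. exp ((norm (g n))\<^sup>2 / 2)) \<longlonglongrightarrow> exp ((norm h)\<^sup>2 / 2)"
    by (intro tendsto_intros lim) auto
  ultimately show "(\<integral>w. exp (I h w) \<partial>M) = exp ((norm h)\<^sup>2 / 2)" by (rule LIMSEQ_unique)
qed

sublocale isonormal_process M I
proof
  show "I h \<in> borel_measurable M" for h
    using I_sq_integrable by (rule sq_integrable_measurable)
qed (use I_lin I_sq exp_moment_I in auto)

text \<open>Since \<open>X s\<close> is almost surely the integral of an indicator, the vanishing of the $S$-transform
  annihilates all cylinder sets of the process. These generate the \<open>\<sigma>\<close>-algebra for which \<open>\<xi>\<close> is
  measurable.\<close>

lemma S_transform_injective:
  assumes \<xi>: "\<xi> \<in> L2X M T X" and S: "\<And>h. S_transform M I \<xi> h = 0"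
  shows "AE w in M. \<xi> w = 0"
proof -
  note sq = L2X_sq_integrable[OF \<xi>]
  note int = sq_integrable_integrable[OF sq]
  let ?e = "\<lambda>s. emb (indicator {0<..s})"
  have cyl: "(\<integral>w. \<xi> w * (\<Prod>(s, B)\<leftarrow>ps. indicator B (X s w)) \<partial>M) = 0"
    if ps: "\<And>s B. (s, B) \<in> set ps \<Longrightarrow> s \<in> {0..T} \<and> B \<in> sets borel" for ps
  proof -
    define qs where "qs = map (\<lambda>(s, B). (?e s, B)) ps"
    have qs: "B \<in> sets borel" if "(g, B) \<in> set qs" for g B using that ps by (auto simp: qs_def)
    have "AE w in M. \<forall>(s, B)\<in>set ps. I (?e s) w = X s w"
    proof (rule AE_finite_allI)
      fix p assume "p \<in> set ps"
      then show "AE w in M. case p of (s, B) \<Rightarrow> I (?e s) w = X s w"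
        using ps[of "fst p" "snd p"] I_indicator[of "fst p"] by (simp add: split_def)
    qed simp
    then have ae: "AE w in M. \<xi> w * (\<Prod>(s, B)\<leftarrow>ps. indicator B (X s w)) =
        \<xi> w * (\<Prod>(g, B)\<leftarrow>qs. indicator B (I g w)) * cos (I 0 w)"
      using I_scaleR[of 0 0]
    proof eventually_elim
      case (elim w)
      have "map (\<lambda>(s, B). indicator B (X s w) :: real) ps = map (\<lambda>(g, B). indicator B (I g w)) qs"
        using elim(1) by (auto simp: qs_def)
      then show ?case using elim(2) by simp
    qed
    have [measurable]: "\<xi> \<in> borel_measurable M" using sq by (rule sq_integrable_measurable)
    have [measurable]: "(\<lambda>w. \<Prod>(s, B)\<leftarrow>ps. indicator B (X s w) :: real) \<in> borel_measurable M"
      using ps X_measurable by (intro cylinder_indicator_measurable) auto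
    have [measurable]: "(\<lambda>w. \<Prod>(g, B)\<leftarrow>qs. indicator B (I g w) :: real) \<in> borel_measurable M"
      using qs by (intro cylinder_indicator_measurable) auto
    have "(\<integral>w. \<xi> w * (\<Prod>(s, B)\<leftarrow>ps. indicator B (X s w)) \<partial>M) =
        (\<integral>w. \<xi> w * (\<Prod>(g, B)\<leftarrow>qs. indicator B (I g w)) * cos (I 0 w) \<partial>M)"
      by (rule integral_cong_AE[OF _ _ ae]) measurable
    also have "\<dots> = 0" using cylinder_eq_0_if_S_transform_0[OF sq S, of qs 0] qs by blast
    finally show ?thesis .
  qed
  show ?thesis
  proof (rule AE_eq_0_if_integrals_0[OF subalgebra_process_filtration _ int])
    show "\<xi> \<in> borel_measurable (process_filtration M X T)" using \<xi> by (simp add: L2X_def)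
    show "(\<integral>w. \<xi> w * indicator A w \<partial>M) = 0" if "A \<in> sets (process_filtration M X T)" for A
      using that unfolding sets_process_filtration
      by (intro integral_indicator_eq_0_if_cylinders_0[of "{0..T}" X, OF X_measurable int cyl])
  qed
qed

text \<open>A bounded operator is determined by its values on the embedded indicators, whose span is dense.\<close>

lemma truncation_properties:
  assumes "has_indefinite_wiener_integral T emb" "r \<in> {0..T}"
  shows "is_truncation T emb r (truncation T emb r)"
proof -
  obtain A where A: "is_truncation T emb r A"
    using assms unfolding has_indefinite_wiener_integral_def by blast
  let ?G = "(\<lambda>t. emb (indicator {0<..t})) ` {0..T}"
  have "step_vectors \<subseteq> span ?G"
    unfolding step_vectors_def by (auto intro!: span_sum intro: span_scale[OF span_base])
  then have total: "closure (span ?G) = UNIV" using closure_step_vectors closure_mono by blast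
  have "B = A" if "is_truncation T emb r B" for B
    using that A by (intro bounded_linear_eq_on_total[OF _ _ total]) (auto simp: is_truncation_def)
  with A show ?thesis unfolding truncation_def by (rule theI)
qed

end

section \<open>Chaos decomposition\<close>

locale chaos_space = wiener_integral_space M T X emb I + tensor_powers tens
  for M :: "'w measure" and T :: real and X :: "real \<Rightarrow> 'w \<Rightarrow> real"
    and emb :: "(real \<Rightarrow> real) \<Rightarrow> 'h::{real_inner,banach}" and I :: "'h \<Rightarrow> 'w \<Rightarrow> real"
    and tens :: "'h list \<Rightarrow> 't::{real_inner,banach}" +
  fixes J :: "nat \<Rightarrow> 't \<Rightarrow> 'w \<Rightarrow> real"
  assumes J: "multiple_wiener_integral M T X I tens J"
begin

abbreviation tpow :: "nat \<Rightarrow> 'h \<Rightarrow> 't" where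
  "tpow k h \<equiv> tens (replicate k h)"

abbreviation sym :: "nat \<Rightarrow> 't set" where
  "sym k \<equiv> sym_power tens k"

lemma J_const: "AE w in M. J 0 (a *\<^sub>R tens []) w = a"
  and J_in_chaos: "f \<in> sym k \<Longrightarrow> J k f \<in> wiener_chaos M T X I k"
  and J_linear: "f \<in> sym k \<Longrightarrow> g \<in> sym k \<Longrightarrow>
    AE w in M. J k (a *\<^sub>R f + b *\<^sub>R g) w = a * J k f w + b * J k g w"
  and J_hermite: "norm h = 1 \<Longrightarrow> AE w in M. J k (tpow k h) w = hermite k (I h w)"
  and J_isometry: "f \<in> sym k \<Longrightarrow> g \<in> sym k \<Longrightarrow> (\<integral>w. J k f w * J k g w \<partial>M) = fact k * (f \<bullet> g)"
  using J unfolding multiple_wiener_integral_def by blast+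

lemma J_in_L2X: "f \<in> sym k \<Longrightarrow> J k f \<in> L2X M T X"
  using J_in_chaos[of f k] by (auto simp: wiener_chaos_def L2_closed_span_def split: if_splits)

lemma J_sq_integrable: "f \<in> sym k \<Longrightarrow> sq_integrable M (J k f)"
  by (intro L2X_sq_integrable J_in_L2X)

lemma J_measurable: "f \<in> sym k \<Longrightarrow> J k f \<in> borel_measurable M"
  by (intro sq_integrable_measurable J_sq_integrable)

lemma J_square: "f \<in> sym k \<Longrightarrow> (\<integral>w. (J k f w)\<^sup>2 \<partial>M) = fact k * (norm f)\<^sup>2"
  using J_isometry[of f k f] by (simp add: power2_eq_square[of "J k f _"] power2_norm_eq_inner)

lemma J_scaleR: "f \<in> sym k \<Longrightarrow> AE w in M. J k (a *\<^sub>R f) w = a * J k f w"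
  using J_linear[of f k f a 0] by simp

lemma J_sum:
  assumes "finite S" "\<And>i. i \<in> S \<Longrightarrow> f i \<in> sym k"
  shows "AE w in M. J k (\<Sum>i\<in>S. a i *\<^sub>R f i) w = (\<Sum>i\<in>S. a i * J k (f i) w)"
  using assms
proof (induction S rule: finite_induct)
  case empty
  show ?case using J_scaleR[OF subspace_0[OF sym_power_subspace], of k 0] by simp
next
  case (insert i S)
  have "(\<Sum>i\<in>S. a i *\<^sub>R f i) \<in> sym k"
    using insert.prems by (intro subspace_sum subspace_scale sym_power_subspace) auto
  from J_linear[OF insert.prems[OF insertI1] this, of "a i" 1]
  have "AE w in M. J k (\<Sum>i\<in>insert i S. a i *\<^sub>R f i) w =
      a i * J k (f i) w + J k (\<Sum>i\<in>S. a i *\<^sub>R f i) w"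
    using insert.hyps by simp
  moreover have "AE w in M. J k (\<Sum>i\<in>S. a i *\<^sub>R f i) w = (\<Sum>i\<in>S. a i * J k (f i) w)"
    using insert by auto
  ultimately show ?case by eventually_elim (use insert.hyps in simp)
qed

lemma J_tpow:
  assumes u: "norm u = 1"
  shows "AE w in M. J k (tpow k (t *\<^sub>R u)) w = t ^ k * hermite k (I u w)"
  unfolding tens_replicate_scaleR
  using J_scaleR[OF tpow_in_sym_power[of k u], of "t ^ k"] J_hermite[OF u, of k]
  by eventually_elim simp

text \<open>The generating function of the Hermite polynomials at \<open>t = \<parallel>h\<parallel>\<close> for the unit vector in the
  direction of \<open>h\<close>. For \<open>h = 0\<close> there need not be any unit vector; then the Wick exponential and all nonempty
  partial sums are almost surely 1.\<close>

lemma wick_exp_chaos_expansion: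
  "(\<lambda>N. \<integral>w. ((\<Sum>k<N. 1 / fact k * J k (tpow k h) w) - wick_exp M (I h) w)\<^sup>2 \<partial>M) \<longlonglongrightarrow> 0"
  (is "(\<lambda>N. \<integral>w. (?u N h w - _)\<^sup>2 \<partial>M) \<longlonglongrightarrow> 0")
proof (cases "h = 0")
  case True
  have [measurable]: "J k (tpow k 0) \<in> borel_measurable M" for k
    by (intro J_measurable tpow_in_sym_power)
  have zero: "AE w in M. J (Suc k) (tpow (Suc k) 0) w = 0" for k
    using J_scaleR[OF tpow_in_sym_power[of "Suc k" 0], of 0] tens_replicate_scaleR[of "Suc k" 0 0]
    by simp
  have one: "AE w in M. J 0 (tpow 0 0) w = 1" using J_const[of 1] by simp
  have wick: "AE w in M. wick_exp M (I 0) w = 1"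
    using I_scaleR[of 0 0] by eventually_elim (simp add: wick_exp_I)
  have "AE w in M. (?u (Suc N) 0 w - wick_exp M (I 0) w)\<^sup>2 = 0" for N
  proof -
    have "AE w in M. \<forall>k\<in>{..<N}. J (Suc k) (tpow (Suc k) 0) w = 0"
      using zero by (intro AE_finite_allI) auto
    then show ?thesis
      using one wick
    proof eventually_elim
      case (elim w)
      then show ?case by (simp add: sum.lessThan_Suc_shift del: sum.lessThan_Suc replicate.simps)
    qed
  qed
  then have "(\<integral>w. (?u (Suc N) 0 w - wick_exp M (I 0) w)\<^sup>2 \<partial>M) = 0" for N
    by (intro integral_eq_zero_AE)
  then have "(\<lambda>N. \<integral>w. (?u (Suc N) h w - wick_exp M (I h) w)\<^sup>2 \<partial>M) \<longlonglongrightarrow> 0"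
    unfolding True by simp
  then show ?thesis by (rule LIMSEQ_imp_Suc)
next
  case False
  define t u where "t = norm h" and "u = sgn h"
  have u: "norm u = 1" and h: "h = t *\<^sub>R u"
    using False by (auto simp: t_def u_def norm_sgn sgn_div_norm)
  have [measurable]: "J k (tpow k (t *\<^sub>R u)) \<in> borel_measurable M" for k
    by (intro J_measurable tpow_in_sym_power)
  have "(\<integral>w. (?u N h w - wick_exp M (I h) w)\<^sup>2 \<partial>M) =
      (\<integral>w. ((\<Sum>k<N. t ^ k / fact k * hermite k (I u w)) - wick_exp M (I h) w)\<^sup>2 \<partial>M)" for N
    unfolding h
  proof (rule integral_cong_AE)
    have "AE w in M. \<forall>k\<in>{..<N}. J k (tpow k (t *\<^sub>R u)) w = t ^ k * hermite k (I u w)"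
      using J_tpow[OF u] by (intro AE_finite_allI) auto
    then show "AE w in M. (?u N (t *\<^sub>R u) w - wick_exp M (I (t *\<^sub>R u)) w)\<^sup>2 =
        ((\<Sum>k<N. t ^ k / fact k * hermite k (I u w)) - wick_exp M (I (t *\<^sub>R u)) w)\<^sup>2"
      by eventually_elim simp
  qed measurable
  then show ?thesis using wick_exp_hermite_expansion[OF u, of t] by (simp add: h)
qed

lemma S_transform_sums:
  assumes \<xi>: "sq_integrable M \<xi>"
  shows "(\<lambda>k. 1 / fact k * (\<integral>w. \<xi> w * J k (tpow k h) w \<partial>M)) sums S_transform M I \<xi> h"
proof -
  let ?c = "\<lambda>k. \<integral>w. \<xi> w * J k (tpow k h) w \<partial>M"
  let ?u = "\<lambda>N w. \<Sum>k<N. 1 / fact k * J k (tpow k h) w"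
  have Jsq: "sq_integrable M (\<lambda>w. 1 / fact k * J k (tpow k h) w)" for k
    by (intro sq_integrable_scale J_sq_integrable tpow_in_sym_power)
  have "(\<lambda>N. \<integral>w. ?u N w * \<xi> w \<partial>M) \<longlonglongrightarrow>
      (\<integral>w. wick_exp M (I h) w * \<xi> w \<partial>M)"
    by (rule integral_mult_tendsto[OF sq_integrable_sum[OF Jsq] sq_integrable_wick_exp \<xi>
          wick_exp_chaos_expansion])
  also have "(\<lambda>N. \<integral>w. ?u N w * \<xi> w \<partial>M) =
      (\<lambda>N. \<Sum>k<N. 1 / fact k * ?c k)"
  proof
    fix N
    have "(\<integral>w. ?u N w * \<xi> w \<partial>M) =
        (\<Sum>k<N. \<integral>w. 1 / fact k * J k (tpow k h) w * \<xi> w \<partial>M)"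
      unfolding sum_distrib_right
      by (rule Bochner_Integration.integral_sum) (rule sq_integrable_mult[OF Jsq \<xi>])
    also have "\<dots> = (\<Sum>k<N. 1 / fact k * ?c k)"
      by (intro sum.cong refl) (simp add: mult.commute[of "\<xi> _"])
    finally show "(\<integral>w. ?u N w * \<xi> w \<partial>M) =
        (\<Sum>k<N. 1 / fact k * ?c k)" .
  qed
  finally show ?thesis by (simp add: sums_def S_transform_def mult.commute)
qed

lemma S_transform_scaled_sums:
  assumes \<xi>: "sq_integrable M \<xi>"
  shows "(\<lambda>k. (1 / fact k * (\<integral>w. \<xi> w * J k (tpow k h) w \<partial>M)) * s ^ k) sums S_transform M I \<xi> (s *\<^sub>R h)"
proof -
  let ?c = "\<lambda>k h. \<integral>w. \<xi> w * J k (tpow k h) w \<partial>M"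
  have "?c k (s *\<^sub>R h) = s ^ k * ?c k h" for k
  proof -
    have [measurable]: "\<xi> \<in> borel_measurable M" "J k (tpow k g) \<in> borel_measurable M" for g
      using \<xi> by (auto intro: sq_integrable_measurable J_measurable tpow_in_sym_power)
    have "?c k (s *\<^sub>R h) = (\<integral>w. s ^ k * (\<xi> w * J k (tpow k h) w) \<partial>M)"
    proof (rule integral_cong_AE)
      show "AE w in M. \<xi> w * J k (tpow k (s *\<^sub>R h)) w = s ^ k * (\<xi> w * J k (tpow k h) w)"
        using J_scaleR[OF tpow_in_sym_power[of k h], of "s ^ k"]
        unfolding tens_replicate_scaleR by eventually_elim simp
    qed measurable
    then show ?thesis by simp
  qed
  then show ?thesis using S_transform_sums[OF \<xi>, of "s *\<^sub>R h"] by (simp add: ac_simps)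
qed

text \<open>Both sides, divided by \<open>k!\<close>, are the coefficients of \<open>exp (s * (g \<bullet> h))\<close> as a power series in \<open>s\<close>,
  by the product formula for Wick exponentials.\<close>

lemma integral_wick_exp_J_tpow: "(\<integral>w. wick_exp M (I h) w * J k (tpow k g) w \<partial>M) = (g \<bullet> h) ^ k"
proof -
  have "S_transform M I (wick_exp M (I h)) (s *\<^sub>R g) = exp (s * (g \<bullet> h))" for s
    unfolding S_transform_def integral_wick_exp_mult by (simp add: inner_commute)
  moreover have "(\<lambda>k. (1 / fact k * (g \<bullet> h) ^ k) * s ^ k) sums exp (s * (g \<bullet> h))" for s
    using exp_sums[of "s * (g \<bullet> h)"] by (simp add: power_mult_distrib mult.commute)
  ultimately have "1 / fact k * (\<integral>w. wick_exp M (I h) w * J k (tpow k g) w \<partial>M) = 1 / fact k * (g \<bullet> h) ^ k"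
    using S_transform_scaled_sums[OF sq_integrable_wick_exp, of h g]
    by (intro power_series_eq_imp_coeff_eq[of _ "\<lambda>s. exp (s * (g \<bullet> h))"]) simp_all
  then show ?thesis by simp
qed

text \<open>By definition of the Wiener chaos, \<open>J k f\<close> is a limit of combinations of Hermite polynomials, that is,
  of values of \<open>J k\<close> at powers of vectors, and the isometry carries the approximation back to \<open>f\<close>.
  This takes the place of the polarization identity.\<close>

lemma sym_power_subset_closure_span_tpow: "sym k \<subseteq> closure (span (range (tpow k)))"
proof
  fix f assume f: "f \<in> sym k"
  let ?G = "if k = 0 then {\<lambda>w. 1} else {\<lambda>w. hermite k (I h w) |h. norm h = 1}"
  have "\<exists>h. AE w in M. J k (tpow k h) w = g w" if "g \<in> ?G" for g
  proof (cases "k = 0")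
    case True
    then show ?thesis using that J_const[of 1] by auto
  next
    case False
    then show ?thesis using that J_hermite by auto
  qed
  note ex = this
  \<comment> \<open>a function in the generating set does not determine a vector, so one is chosen\<close>
  define H where "H g = (SOME h. AE w in M. J k (tpow k h) w = g w)" for g
  have H: "AE w in M. J k (tpow k (H g)) w = g w" if "g \<in> ?G" for g
    unfolding H_def by (rule someI_ex[OF ex[OF that]])
  show "f \<in> closure (span (range (tpow k)))"
    unfolding closure_approachable
  proof (intro allI impI)
    fix e :: real assume e: "0 < e"
    have "J k f \<in> L2_closed_span M T X ?G" using J_in_chaos[OF f] unfolding wiener_chaos_def .
    moreover have "0 < ennreal (fact k * e\<^sup>2)" using e by simp
    ultimately obtain S a where S: "finite S" "S \<subseteq> ?G"
      and le: "(\<integral>\<^sup>+w. ennreal ((J k f w - (\<Sum>g\<in>S. a g * g w))\<^sup>2) \<partial>M) < ennreal (fact k * e\<^sup>2)"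
      unfolding L2_closed_span_def by blast
    define f' where "f' = (\<Sum>g\<in>S. a g *\<^sub>R tpow k (H g))"
    have f'_span: "f' \<in> span (range (tpow k))"
      unfolding f'_def by (intro span_sum span_scale span_base) auto
    have f': "f' \<in> sym k"
      unfolding f'_def
      by (intro subspace_sum subspace_scale sym_power_subspace tpow_in_sym_power)
    have "AE w in M. \<forall>g\<in>S. J k (tpow k (H g)) w = g w"
      using H S by (intro AE_finite_allI) auto
    then have "AE w in M. J k (f - f') w = J k f w - (\<Sum>g\<in>S. a g * g w)"
      using J_linear[OF f f', of 1 "-1"] 
        J_sum[OF S(1), of "\<lambda>g. tpow k (H g)" k a, OF tpow_in_sym_power, folded f'_def]
      by eventually_elim simp
    then have "(\<integral>\<^sup>+w. ennreal ((J k (f - f') w)\<^sup>2) \<partial>M) =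
        (\<integral>\<^sup>+w. ennreal ((J k f w - (\<Sum>g\<in>S. a g * g w))\<^sup>2) \<partial>M)"
      by (intro nn_integral_cong_AE) auto
    moreover have diff: "f - f' \<in> sym k" using f f' by (intro subspace_diff sym_power_subspace)
    then have "(\<integral>\<^sup>+w. ennreal ((J k (f - f') w)\<^sup>2) \<partial>M) = ennreal (fact k * (norm (f - f'))\<^sup>2)"
      using J_sq_integrable[OF diff]
      by (subst nn_integral_eq_integral) (auto simp: sq_integrable_def J_square)
    ultimately have "ennreal (fact k * (norm (f - f'))\<^sup>2) < ennreal (fact k * e\<^sup>2)"
      using le by (simp only:)
    then have "fact k * (norm (f - f'))\<^sup>2 < fact k * e\<^sup>2"
      by (subst (asm) ennreal_less_iff) auto
    then have "(norm (f - f'))\<^sup>2 < e\<^sup>2" by simp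
    then have "norm (f - f') < e" using e by (intro power2_less_imp_less[of "norm (f - f')" e]) auto
    then show "\<exists>y\<in>span (range (tpow k)). dist y f < e"
      using f'_span by (intro bexI[of _ f']) (auto simp: dist_norm norm_minus_commute)
  qed
qed

lemma sym_power_eq_0:
  assumes f: "f \<in> sym k" and perp: "\<And>h. f \<bullet> tpow k h = 0"
  shows "f = 0"
proof -
  have "f \<bullet> f = 0"
    using f sym_power_subset_closure_span_tpow perp
    by (intro inner_eq_0_on_closure_span[of f "range (tpow k)"]) auto
  then show ?thesis by simp
qed

text \<open>The Riesz representation on the closed subspace of symmetric tensors. The kernel \<open>F\<close> is the one for
  which \<open>J k F\<close> is the orthogonal projection of \<open>Y\<close> onto the \<open>k\<close>th chaos.\<close>

lemma chaos_kernel_exists: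
  assumes Y: "sq_integrable M Y"
  shows "\<exists>F\<in>sym k. \<forall>g\<in>sym k. (\<integral>w. Y w * J k g w \<partial>M) = fact k * (F \<bullet> g)"
proof -
  note [measurable] = sq_integrable_measurable[OF Y] J_measurable
  let ?E = "\<lambda>g. \<integral>w. Y w * J k g w \<partial>M"
  let ?\<phi> = "\<lambda>g. ?E g / fact k"
  have lin: "?E (a *\<^sub>R g + b *\<^sub>R h) =
      a * ?E g + b * ?E h" if gh: "g \<in> sym k" "h \<in> sym k" for a b g h
  proof -
    have "a *\<^sub>R g + b *\<^sub>R h \<in> sym k"
      using gh sym_power_subspace by (intro subspace_add subspace_scale)
    then have "?E (a *\<^sub>R g + b *\<^sub>R h) =
        (\<integral>w. a * (Y w * J k g w) + b * (Y w * J k h w) \<partial>M)"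
      using J_linear[OF gh, of a b] gh by (intro integral_cong_AE) (auto simp: algebra_simps)
    also have "\<dots> = a * ?E g + b * ?E h"
      using sq_integrable_mult[OF Y J_sq_integrable] gh by simp
    finally show ?thesis .
  qed
  define C where "C = sqrt (\<integral>w. (Y w)\<^sup>2 \<partial>M) * sqrt (fact k)"
  have bound: "\<bar>?E g\<bar> \<le> C * norm g" if "g \<in> sym k" for g
  proof -
    have "(?E g)\<^sup>2 \<le> (\<integral>w. (Y w)\<^sup>2 \<partial>M) * (fact k * (norm g)\<^sup>2)"
      using integral_cauchy_schwarz[OF Y J_sq_integrable[OF that]] J_square[OF that] by simp
    from real_le_rsqrt[OF this] real_sqrt_le_mono[OF this] show ?thesis
      by (simp add: C_def real_sqrt_mult ac_simps)
  qed
  obtain F where F: "F \<in> sym k" "\<And>g. g \<in> sym k \<Longrightarrow> ?\<phi> g = F \<bullet> g"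
  proof (rule riesz_on_subspace[OF sym_power_closed sym_power_subspace, of k ?\<phi> "C / fact k"])
    show "?\<phi> (g + h) = ?\<phi> g + ?\<phi> h" if "g \<in> sym k" "h \<in> sym k" for g h
      using lin[OF that, of 1 1] by (simp add: add_divide_distrib)
    show "?\<phi> (a *\<^sub>R g) = a * ?\<phi> g" if "g \<in> sym k" for a g
      using lin[OF that that, of a 0] by simp
    show "\<bar>?\<phi> g\<bar> \<le> C / fact k * norm g" if "g \<in> sym k" for g
      using bound[OF that] by (simp add: divide_right_mono)
  qed (use that in blast)
  have "?E g = fact k * (F \<bullet> g)" if "g \<in> sym k" for g
    using F(2)[OF that] by (simp add: field_simps)
  with F(1) show ?thesis by blast
qed

text \<open>The kernel of the Wick exponential in the \<open>k\<close>th chaos is \<open>h\<^sup>\<otimes>\<^sup>k / k!\<close>: by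
  \<open>integral_wick_exp_J_tpow\<close> this is true when tested on powers of vectors, and these are total.\<close>

lemma S_transform_J:
  assumes f: "f \<in> sym k"
  shows "S_transform M I (J k f) h = f \<bullet> tpow k h"
proof -
  obtain F where F: "F \<in> sym k"
    "\<And>g. g \<in> sym k \<Longrightarrow> (\<integral>w. wick_exp M (I h) w * J k g w \<partial>M) = fact k * (F \<bullet> g)"
    using chaos_kernel_exists[OF sq_integrable_wick_exp, of k h] by blast
  have "fact k *\<^sub>R F - tpow k h = 0"
  proof (rule sym_power_eq_0)
    show "fact k *\<^sub>R F - tpow k h \<in> sym k"
      using F(1) by (intro subspace_diff subspace_scale sym_power_subspace tpow_in_sym_power)
    show "(fact k *\<^sub>R F - tpow k h) \<bullet> tpow k g = 0" for g
      using F(2)[OF tpow_in_sym_power, of g] integral_wick_exp_J_tpow[of h k g]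
      by (simp add: inner_diff inner_commute)
  qed
  then have "tpow k h \<bullet> f = fact k * (F \<bullet> f)" by (metis eq_iff_diff_eq_0 inner_scaleR_left)
  also have "\<dots> = S_transform M I (J k f) h"
    using F(2)[OF f] by (simp add: S_transform_def mult.commute)
  finally show ?thesis by (simp add: inner_commute)
qed

text \<open>Along a ray, the $S$-transform of \<open>J k f\<close> is a multiple of \<open>s\<^sup>k\<close>. Its other coefficients, which
  are the products with \<open>J l\<close> of powers of vectors, therefore vanish.\<close>

lemma J_orthogonal:
  assumes f: "f \<in> sym k" and g: "g \<in> sym l" and "k \<noteq> l"
  shows "(\<integral>w. J k f w * J l g w \<partial>M) = 0"
proof -
  note sq = J_sq_integrable[OF f]
  have zero: "(\<integral>w. J k f w * J l (tpow l h) w \<partial>M) = 0" for h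
  proof -
    let ?b = "\<lambda>j. if j = k then f \<bullet> tpow k h else 0"
    have S: "S_transform M I (J k f) (s *\<^sub>R h) = s ^ k * (f \<bullet> tpow k h)" for s
      unfolding S_transform_J[OF f] tens_replicate_scaleR by simp
    have "(\<lambda>j. ?b j * s ^ j) sums S_transform M I (J k f) (s *\<^sub>R h)" for s
    proof -
      have "(\<lambda>j. ?b j * s ^ j) = (\<lambda>j. if j = k then (f \<bullet> tpow k h) * s ^ j else 0)" by auto
      then show ?thesis
        using sums_single[of k "\<lambda>j. (f \<bullet> tpow k h) * s ^ j"] by (simp only: S mult.commute)
    qed
    from power_series_eq_imp_coeff_eq[OF S_transform_scaled_sums[OF sq] this, of l]
    show ?thesis using \<open>k \<noteq> l\<close> by simp
  qed
  obtain F where F: "F \<in> sym l"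
    "\<And>g. g \<in> sym l \<Longrightarrow> (\<integral>w. J k f w * J l g w \<partial>M) = fact l * (F \<bullet> g)"
    using chaos_kernel_exists[OF sq, of l] by blast
  have "F = 0"
    using F(2)[OF tpow_in_sym_power] zero by (intro sym_power_eq_0[OF F(1)]) simp
  then show ?thesis using F(2)[OF g] by simp
qed

lemma integral_chaos_sum_square:
  assumes f: "\<And>k. f k \<in> sym k" and "finite A"
  shows "(\<integral>w. (\<Sum>k\<in>A. J k (f k) w)\<^sup>2 \<partial>M) = (\<Sum>k\<in>A. fact k * (norm (f k))\<^sup>2)"
proof -
  note int = sq_integrable_mult[OF J_sq_integrable[OF f] J_sq_integrable[OF f]]
  have "(\<integral>w. (\<Sum>k\<in>A. J k (f k) w)\<^sup>2 \<partial>M) = (\<Sum>k\<in>A. \<Sum>l\<in>A. \<integral>w. J k (f k) w * J l (f l) w \<partial>M)"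
    unfolding power2_eq_square sum_product
    by (subst Bochner_Integration.integral_sum, use int in simp)+ simp
  also have "\<dots> = (\<Sum>k\<in>A. \<Sum>l\<in>A. if l = k then fact k * (norm (f k))\<^sup>2 else 0)"
    using J_orthogonal[OF f f] J_isometry[OF f f]
    by (intro sum.cong refl) (auto simp: power2_norm_eq_inner)
  also have "\<dots> = (\<Sum>k\<in>A. fact k * (norm (f k))\<^sup>2)" using \<open>finite A\<close> by simp
  finally show ?thesis .
qed

lemma chaos_series_converges:
  assumes f: "\<And>k. f k \<in> sym k" and sum: "summable (\<lambda>k. fact k * (norm (f k))\<^sup>2)"
  obtains \<xi> where "\<xi> \<in> L2X M T X" "L2_sums M (\<lambda>k. J k (f k)) \<xi>"
proof -
  let ?u = "\<lambda>N w. \<Sum>k<N. J k (f k) w"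
  note Jsq = J_sq_integrable[OF f]
  have Jmeas: "J k (f k) \<in> borel_measurable (process_filtration M X T)" for k
    using J_in_L2X[OF f] by (simp add: L2X_def)
  have diff: "(\<integral>w. (?u m w - ?u n w)\<^sup>2 \<partial>M) = \<bar>\<Sum>k=min m n..<max m n. fact k * (norm (f k))\<^sup>2\<bar>" for m n
  proof -
    have "(?u m w - ?u n w)\<^sup>2 = (\<Sum>k=min m n..<max m n. J k (f k) w)\<^sup>2" for w
    proof (cases "n \<le> m")
      case True
      then show ?thesis
        using sum_diff_nat_ivl[of 0 n m "\<lambda>k. J k (f k) w"] by (simp add: lessThan_atLeast0 min_def max_def)
    next
      case False
      then show ?thesis
        using sum_diff_nat_ivl[of 0 m n "\<lambda>k. J k (f k) w"]
        by (subst power2_commute) (simp add: lessThan_atLeast0 min_def max_def)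
    qed
    then show ?thesis using integral_chaos_sum_square[OF f] by (simp add: sum_nonneg)
  qed
  obtain \<xi> where \<xi>: "\<xi> \<in> borel_measurable (process_filtration M X T)" "sq_integrable M \<xi>"
    "(\<lambda>n. \<integral>w. (?u n w - \<xi> w)\<^sup>2 \<partial>M) \<longlonglongrightarrow> 0"
  proof (rule L2_complete[OF subalgebra_process_filtration, of ?u])
    show "?u n \<in> borel_measurable (process_filtration M X T)" for n
      using Jmeas by (intro borel_measurable_sum)
    show "sq_integrable M (?u n)" for n by (intro sq_integrable_sum Jsq)
    show "\<exists>N. \<forall>m\<ge>N. \<forall>n\<ge>N. (\<integral>w. (?u m w - ?u n w)\<^sup>2 \<partial>M) < e" if "0 < e" for e
    proof -
      obtain N where N: "\<And>m n. m \<ge> N \<Longrightarrow> norm (\<Sum>k=m..<n. fact k * (norm (f k))\<^sup>2) < e"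
        using sum \<open>0 < e\<close> unfolding summable_Cauchy by blast
      have "\<forall>m\<ge>N. \<forall>n\<ge>N. (\<integral>w. (?u m w - ?u n w)\<^sup>2 \<partial>M) < e"
        unfolding diff using N by (auto simp: min_def)
      then show ?thesis ..
    qed
  qed (use that in blast)
  have "L2_sums M (\<lambda>k. J k (f k)) \<xi>" using L2_sums_iff[of M "\<lambda>k. J k (f k)", OF Jsq \<xi>(2)] \<xi>(3) by blast
  with L2XI[OF \<xi>(1,2)] show thesis by (rule that)
qed

abbreviation decomposes :: "('w \<Rightarrow> real) \<Rightarrow> (nat \<Rightarrow> 't) \<Rightarrow> bool" where
  "decomposes \<equiv> chaos_decomposition M tens J"

lemma chaos_decomposition_summable:
  assumes \<xi>: "\<xi> \<in> L2X M T X" and dec: "decomposes \<xi> f"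
  shows "summable (\<lambda>k. fact k * (norm (f k))\<^sup>2)"
proof -
  have f: "\<And>k. f k \<in> sym k" and L2: "L2_sums M (\<lambda>k. J k (f k)) \<xi>"
    using dec by (auto simp: chaos_decomposition_def)
  note Jsq = J_sq_integrable[OF f] and sq = L2X_sq_integrable[OF \<xi>]
  let ?u = "\<lambda>N w. \<Sum>k<N. J k (f k) w"
  have usq: "sq_integrable M (?u N)" for N by (intro sq_integrable_sum Jsq)
  have lim: "(\<lambda>N. \<integral>w. (?u N w - \<xi> w)\<^sup>2 \<partial>M) \<longlonglongrightarrow> 0" using L2_sums_iff[of M "\<lambda>k. J k (f k)", OF Jsq sq] L2 by blast
  then obtain K where K: "\<And>N. (\<integral>w. (?u N w - \<xi> w)\<^sup>2 \<partial>M) \<le> K"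
    using convergent_imp_Bseq[OF convergentI[OF lim]] by (auto simp: Bseq_def abs_le_iff)
  have "(\<Sum>k<N. fact k * (norm (f k))\<^sup>2) \<le> 2 * K + 2 * (\<integral>w. (\<xi> w)\<^sup>2 \<partial>M)" for N
    using integral_chaos_sum_square[OF f, of "{..<N}"] K[of N]
      integral_sq_triangle[OF sq_integrable_diff[OF usq sq] sq, of N] by simp
  then show ?thesis by (intro summableI_nonneg_bounded) auto
qed

lemma S_transform_chaos:
  assumes \<xi>: "\<xi> \<in> L2X M T X" and dec: "decomposes \<xi> f"
  shows "(\<lambda>k. f k \<bullet> tpow k h) sums S_transform M I \<xi> h"
proof -
  have f: "\<And>k. f k \<in> sym k" and L2: "L2_sums M (\<lambda>k. J k (f k)) \<xi>"
    using dec by (auto simp: chaos_decomposition_def)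
  note Jsq = J_sq_integrable[OF f] and sq = L2X_sq_integrable[OF \<xi>]
  have lim: "(\<lambda>N. \<integral>w. ((\<Sum>k<N. J k (f k) w) - \<xi> w)\<^sup>2 \<partial>M) \<longlonglongrightarrow> 0"
    using L2_sums_iff[of M "\<lambda>k. J k (f k)", OF Jsq sq] L2 by blast
  have "(\<lambda>N. \<integral>w. (\<Sum>k<N. J k (f k) w) * wick_exp M (I h) w \<partial>M) \<longlonglongrightarrow> S_transform M I \<xi> h"
    unfolding S_transform_def
    by (rule integral_mult_tendsto[OF sq_integrable_sum[OF Jsq] sq sq_integrable_wick_exp lim])
  moreover have "(\<integral>w. (\<Sum>k<N. J k (f k) w) * wick_exp M (I h) w \<partial>M) = (\<Sum>k<N. f k \<bullet> tpow k h)" for N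
  proof -
    have "(\<integral>w. (\<Sum>k<N. J k (f k) w) * wick_exp M (I h) w \<partial>M) =
        (\<Sum>k<N. \<integral>w. J k (f k) w * wick_exp M (I h) w \<partial>M)"
      unfolding sum_distrib_right
      by (rule Bochner_Integration.integral_sum) (rule sq_integrable_mult[OF Jsq sq_integrable_wick_exp])
    then show ?thesis using S_transform_J[OF f] by (simp add: S_transform_def)
  qed
  ultimately show ?thesis by (simp add: sums_def)
qed

text \<open>The candidate series has as kernels the projections of \<open>\<xi>\<close> onto the chaoses and converges by
  Bessel's inequality. Its sum has the same $S$-transform as \<open>\<xi>\<close>, so it is \<open>\<xi>\<close>.\<close>

lemma chaos_decomposition_exists:
  assumes \<xi>: "\<xi> \<in> L2X M T X"
  obtains f where "decomposes \<xi> f"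
proof -
  note sq = L2X_sq_integrable[OF \<xi>]
  have "\<forall>k. \<exists>F. F \<in> sym k \<and> (\<forall>g\<in>sym k. (\<integral>w. \<xi> w * J k g w \<partial>M) = fact k * (F \<bullet> g))"
    using chaos_kernel_exists[OF sq] by blast
  then obtain f where f: "\<And>k. f k \<in> sym k"
    and ker: "\<And>k g. g \<in> sym k \<Longrightarrow> (\<integral>w. \<xi> w * J k g w \<partial>M) = fact k * (f k \<bullet> g)" by metis
  note Jsq = J_sq_integrable[OF f]
  have "(\<Sum>k<N. fact k * (norm (f k))\<^sup>2) \<le> (\<integral>w. (\<xi> w)\<^sup>2 \<partial>M)" for N
  proof -
    let ?u = "\<lambda>w. \<Sum>k<N. J k (f k) w" and ?b = "\<Sum>k<N. fact k * (norm (f k))\<^sup>2"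
    have usq: "sq_integrable M ?u" by (intro sq_integrable_sum Jsq)
    have uu: "(\<integral>w. (?u w)\<^sup>2 \<partial>M) = ?b" by (rule integral_chaos_sum_square[OF f]) simp
    have xu: "(\<integral>w. \<xi> w * ?u w \<partial>M) = ?b"
    proof -
      have "(\<integral>w. \<xi> w * ?u w \<partial>M) = (\<Sum>k<N. \<integral>w. \<xi> w * J k (f k) w \<partial>M)"
        unfolding sum_distrib_left
        by (rule Bochner_Integration.integral_sum) (rule sq_integrable_mult[OF sq Jsq])
      then show ?thesis by (simp add: ker[OF f] power2_norm_eq_inner)
    qed
    have "?b\<^sup>2 \<le> (\<integral>w. (\<xi> w)\<^sup>2 \<partial>M) * ?b"
      using integral_cauchy_schwarz[OF sq usq] unfolding uu xu .
    moreover have "0 \<le> ?b" by (intro sum_nonneg) auto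
    ultimately show ?thesis
      by (cases "?b = 0") (auto simp: power2_eq_square)
  qed
  then have sum: "summable (\<lambda>k. fact k * (norm (f k))\<^sup>2)"
    by (intro summableI_nonneg_bounded) auto
  obtain \<zeta> where \<zeta>: "\<zeta> \<in> L2X M T X" "L2_sums M (\<lambda>k. J k (f k)) \<zeta>"
    by (rule chaos_series_converges[OF f sum])
  have dec: "decomposes \<zeta> f" using f \<zeta>(2) by (simp add: chaos_decomposition_def)
  note sq\<zeta> = L2X_sq_integrable[OF \<zeta>(1)]
  have "S_transform M I \<xi> h = S_transform M I \<zeta> h" for h
    using S_transform_sums[OF sq, of h] S_transform_chaos[OF \<zeta>(1) dec, of h]
    by (simp add: ker[OF tpow_in_sym_power] sums_iff)
  moreover have "S_transform M I (\<lambda>w. \<xi> w - \<zeta> w) h = S_transform M I \<xi> h - S_transform M I \<zeta> h" for h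
    unfolding S_transform_def left_diff_distrib
    by (intro Bochner_Integration.integral_diff sq_integrable_mult sq sq\<zeta> sq_integrable_wick_exp)
  moreover have "(\<lambda>w. \<xi> w - \<zeta> w) \<in> L2X M T X"
    using \<xi> \<zeta>(1) by (intro L2XI sq_integrable_diff sq sq\<zeta>) (auto simp: L2X_def)
  ultimately have "AE w in M. \<xi> w - \<zeta> w = 0" by (intro S_transform_injective) auto
  then have "AE w in M. \<xi> w = \<zeta> w" by eventually_elim simp
  then have "(\<integral>\<^sup>+w. ennreal ((\<xi> w - (\<Sum>k<N. J k (f k) w))\<^sup>2) \<partial>M) =
      (\<integral>\<^sup>+w. ennreal ((\<zeta> w - (\<Sum>k<N. J k (f k) w))\<^sup>2) \<partial>M)" for N
    by (intro nn_integral_cong_AE) auto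
  then have "L2_sums M (\<lambda>k. J k (f k)) \<xi>" using \<zeta>(2) by (simp add: L2_sums_def)
  then show thesis using f by (intro that[of f]) (simp add: chaos_decomposition_def)
qed

end

section \<open>Shifted quasi-conditional expectation\<close>

text \<open>Summation by columns instead of rows over the triangle \<open>n \<le> k\<close>: the partial sums over the columns
  \<open>n < N\<close> are, row by row, eventually constant in \<open>N\<close> and dominated by \<open>d\<close>, so Tannery's theorem
  applies.\<close>

lemma triangular_double_series:
  fixes F :: "nat \<Rightarrow> nat \<Rightarrow> real"
  assumes d: "\<And>k. (\<Sum>n\<le>k. \<bar>F k n\<bar>) \<le> d k" "summable d"
    and col: "\<And>n. (\<lambda>j. F (n + j) n) sums c n"
    and row: "(\<lambda>k. \<Sum>n\<le>k. F k n) sums s"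
  shows "c sums s"
proof -
  define P where "P k n = (if n \<le> k then F k n else 0)" for k n
  have "(\<lambda>j. P (j + n) n) sums c n" for n using col[of n] by (simp add: P_def add.commute)
  then have "(\<lambda>k. P k n) sums (c n + (\<Sum>i<n. P i n))" for n using sums_iff_shift by blast
  moreover have "(\<Sum>i<n. P i n) = 0" for n by (intro sum.neutral) (simp add: P_def)
  ultimately have P: "(\<lambda>k. P k n) sums c n" for n by simp
  then have part: "(\<lambda>k. \<Sum>n<N. P k n) sums (\<Sum>n<N. c n)" for N by (intro sums_sum)
  have "(\<lambda>N. \<Sum>k. \<Sum>n<N. P k n) \<longlonglongrightarrow> (\<Sum>k. \<Sum>n\<le>k. F k n)"
  proof (rule tannerys_theorem[THEN conjunct2, THEN conjunct2])
    show "(\<lambda>N. \<Sum>n<N. P k n) \<longlonglongrightarrow> (\<Sum>n\<le>k. F k n)" for k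
    proof (rule tendsto_eventually)
      show "\<forall>\<^sub>F N in sequentially. (\<Sum>n<N. P k n) = (\<Sum>n\<le>k. F k n)"
        using eventually_gt_at_top[of k]
      proof eventually_elim
        case (elim N)
        have "(\<Sum>n<N. P k n) = (\<Sum>n\<le>k. P k n)"
          using elim by (intro sum.mono_neutral_right) (auto simp: P_def)
        then show ?case by (simp add: P_def)
      qed
    qed
    have "norm (\<Sum>n<N. P k n) \<le> d k" for k N
    proof -
      have "norm (\<Sum>n<N. P k n) \<le> (\<Sum>n<N. \<bar>P k n\<bar>)" using sum_abs by simp
      also have "\<dots> \<le> (\<Sum>n\<in>{..<N} \<union> {..k}. \<bar>P k n\<bar>)" by (intro sum_mono2) auto
      also have "\<dots> = (\<Sum>n\<le>k. \<bar>P k n\<bar>)" by (intro sum.mono_neutral_right) (auto simp: P_def)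
      also have "\<dots> = (\<Sum>n\<le>k. \<bar>F k n\<bar>)" by (simp add: P_def)
      finally show ?thesis using d(1)[of k] by linarith
    qed
    then show "\<forall>\<^sub>F (k, N) in at_top \<times>\<^sub>F sequentially. norm (\<Sum>n<N. P k n) \<le> d k"
      by (intro always_eventually) auto
  qed (use d(2) in auto)
  then show ?thesis
    unfolding sums_unique[OF part, symmetric] sums_unique[OF row, symmetric] sums_def .
qed

text \<open>The inequality of arithmetic and geometric means, with the weight \<open>k!\<close> moved from the exponential
  series to the coefficients.\<close>

lemma summable_mult_power_if_summable_fact_square:
  fixes s :: "nat \<Rightarrow> real"
  assumes s: "summable (\<lambda>k. fact k * (s k)\<^sup>2)"
  shows "summable (\<lambda>k. s k * x ^ k)"
proof (rule summable_comparison_test)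
  have "summable (\<lambda>k. (x\<^sup>2) ^ k / fact k)" using exp_sums[of "x\<^sup>2"] by (simp add: sums_iff)
  with s show "summable (\<lambda>k. fact k * (s k)\<^sup>2 + (x\<^sup>2) ^ k / fact k)" by (rule summable_add)
  have "\<bar>s k * x ^ k\<bar> \<le> fact k * (s k)\<^sup>2 + (x\<^sup>2) ^ k / fact k" for k
  proof -
    define f where "f = sqrt (fact k)"
    have f: "f > 0" "f\<^sup>2 = fact k" by (auto simp: f_def)
    have "2 * (f * \<bar>s k\<bar>) * (\<bar>x ^ k\<bar> / f) \<le> (f * \<bar>s k\<bar>)\<^sup>2 + (\<bar>x ^ k\<bar> / f)\<^sup>2" by (rule sum_squares_bound)
    also have "2 * (f * \<bar>s k\<bar>) * (\<bar>x ^ k\<bar> / f) = 2 * \<bar>s k * x ^ k\<bar>" using f(1) by (simp add: abs_mult)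
    also have "(f * \<bar>s k\<bar>)\<^sup>2 + (\<bar>x ^ k\<bar> / f)\<^sup>2 = fact k * (s k)\<^sup>2 + (x\<^sup>2) ^ k / fact k"
      by (simp add: power_mult_distrib power_divide f(2) flip: power_mult) (simp add: mult.commute)
    finally show ?thesis using abs_ge_zero[of "s k * x ^ k"] by linarith
  qed
  then show "\<exists>N. \<forall>k\<ge>N. norm (s k * x ^ k) \<le> fact k * (s k)\<^sup>2 + (x\<^sup>2) ^ k / fact k" by simp
qed

lemma bounded_linear_in_closed_subspace:
  assumes B: "bounded_linear B" and S: "closed S" "subspace S"
    and G: "\<And>x. x \<in> G \<Longrightarrow> B x \<in> S" and v: "v \<in> closure (span G)"
  shows "B v \<in> S"
proof -
  interpret B: bounded_linear B by fact
  have "span G \<subseteq> {v. B v \<in> S}"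
    using G S(2) by (intro span_minimal)
      (auto simp: subspace_def B.add B.scaleR)
  moreover have "closed {v. B v \<in> S}"
    using closed_vimage[OF S(1) linear_continuous_on[OF B]] by (simp add: vimage_def)
  ultimately have "closure (span G) \<subseteq> {v. B v \<in> S}" by (rule closure_minimal)
  with v show ?thesis by auto
qed

context tensor_powers
begin

text \<open>Up to a binomial coefficient, this is the contribution of the \<open>k\<close>th kernel to the \<open>n\<close>th shifted one.\<close>

definition contract_map :: "('h \<Rightarrow> 'h) \<Rightarrow> 'h \<Rightarrow> nat \<Rightarrow> nat \<Rightarrow> 't \<Rightarrow> 't" where
  "contract_map A b k n v = tensor_power_op tens n A (contraction tens k n b v)"

context
  fixes A :: "'h \<Rightarrow> 'h" and K :: real and b :: 'h
  assumes A: "bounded_linear A" and K: "0 \<le> K" "\<And>x. norm (A x) \<le> K * norm x"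
begin

lemma bounded_linear_contract_map:
  assumes "n \<le> k"
  shows "bounded_linear (contract_map A b k n)"
  unfolding contract_map_def
  by (intro bounded_linear_compose[OF bounded_linear_tensor_power_op[OF A K] bounded_linear_contraction[OF assms]])

lemma norm_contract_map_le:
  assumes "n \<le> k"
  shows "norm (contract_map A b k n v) \<le> K ^ n * norm b ^ (k - n) * norm v"
proof -
  have "norm (contract_map A b k n v) \<le> K ^ n * norm (contraction tens k n b v)"
    unfolding contract_map_def by (rule norm_tensor_power_op_le[OF A K])
  also have "\<dots> \<le> K ^ n * (norm b ^ (k - n) * norm v)"
    using K(1) by (intro mult_left_mono norm_contraction_le[OF assms]) auto
  finally show ?thesis by (simp add: mult.assoc)
qed

lemma contract_map_tpow:
  assumes "n \<le> k"
  shows "contract_map A b k n (tens (replicate k g)) = (g \<bullet> b) ^ (k - n) *\<^sub>R tens (replicate n (A g))"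
proof -
  have "(\<Prod>i=n..<k. replicate k g ! i \<bullet> b) = (g \<bullet> b) ^ (k - n)" by simp
  then have "contraction tens k n b (tens (replicate k g)) = (g \<bullet> b) ^ (k - n) *\<^sub>R tens (replicate n g)"
    using assms by (simp add: contraction_tens[OF assms])
  moreover have "tensor_power_op tens n A (a *\<^sub>R v) = a *\<^sub>R tensor_power_op tens n A v" for a v
    using bounded_linear_tensor_power_op[OF A K] by (simp add: bounded_linear.linear linear_cmul)
  ultimately show ?thesis
    by (simp add: contract_map_def tensor_power_op_tens[OF A K])
qed

end

end

context chaos_space
begin

context
  fixes A :: "'h \<Rightarrow> 'h" and K :: real and b :: 'h
  assumes A: "bounded_linear A" and K: "0 \<le> K" "\<And>x. norm (A x) \<le> K * norm x"
begin

lemma contract_map_in_sym_power: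
  assumes "n \<le> k" "v \<in> sym k"
  shows "contract_map A b k n v \<in> sym n"
proof (rule bounded_linear_in_closed_subspace[where B = "contract_map A b k n" and G = "range (tpow k)"])
  show "v \<in> closure (span (range (tpow k)))" using assms(2) sym_power_subset_closure_span_tpow by blast
  show "contract_map A b k n x \<in> sym n" if "x \<in> range (tpow k)" for x
    using that contract_map_tpow[OF A K \<open>n \<le> k\<close>]
    by (auto intro!: subspace_scale sym_power_subspace tpow_in_sym_power)
qed (use bounded_linear_contract_map[OF A K \<open>n \<le> k\<close>] sym_power_closed sym_power_subspace in auto)

text \<open>For \<open>v = g\<^sup>\<otimes>\<^sup>k\<close> this is the binomial theorem for \<open>(\<langle>A g, h\<rangle> + \<langle>g, b\<rangle>)\<^sup>k\<close>. Both sides are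
  bounded linear in \<open>v\<close>, and powers of vectors are total among the symmetric tensors.\<close>

lemma inner_tpow_shift:
  assumes "v \<in> sym k" and adj: "\<And>x. x \<bullet> h' = A x \<bullet> h"
  shows "v \<bullet> tpow k (h' + b) = (\<Sum>n\<le>k. real (k choose n) * (contract_map A b k n v \<bullet> tpow n h))"
proof -
  let ?D = "\<lambda>v. v \<bullet> tpow k (h' + b) - (\<Sum>n\<le>k. real (k choose n) * (contract_map A b k n v \<bullet> tpow n h))"
  have "?D v \<in> {0}"
  proof (rule bounded_linear_in_closed_subspace[where B = ?D and G = "range (tpow k)"])
    have "bounded_linear (\<lambda>v. real (k choose n) * (contract_map A b k n v \<bullet> tpow n h))" if "n \<le> k" for n
      using bounded_linear_contract_map[OF A K that]
      by (intro bounded_linear_const_mult bounded_linear_compose[OF bounded_linear_inner_left])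
    then show "bounded_linear ?D"
      by (intro bounded_linear_sub bounded_linear_sum bounded_linear_inner_left) auto
    show "v \<in> closure (span (range (tpow k)))" using assms(1) sym_power_subset_closure_span_tpow by blast
    fix x assume "x \<in> range (tpow k)"
    then obtain g where x: "x = tpow k g" by auto
    have "x \<bullet> tpow k (h' + b) = (A g \<bullet> h + g \<bullet> b) ^ k" by (simp add: x inner_add adj)
    also have "\<dots> = (\<Sum>n\<le>k. real (k choose n) * (A g \<bullet> h) ^ n * (g \<bullet> b) ^ (k - n))"
      by (rule binomial_ring)
    also have "\<dots> = (\<Sum>n\<le>k. real (k choose n) * (contract_map A b k n x \<bullet> tpow n h))"
      by (intro sum.cong refl) (simp add: x contract_map_tpow[OF A K])
    finally show "?D x \<in> {0}" by simp
  qed (auto simp: subspace_def)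
  then show ?thesis by simp
qed

abbreviation shifted_term :: "(nat \<Rightarrow> 't) \<Rightarrow> nat \<Rightarrow> nat \<Rightarrow> 't" where
  "shifted_term f n j \<equiv> real ((n + j) choose n) *\<^sub>R contract_map A b (n + j) n (f (n + j))"

definition shifted_kernel :: "(nat \<Rightarrow> 't) \<Rightarrow> nat \<Rightarrow> 't" where
  "shifted_kernel f n = (\<Sum>j. shifted_term f n j)"

context
  fixes f :: "nat \<Rightarrow> 't"
  assumes f: "\<And>k. f k \<in> sym k" and f_summable: "summable (\<lambda>k. fact k * (norm (f k))\<^sup>2)"
begin

text \<open>The norm of the \<open>j\<close>th term is \<open>\<parallel>f (n + j)\<parallel>\<close> times at most one term of the binomial expansion of
  \<open>(K + \<parallel>b\<parallel>)\<^sup>n\<^sup>+\<^sup>j\<close>.\<close>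

lemma shifted_kernel_sums:
  "(\<lambda>j. shifted_term f n j) sums shifted_kernel f n"
proof -
  have "summable (\<lambda>j. shifted_term f n j)"
  proof (rule summable_comparison_test)
    have "summable (\<lambda>k. norm (f k) * (K + norm b) ^ k)"
      using f_summable by (rule summable_mult_power_if_summable_fact_square)
    then show "summable (\<lambda>j. norm (f (j + n)) * (K + norm b) ^ (j + n))" by (rule summable_ignore_initial_segment)
    have "norm (shifted_term f n j)
        \<le> norm (f (j + n)) * (K + norm b) ^ (j + n)" for j
    proof -
      have "norm (shifted_term f n j)
          \<le> real ((n + j) choose n) * (K ^ n * norm b ^ j * norm (f (n + j)))"
        using norm_contract_map_le[OF A K, of n "n + j" b "f (n + j)"] by (simp add: mult_left_mono)
      also have "\<dots> = norm (f (n + j)) * (real ((n + j) choose n) * K ^ n * norm b ^ (n + j - n))" by simp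
      also have "\<dots> \<le> norm (f (n + j)) * (\<Sum>i\<le>n + j. real ((n + j) choose i) * K ^ i * norm b ^ (n + j - i))"
        using K(1) by (intro mult_left_mono member_le_sum) auto
      also have "\<dots> = norm (f (n + j)) * (K + norm b) ^ (n + j)" by (simp only: binomial_ring)
      finally show ?thesis by (simp add: add.commute)
    qed
    then show "\<exists>N. \<forall>j\<ge>N. norm (shifted_term f n j)
        \<le> norm (f (j + n)) * (K + norm b) ^ (j + n)" by blast
  qed
  then show ?thesis unfolding shifted_kernel_def by (rule summable_sums)
qed

lemma shifted_kernel_in_sym_power: "shifted_kernel f n \<in> sym n"
proof (rule closed_sequentially[OF sym_power_closed])
  show "(\<Sum>j<N. shifted_term f n j) \<in> sym n" for N
    using f by (intro subspace_sum subspace_scale sym_power_subspace contract_map_in_sym_power) auto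
  show "(\<lambda>N. \<Sum>j<N. shifted_term f n j)
      \<longlonglongrightarrow> shifted_kernel f n"
    using shifted_kernel_sums by (simp add: sums_def)
qed

text \<open>By \<open>inner_tpow_shift\<close> the given series is a double series over \<open>n \<le> k\<close>, and its column sums are the
  pairings of the shifted kernels. The absolute row sums are at most \<open>\<parallel>f k\<parallel> (K \<parallel>h\<parallel> + \<parallel>b\<parallel>)\<^sup>k\<close>, again by the
  binomial theorem.\<close>

lemma shifted_kernel_series:
  assumes adj: "\<And>x. x \<bullet> h' = A x \<bullet> h" and s: "(\<lambda>k. f k \<bullet> tpow k (h' + b)) sums s"
  shows "(\<lambda>n. shifted_kernel f n \<bullet> tpow n h) sums s"
proof (rule triangular_double_series)
  let ?F = "\<lambda>k n. real (k choose n) * (contract_map A b k n (f k) \<bullet> tpow n h)"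
  show "(\<lambda>k. \<Sum>n\<le>k. ?F k n) sums s"
    using s unfolding inner_tpow_shift[OF f adj] .
  show "(\<lambda>j. ?F (n + j) n) sums (shifted_kernel f n \<bullet> tpow n h)" for n
    using bounded_linear.sums[OF bounded_linear_inner_left shifted_kernel_sums[of n], of "tpow n h"] by simp
  show "summable (\<lambda>k. norm (f k) * (K * norm h + norm b) ^ k)"
    using f_summable by (rule summable_mult_power_if_summable_fact_square)
  show "(\<Sum>n\<le>k. \<bar>?F k n\<bar>) \<le> norm (f k) * (K * norm h + norm b) ^ k" for k
  proof -
    have "(\<Sum>n\<le>k. \<bar>?F k n\<bar>) \<le> (\<Sum>n\<le>k. norm (f k) * (real (k choose n) * (K * norm h) ^ n * norm b ^ (k - n)))"
    proof (rule sum_mono)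
      fix n assume "n \<in> {..k}"
      then have "\<bar>contract_map A b k n (f k) \<bullet> tpow n h\<bar> \<le> (K ^ n * norm b ^ (k - n) * norm (f k)) * norm h ^ n"
        using norm_contract_map_le[OF A K, of n k b "f k"]
        by (intro order_trans[OF Cauchy_Schwarz_ineq2]) (simp add: mult_right_mono)
      then have "real (k choose n) * \<bar>contract_map A b k n (f k) \<bullet> tpow n h\<bar> \<le>
          real (k choose n) * ((K ^ n * norm b ^ (k - n) * norm (f k)) * norm h ^ n)"
        by (rule mult_left_mono) simp
      then show "\<bar>?F k n\<bar> \<le> norm (f k) * (real (k choose n) * (K * norm h) ^ n * norm b ^ (k - n))"
        by (simp add: abs_mult power_mult_distrib ac_simps)
    qed
    also have "\<dots> = norm (f k) * (K * norm h + norm b) ^ k"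
      by (simp only: sum_distrib_left[symmetric] binomial_ring)
    finally show ?thesis .
  qed
qed

end

end

text \<open>The \<open>k\<close>th term of the series is homogeneous of degree \<open>k\<close> in \<open>h\<close>, so it can be recovered from
  the sum along the ray through \<open>h\<close>.\<close>

lemma S_transform_determines_kernels:
  assumes f: "\<And>k. f k \<in> sym k" and g: "\<And>k. g k \<in> sym k"
    and fs: "\<And>h. (\<lambda>k. f k \<bullet> tpow k h) sums \<Phi> h" and gs: "\<And>h. (\<lambda>k. g k \<bullet> tpow k h) sums \<Phi> h"
  shows "f k = g k"
proof -
  have "f k \<bullet> tpow k h = g k \<bullet> tpow k h" for h
  proof (rule power_series_eq_imp_coeff_eq)
    show "(\<lambda>k. (f k \<bullet> tpow k h) * t ^ k) sums \<Phi> (t *\<^sub>R h)" for t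
      using fs[of "t *\<^sub>R h"] by (simp add: tens_replicate_scaleR mult.commute)
    show "(\<lambda>k. (g k \<bullet> tpow k h) * t ^ k) sums \<Phi> (t *\<^sub>R h)" for t
      using gs[of "t *\<^sub>R h"] by (simp add: tens_replicate_scaleR mult.commute)
  qed
  then have "f k - g k = 0"
    using f g by (intro sym_power_eq_0 subspace_diff sym_power_subspace) (auto simp: inner_diff)
  then show ?thesis by simp
qed

context
  fixes c :: 'h and r :: real
  assumes indef: "has_indefinite_wiener_integral T emb" and r: "r \<in> {0..T}"
begin

abbreviation kernel :: "(nat \<Rightarrow> 't) \<Rightarrow> nat \<Rightarrow> 't" where
  "kernel \<equiv> qce_kernel T emb tens c r"

text \<open>The point at which the $S$-transform is evaluated is \<open>A\<^sup>* h + b\<close> with \<open>b = A\<^sup>* c - c\<close>, so this is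
  \<open>shifted_kernel_series\<close> for the truncation operator.\<close>

lemma qce_kernel_properties:
  assumes \<xi>: "\<xi> \<in> L2X M T X" and dec: "decomposes \<xi> f"
  shows "kernel f n \<in> sym n"
    and "(\<lambda>n. kernel f n \<bullet> tpow n h) sums S_transform M I \<xi> (stopped T emb r (h + c) - c)"
proof -
  let ?A = "truncation T emb r" and ?b = "stopped T emb r c - c"
  have A: "bounded_linear ?A" using truncation_properties[OF indef r] by (simp add: is_truncation_def)
  obtain K where K: "0 \<le> K" "\<And>x. norm (?A x) \<le> K * norm x"
    using bounded_linear.nonneg_bounded[OF A] by (auto simp: mult.commute)
  have f: "\<And>k. f k \<in> sym k" using dec by (simp add: chaos_decomposition_def)
  note fs = chaos_decomposition_summable[OF \<xi> dec]
  have stopped: "x \<bullet> stopped T emb r h = ?A x \<bullet> h" for x h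
    unfolding stopped_def by (rule inner_adjoint[OF A])
  have "stopped T emb r (h + c) = stopped T emb r h + stopped T emb r c"
  proof -
    have "x \<bullet> (stopped T emb r (h + c) - (stopped T emb r h + stopped T emb r c)) = 0" for x
      by (simp add: inner_diff_right inner_add_right stopped)
    from this[of "stopped T emb r (h + c) - (stopped T emb r h + stopped T emb r c)"] show ?thesis by simp
  qed
  then have shift: "stopped T emb r (h + c) - c = stopped T emb r h + ?b" by simp
  have ker: "kernel f = shifted_kernel ?A ?b f"
    by (rule ext) (simp add: qce_kernel_def shifted_kernel_def[OF A K] contract_map_def)
  show "kernel f n \<in> sym n"
    unfolding ker by (rule shifted_kernel_in_sym_power[OF A K f fs])
  show "(\<lambda>n. kernel f n \<bullet> tpow n h) sums S_transform M I \<xi> (stopped T emb r (h + c) - c)"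
    unfolding ker shift
    by (rule shifted_kernel_series[OF A K f fs stopped S_transform_chaos[OF \<xi> dec]])
qed

text \<open>The kernels of \<open>\<eta>\<close> and the shifted kernels of \<open>\<xi>\<close> give the same series for the $S$-transform of \<open>\<eta>\<close>.\<close>

lemma is_qce_chaos:
  assumes \<xi>: "\<xi> \<in> L2X M T X" and dec: "decomposes \<xi> f"
    and q: "is_qce M T X emb I c r \<xi> \<eta>"
  shows "decomposes \<eta> (kernel f)"
proof -
  have \<eta>: "\<eta> \<in> L2X M T X"
    and S: "\<And>h. S_transform M I \<xi> (stopped T emb r (h + c) - c) = S_transform M I \<eta> h"
    using q by (auto simp: is_qce_def)
  obtain g where g: "decomposes \<eta> g" using chaos_decomposition_exists[OF \<eta>] .
  have "kernel f k = g k" for k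
  proof (rule S_transform_determines_kernels)
    show "kernel f k \<in> sym k" for k by (rule qce_kernel_properties(1)[OF \<xi> dec])
    show "g k \<in> sym k" for k using g by (simp add: chaos_decomposition_def)
    show "(\<lambda>k. kernel f k \<bullet> tpow k h) sums S_transform M I \<eta> h" for h
      using qce_kernel_properties(2)[OF \<xi> dec, of h] by (simp only: S)
    show "(\<lambda>k. g k \<bullet> tpow k h) sums S_transform M I \<eta> h" for h by (rule S_transform_chaos[OF \<eta> g])
  qed
  then have "kernel f = g" by (rule ext)
  with g show ?thesis by simp
qed

lemma qce_domain_iff:
  assumes \<xi>: "\<xi> \<in> L2X M T X" and dec: "decomposes \<xi> f"
  shows "\<xi> \<in> qce_domain M T X emb I c r \<longleftrightarrow>
    summable (\<lambda>k. fact k * (norm (kernel f k))\<^sup>2)"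
proof
  assume "\<xi> \<in> qce_domain M T X emb I c r"
  then obtain \<eta> where q: "is_qce M T X emb I c r \<xi> \<eta>" by (auto simp: qce_domain_def)
  then have "\<eta> \<in> L2X M T X" by (simp add: is_qce_def)
  then show "summable (\<lambda>k. fact k * (norm (kernel f k))\<^sup>2)"
    using is_qce_chaos[OF \<xi> dec q] by (rule chaos_decomposition_summable)
next
  let ?g = "kernel f"
  assume "summable (\<lambda>k. fact k * (norm (?g k))\<^sup>2)"
  then obtain \<eta> where \<eta>: "\<eta> \<in> L2X M T X" "L2_sums M (\<lambda>k. J k (?g k)) \<eta>"
    by (rule chaos_series_converges[OF qce_kernel_properties(1)[OF \<xi> dec]])
  then have "decomposes \<eta> ?g"
    using qce_kernel_properties(1)[OF \<xi> dec] by (simp add: chaos_decomposition_def)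
  then have "S_transform M I \<xi> (stopped T emb r (h + c) - c) = S_transform M I \<eta> h" for h
    using S_transform_chaos[OF \<eta>(1)] qce_kernel_properties(2)[OF \<xi> dec] sums_unique2 by blast
  with \<xi> \<eta>(1) show "\<xi> \<in> qce_domain M T X emb I c r" by (auto simp: qce_domain_def is_qce_def)
qed

end

end

theorem theorem4p13:
  fixes M :: "'w measure"
    and T :: real
    and X :: "real \<Rightarrow> 'w \<Rightarrow> real"
    and emb :: "(real \<Rightarrow> real) \<Rightarrow> 'h::{real_inner,banach}"
    and I :: "'h \<Rightarrow> 'w \<Rightarrow> real"
    and tens :: "'h list \<Rightarrow> 't::{real_inner,banach}"
    and J :: "nat \<Rightarrow> 't \<Rightarrow> 'w \<Rightarrow> real"
    and c :: 'h
    and r :: real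
  assumes "0 < T"
    and "prob_space M" and "complete_measure M"
    and "measurable_centered_gaussian_process M T X"
    and "AE \<omega> in M. X 0 \<omega> = 0"
    and "integrand_space M T X emb"
    and "wiener_integral M T X emb I"
    and "hilbert_tensor_powers tens"
    and "multiple_wiener_integral M T X I tens J"
    and "has_indefinite_wiener_integral T emb"
    and "r \<in> {0..T}"
  shows
    "qce_domain M T X emb I c r =
       {\<xi> \<in> L2X M T X. \<exists>f. chaos_decomposition M tens J \<xi> f \<and>
          summable (\<lambda>k. fact k * (norm (qce_kernel T emb tens c r f k))\<^sup>2)}
     \<and> (\<forall>\<xi>\<in>qce_domain M T X emb I c r. \<forall>f. chaos_decomposition M tens J \<xi> f \<longrightarrow>
          L2_sums M (\<lambda>k. J k (qce_kernel T emb tens c r f k)) (qce M T X emb I c r \<xi>))"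
proof -
  interpret chaos_space M T X emb I tens J
    by (intro chaos_space.intro wiener_integral_space.intro tensor_powers.intro chaos_space_axioms.intro)
      (fact assms)+
  note indef = \<open>has_indefinite_wiener_integral T emb\<close> and r = \<open>r \<in> {0..T}\<close>
  have L2X: "\<xi> \<in> L2X M T X" if "\<xi> \<in> qce_domain M T X emb I c r" for \<xi>
    using that by (simp add: qce_domain_def)
  show ?thesis
  proof (intro conjI ballI allI impI set_eqI iffI)
    fix \<xi> assume \<xi>: "\<xi> \<in> qce_domain M T X emb I c r"
    obtain f where f: "chaos_decomposition M tens J \<xi> f"
      using chaos_decomposition_exists[OF L2X[OF \<xi>]] .
    show "\<xi> \<in> {\<xi> \<in> L2X M T X. \<exists>f. chaos_decomposition M tens J \<xi> f \<and>
        summable (\<lambda>k. fact k * (norm (qce_kernel T emb tens c r f k))\<^sup>2)}"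
      using L2X[OF \<xi>] f qce_domain_iff[OF indef r L2X[OF \<xi>] f] \<xi> by blast
  next
    fix \<xi> assume "\<xi> \<in> {\<xi> \<in> L2X M T X. \<exists>f. chaos_decomposition M tens J \<xi> f \<and>
        summable (\<lambda>k. fact k * (norm (qce_kernel T emb tens c r f k))\<^sup>2)}"
    then show "\<xi> \<in> qce_domain M T X emb I c r" using qce_domain_iff[OF indef r] by blast
  next
    fix \<xi> f assume \<xi>: "\<xi> \<in> qce_domain M T X emb I c r" and f: "chaos_decomposition M tens J \<xi> f"
    have "\<exists>\<eta>. is_qce M T X emb I c r \<xi> \<eta>" using \<xi> by (simp add: qce_domain_def)
    then have "is_qce M T X emb I c r \<xi> (qce M T X emb I c r \<xi>)"
      unfolding qce_def by (rule someI_ex)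
    from is_qce_chaos[OF indef r L2X[OF \<xi>] f this]
    show "L2_sums M (\<lambda>k. J k (qce_kernel T emb tens c r f k)) (qce M T X emb I c r \<xi>)"
      by (simp add: chaos_decomposition_def)
  qed
qed

end
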